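(* Let $F_n$ be a maximizer of the extremal problem, let $(\mathbf a,\mathbf b)$ be the gap containing $x_*$, and let $D_n^0=(F_n)_0+D_n^\infty-(F_n)_\infty$. Then: (i) every $x$ with $D_n^0(x)>0$ lies in $\overline{\mathbb R}$; (ii) $F_n$ is real; (iii) for any distinct $x_1,x_2\in\overline{\mathbb R}$ with $D_n^0(x_1)\ge1$, $D_n^0(x_2)\ge1$, there is $y\in\mathsf E\cap(x_1,x_2)$ with $|F_n(y)|=1$; (iv) $D_n^0\le1$; (v) each gap contains at most one point $x$ with $D_n^0(x)>0$; (vi) $D_n^0(x)=0$ for all $x\in(\mathbf a,\mathbf b)$; (vii) the maximizer is unique; (viii) if $F_n$ is nonconstant, then $\{z\in\overline{\mathbb C}:F_n(z)\in[-1,1]\}\subset\overline{\mathbb R}$; in particular all solutions of $F_n(z)=\pm1$ lie in $\overline{\mathbb R}$; (ix) if $F_n$ is nonconstant of degree $m$, then $F_n^{-1}((-1,1))$ has exactly $m$ connected components (open bands), $F_n$ is strictly monotone on each of them (with respect to the cyclic orientation of $\overline{\mathbb R}$) and maps each onto $(-1,1)$, and the endpoints of the open bands are exactly all the points where $F_n=\pm1$; (x) $F_n(\mathbf a)=(-1)^{\sum_{\mathbf c\in(\mathbf a,x_* )}D_n^\infty(\mathbf c)}$ and $F_n(\mathbf b)=(-1)^{\sum_{\mathbf c\in[x_*,\mathbf b)}D_n^\infty(\mathbf c)}$; (xi) for any gap $(\mathbf a_i,\mathbf b_i)$ containing a point $\mathbf c_i$ with $D_n^\infty(\mathbf c_i)>0$,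 at least one of $|F_n(\mathbf a_i)|=1$, $|F_n(\mathbf b_i)|=1$ holds; and if moreover $D_n^0(\mathbf c_i)=1$, then $|F_n(\mathbf a_i)|=|F_n(\mathbf b_i)|=1$.
   Context: Let $\mathsf E\subset\overline{\mathbb R}$ be a compact proper subset with infinitely many points; gaps are connected components of $\overline{\mathbb R}\setminus\mathsf E$, each of the form $(\mathbf a,\mathbf b)$ with $\mathbf a,\mathbf b\in\mathsf E$ in cyclic interval notation: a sequence $(t_0,\dots,t_m)$, $m\ge 2$, is cyclically ordered if it has no repetitions and some $f\in\mathrm{PSL}(2,\mathbb R)$ satisfies $f(t_0)=\infty$, $f(t_1)<\dots<f(t_m)$; for distinct $a,b$, $(a,b)=\{c:(a,c,b)\text{ cyclically ordered}\}$, $[a,b)=(a,b)\cup\{a\}$. Divisors are finitely supported $D:\overline{\mathbb C}\to\mathbb Z$, integral if $D\ge0$; for rational $f$, $(f)_\infty$ and $(f)_0$ are its polar and zero divisors ($0$ for constants) and $\deg f=\deg(f)_\infty$; $\mathcal L(D)=\{f\text{ rational}:(f)_\infty\le D\}$. For $\mathbf c\in\overline{\mathbb R}$, $r(z,\mathbf c)=1/(\mathbf c-z)$ if $\mathbf c\neq\infty$, $r(z,\infty)=z$. Fix $n\ge1$, an integral divisor $D_n^\infty$ of degree $n$ supported in $\overline{\mathbb R}\setminus\mathsf E$, and $x_*\in\overline{\mathbb R}\setminus\mathsf E$; $d_n=D_n^\infty(x_* )$, $\mathcal L_n=\mathcal L(D_n^\infty)$. The extremal problem maximizes $\Re\lim_{x\to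 x_*}F(x)/r(x,x_* )^{d_n}$ over $F\in\mathcal L_n$ with $\sup_{\mathsf E}|F|\le1$. A function is real if $F(\bar z)=\overline{F(z)}$. *)

theory Defs
  imports "HOL-Analysis.Analysis" "HOL-Computational_Algebra.Polynomial_Factorial"
begin

text \<open>The Riemann sphere is modelled as complex option, None being the point at infinity.
  The extended real line is the subset consisting of None and the real points.\<close>

definition Rbar :: "complex option set" where
  "Rbar = insert None ((\<lambda>t. Some (complex_of_real t)) ` UNIV)"

text \<open>Topology: the sphere is identified with the unit sphere in R^3 via inverse
  stereographic projection; all topological notions (compactness, components, closure)
  are taken through this injective map.\<close>

definition sph :: "complex option \<Rightarrow> real \<times> real \<times> real" where
  "sph x = (case x of
      None \<Rightarrow> (0, 0, 1)
    | Some z \<Rightarrow> (2 * Re z / (1 + (cmod z)^2), 2 * Im z / (1 + (cmod z)^2),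
                 ((cmod z)^2 - 1) / ((cmod z)^2 + 1)))"

text \<open>Action of an element of PSL(2,R), given by real a b c d with ad - bc = 1.\<close>

definition mob :: "real \<Rightarrow> real \<Rightarrow> real \<Rightarrow> real \<Rightarrow> complex option \<Rightarrow> complex option" where
  "mob a b c d x = (case x of
      None \<Rightarrow> (if c = 0 then None else Some (complex_of_real (a / c)))
    | Some z \<Rightarrow> (if of_real c * z + of_real d = 0 then None
                 else Some ((of_real a * z + of_real b) / (of_real c * z + of_real d))))"

definition cyc_ordered :: "complex option list \<Rightarrow> bool" where
  "cyc_ordered ts \<longleftrightarrow> length ts \<ge> 3 \<and> distinct ts \<and> set ts \<subseteq> Rbar \<and>
     (\<exists>a b c d. a * d - b * c = 1 \<and> mob a b c d (hd ts) = None \<and>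
        (\<forall>t \<in> set (tl ts). mob a b c d t \<noteq> None) \<and>
        sorted_wrt (<) (map (\<lambda>t. Re (the (mob a b c d t))) (tl ts)))"

definition cint :: "complex option \<Rightarrow> complex option \<Rightarrow> complex option set" where
  "cint a b = {c. cyc_ordered [a, c, b]}"

definition cint_lc :: "complex option \<Rightarrow> complex option \<Rightarrow> complex option set" where
  "cint_lc a b = insert a (cint a b)"

definition is_gap :: "complex option set \<Rightarrow> complex option \<Rightarrow> complex option \<Rightarrow> bool" where
  "is_gap E a b \<longleftrightarrow> a \<in> E \<and> b \<in> E \<and> a \<noteq> b \<and>
     sph ` (cint a b) \<in> components (sph ` (Rbar - E))"

definition eval_rat :: "complex poly \<Rightarrow> complex poly \<Rightarrow> complex option \<Rightarrow> complex option" where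
  "eval_rat p q x = (case x of
      None \<Rightarrow> (if degree p > degree q then None
               else if degree p = degree q then Some (lead_coeff p / lead_coeff q)
               else Some 0)
    | Some z \<Rightarrow> (if poly q z = 0 then None else Some (poly p z / poly q z)))"

definition rat_rep :: "complex poly \<Rightarrow> complex poly \<Rightarrow> (complex option \<Rightarrow> complex option) \<Rightarrow> bool" where
  "rat_rep p q F \<longleftrightarrow> q \<noteq> 0 \<and> coprime p q \<and> F = eval_rat p q"

definition is_ratfun :: "(complex option \<Rightarrow> complex option) \<Rightarrow> bool" where
  "is_ratfun F \<longleftrightarrow> (\<exists>p q. rat_rep p q F)"

text \<open>A (reduced) representation; orders below do not depend on the choice.\<close>

definition rep :: "(complex option \<Rightarrow> complex option) \<Rightarrow> complex poly \<times> complex poly" where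
  "rep F = (SOME pq. rat_rep (fst pq) (snd pq) F)"

definition polar_div :: "(complex option \<Rightarrow> complex option) \<Rightarrow> complex option \<Rightarrow> int" where
  "polar_div F x = (case rep F of (p, q) \<Rightarrow>
     (case x of None \<Rightarrow> max 0 (int (degree p) - int (degree q))
              | Some z \<Rightarrow> int (order z q)))"

text \<open>Zero divisor (F)_0 (zero for constant functions, in particular for F = 0).\<close>

definition zero_div :: "(complex option \<Rightarrow> complex option) \<Rightarrow> complex option \<Rightarrow> int" where
  "zero_div F x = (case rep F of (p, q) \<Rightarrow>
     (if p = 0 then 0 else
       (case x of None \<Rightarrow> max 0 (int (degree q) - int (degree p))
                | Some z \<Rightarrow> int (order z p))))"

text \<open>Divisors are finitely supported integer-valued functions on the sphere.\<close>

definition div_deg :: "(complex option \<Rightarrow> int) \<Rightarrow> int" where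
  "div_deg D = sum D {x. D x \<noteq> 0}"

definition rat_deg :: "(complex option \<Rightarrow> complex option) \<Rightarrow> int" where
  "rat_deg F = div_deg (polar_div F)"

definition Lspace :: "(complex option \<Rightarrow> int) \<Rightarrow> (complex option \<Rightarrow> complex option) set" where
  "Lspace D = {F. is_ratfun F \<and> (\<forall>x. polar_div F x \<le> D x)}"

definition is_real_fun :: "(complex option \<Rightarrow> complex option) \<Rightarrow> bool" where
  "is_real_fun F \<longleftrightarrow> (\<forall>z. F (map_option cnj z) = map_option cnj (F z))"

text \<open>Finite part of F as a complex function (poles sent to 0; irrelevant for limits).\<close>

definition fval :: "(complex option \<Rightarrow> complex option) \<Rightarrow> complex \<Rightarrow> complex" where
  "fval F z = (case F (Some z) of Some w \<Rightarrow> w | None \<Rightarrow> 0)"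

text \<open>Re lim_{x -> x_*} F(x) / r(x,x_*)^d, with r(z,c) = 1/(c-z) and r(z,infinity) = z.\<close>

definition objective :: "complex option \<Rightarrow> nat \<Rightarrow> (complex option \<Rightarrow> complex option) \<Rightarrow> real" where
  "objective xs d F = Re (case xs of
      None \<Rightarrow> Lim at_infinity (\<lambda>z. fval F z / z ^ d)
    | Some c \<Rightarrow> Lim (at c) (\<lambda>z. fval F z / (1 / (c - z)) ^ d))"

definition admissible :: "complex option set \<Rightarrow> (complex option \<Rightarrow> int) \<Rightarrow> (complex option \<Rightarrow> complex option) set" where
  "admissible E D = {F \<in> Lspace D. \<forall>x \<in> E. \<exists>w. F x = Some w \<and> cmod w \<le> 1}"

definition is_maximizer :: "complex option set \<Rightarrow> (complex option \<Rightarrow> int) \<Rightarrow> complex option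
     \<Rightarrow> (complex option \<Rightarrow> complex option) \<Rightarrow> bool" where
  "is_maximizer E D xs F \<longleftrightarrow> F \<in> admissible E D \<and>
     (\<forall>G \<in> admissible E D. objective xs (nat (D xs)) G \<le> objective xs (nat (D xs)) F)"

definition div0 :: "(complex option \<Rightarrow> complex option) \<Rightarrow> (complex option \<Rightarrow> int) \<Rightarrow> complex option \<Rightarrow> int" where
  "div0 F D x = zero_div F x + D x - polar_div F x"

definition abs_one :: "(complex option \<Rightarrow> complex option) \<Rightarrow> complex option \<Rightarrow> bool" where
  "abs_one F x \<longleftrightarrow> (\<exists>w. F x = Some w \<and> cmod w = 1)"

definition is_const :: "(complex option \<Rightarrow> complex option) \<Rightarrow> bool" where
  "is_const F \<longleftrightarrow> (\<exists>c. \<forall>z. F z = c)"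

definition cyc_strict_mono_on :: "complex option set \<Rightarrow> (complex option \<Rightarrow> complex option) \<Rightarrow> bool" where
  "cyc_strict_mono_on B F \<longleftrightarrow>
     (\<forall>x\<in>B. \<forall>y\<in>B. \<forall>z\<in>B. cyc_ordered [x, y, z] \<longrightarrow> cyc_ordered [F x, F y, F z]) \<or>
     (\<forall>x\<in>B. \<forall>y\<in>B. \<forall>z\<in>B. cyc_ordered [x, y, z] \<longrightarrow> cyc_ordered [F z, F y, F x])"

definition real_preim :: "(complex option \<Rightarrow> complex option) \<Rightarrow> real set \<Rightarrow> complex option set" where
  "real_preim F S = {z. \<exists>t \<in> S. F z = Some (complex_of_real t)}"

definition bands :: "(complex option \<Rightarrow> complex option) \<Rightarrow> complex option set set" where
  "bands F = (\<lambda>C. sph -` C) ` components (sph ` real_preim F {-1<..<1})"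

definition endpoints :: "complex option set \<Rightarrow> complex option set" where
  "endpoints B = {z. sph z \<in> closure (sph ` B)} - B"

end

theory Submission
  imports Defs "HOL-Computational_Algebra.Fundamental_Theorem_Algebra" "HOL-Computational_Algebra.Field_as_Ring"
begin

text \<open>
  A Moebius map moves \<open>x\<^sub>*\<close> to infinity. Then \<open>E\<close> becomes a compact set \<open>K\<close> of reals, elements of
  \<open>\<L>\<^sub>n\<close> become quotients \<open>P / Q\<close> with \<open>degree P \<le> n\<close>, where \<open>Q\<close> is the monic real polynomial with the finite
  part of \<open>D\<^sub>n\<close> as zeros, and the objective becomes the real part of the coefficient of \<open>z\<^sup>n\<close> in \<open>P\<close>.
  If \<open>U / Q\<close> is a real maximizer and \<open>degree S < n\<close>, then \<open>U S \<le> 0\<close> somewhere on the set \<open>X\<close> of points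
  of \<open>K\<close> with \<open>\<bar>U\<bar> = \<bar>Q\<bar>\<close>. Taking \<open>S = \<plusminus>U / W\<close> for a real divisor \<open>W\<close> of \<open>U\<close> of degree one or two shows
  that all zeros of \<open>U\<close> are real and simple, and that \<open>X\<close> has points between any two of them and on both sides of
  each. So \<open>X\<close> has \<open>n + 1\<close> points, which forces the imaginary part of a maximizer and the difference of
  two maximizers to vanish. Finally, after cancellation \<open>U / Q = p / q\<close>, there is for each \<open>\<bar>t\<bar> < 1\<close> a
  solution of \<open>p = t q\<close> in the band around each of the \<open>degree p\<close> zeros of \<open>p\<close>, hence there are no other solutions.
\<close>


section \<open>The extremal problem for real polynomials\<close>

text \<open>With the extremal point at infinity the objective is a leading coefficient, so every
  perturbation of lower degree leaves it unchanged. Positivity of that coefficient gives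
  \<open>degree U = n\<close>, hence all n points counted by \<open>div0\<close> are finite, and the
  gap of the extremal point becomes the complement of the convex hull of K.

  The obstacle is cancellation: \<open>U\<close> and \<open>Q\<close> share a zero where F has a
  smaller pole than D allows. Such a point counts in \<open>div0\<close> without being a zero of F.
  Statements on divisors therefore use \<open>U\<close>, statements on values use the reduced
  \<open>p / q\<close>; the zeros of \<open>p\<close> are zeros of \<open>U\<close>, so they still
  interlace with points where \<open>p / q\<close> is 1 or -1.

  Counting takes the place of derivatives: p = t q has at most \<open>degree p\<close> solutions,
  and each band holds one. At |t| = 1 this count fails, since bands may touch and infinity might be
  a solution. Both cases are settled by factoring p - t q over its known roots and letting |t| tend
  to 1.\<close>

abbreviation cpoly :: "real poly \<Rightarrow> complex poly" where
  "cpoly \<equiv> map_poly complex_of_real"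

section \<open>Real polynomials with a complex argument\<close>

lemma coeff_cpoly [simp]: "coeff (cpoly p) k = of_real (coeff p k)"
  by (simp add: coeff_map_poly)

lemma degree_cpoly [simp]: "degree (cpoly p) = degree p"
  by (simp add: degree_map_poly)

lemma cpoly_eq_0_iff [simp]: "cpoly p = 0 \<longleftrightarrow> p = 0"
  by (auto simp: poly_eq_iff)

lemma cpoly_mult: "cpoly (p * q) = cpoly p * cpoly q"
  by (rule poly_eqI) (simp add: coeff_mult)

lemma cpoly_add: "cpoly (p + q) = cpoly p + cpoly q"
  by (rule poly_eqI) simp

lemma cpoly_diff: "cpoly (p - q) = cpoly p - cpoly q"
  by (rule poly_eqI) simp

lemma cpoly_smult: "cpoly (smult c p) = smult (of_real c) (cpoly p)"
  by (rule poly_eqI) simp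

lemma cpoly_power: "cpoly (p ^ k) = cpoly p ^ k"
  by (induction k) (simp_all add: cpoly_mult)

lemma cpoly_prod: "cpoly (\<Prod>i\<in>A. f i) = (\<Prod>i\<in>A. cpoly (f i))"
  by (induction A rule: infinite_finite_induct) (simp_all add: cpoly_mult)

lemma cpoly_linear: "cpoly [:a, b:] = [:of_real a, of_real b:]"
  by (simp add: map_poly_pCons)

lemma pderiv_cpoly: "pderiv (cpoly p) = cpoly (pderiv p)"
  by (rule poly_eqI) (simp add: coeff_pderiv)

lemma poly_cpoly_of_real [simp]: "poly (cpoly p) (of_real x) = of_real (poly p x)"
  by (simp add: poly_altdef)

text \<open>Every z has a point of Y before the next element of Z; these points increase with z, and
  one more lies left of \<open>Min Z\<close>. Applied to n zeros this gives n + 1 points, one more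
  than a nonzero polynomial of degree n can vanish at.\<close>

lemma interlacing_card:
  fixes Z Y :: "'a::linorder set"
  assumes Z: "finite Z" "Z \<noteq> {}"
    and left: "\<And>z. z \<in> Z \<Longrightarrow> \<exists>y\<in>Y. y < z" and right: "\<And>z. z \<in> Z \<Longrightarrow> \<exists>y\<in>Y. z < y"
    and between: "\<And>z z'. z \<in> Z \<Longrightarrow> z' \<in> Z \<Longrightarrow> z < z' \<Longrightarrow> \<exists>y\<in>Y. z < y \<and> y < z'"
  shows "\<exists>Y'\<subseteq>Y. finite Y' \<and> card Y' = Suc (card Z)"
proof -
  have "\<exists>y\<in>Y. z < y \<and> (\<forall>z'\<in>Z. z < z' \<longrightarrow> y < z')" if z: "z \<in> Z" for z
  proof (cases "\<exists>z'\<in>Z. z < z'")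
    case True
    define w where "w = Min {z'\<in>Z. z < z'}"
    have "w \<in> {z'\<in>Z. z < z'}" unfolding w_def using True Z by (intro Min_in) auto
    moreover have "w \<le> z'" if "z' \<in> Z" "z < z'" for z'
      unfolding w_def using that Z by (intro Min_le) auto
    ultimately show ?thesis using between[OF z, of w] by fastforce
  next
    case False
    then show ?thesis using right[OF z] by auto
  qed
  then obtain f where f: "\<And>z. z \<in> Z \<Longrightarrow> f z \<in> Y \<and> z < f z \<and> (\<forall>z'\<in>Z. z < z' \<longrightarrow> f z < z')"
    by metis
  have mono: "f z < f z'" if "z \<in> Z" "z' \<in> Z" "z < z'" for z z'
    using f[OF that(1)] f[OF that(2)] that by fastforce
  have inj: "inj_on f Z"
    by (rule inj_onI) (metis mono linorder_neqE less_irrefl)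
  obtain y0 where y0: "y0 \<in> Y" "y0 < Min Z" using left[of "Min Z"] Z by auto
  have "y0 < z" if "z \<in> Z" for z
    using y0(2) Min_le[OF Z(1) that] by simp
  then have "y0 < f z" if "z \<in> Z" for z using f[OF that] that less_trans by blast
  then have "y0 \<notin> f ` Z" by auto
  then have "card (insert y0 (f ` Z)) = Suc (card Z)"
    using Z inj by (simp add: card_image)
  moreover have "insert y0 (f ` Z) \<subseteq> Y" using y0 f by auto
  ultimately show ?thesis using Z by blast
qed

lemma two_roots_dvd:
  fixes p :: "'a::idom poly"
  assumes "poly p x = 0" "poly p y = 0" "x \<noteq> y"
  shows "[:-x, 1:] * [:-y, 1:] dvd p"
proof -
  obtain r where r: "p = [:-x, 1:] * r" using assms(1) by (auto simp: poly_eq_0_iff_dvd elim: dvdE)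
  then have "poly r y = 0" using assms by auto
  then show ?thesis unfolding r by (intro mult_dvd_mono dvd_refl) (simp add: poly_eq_0_iff_dvd)
qed

text \<open>The condition |U| <= |Q| stands for |U / Q| <= 1 and treats common zeros of U and Q like
  any other zeros of U. Competitors are real here; complex ones are reduced to this case in
  \<open>complex_extremal\<close>.\<close>

locale extremal_poly =
  fixes K :: "real set" and Q U :: "real poly" and n :: nat
  assumes n_pos: "n \<ge> 1" and compact_K: "compact K" and infinite_K: "infinite K"
    and Q_nz: "\<And>x. x \<in> K \<Longrightarrow> poly Q x \<noteq> 0"
    and degree_U: "degree U \<le> n"
    and bound: "\<And>x. x \<in> K \<Longrightarrow> \<bar>poly U x\<bar> \<le> \<bar>poly Q x\<bar>"
    and maximal: "\<And>W. degree W \<le> n \<Longrightarrow> (\<And>x. x \<in> K \<Longrightarrow> \<bar>poly W x\<bar> \<le> \<bar>poly Q x\<bar>) \<Longrightarrow>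
      coeff W n \<le> coeff U n"
begin

section \<open>Perturbation of an extremal polynomial\<close>

lemma K_nonempty: "K \<noteq> {}"
  using infinite_K by auto

lemma coeff_U_pos: "coeff U n > 0"
proof -
  have "continuous_on K (\<lambda>x. \<bar>poly Q x\<bar>)" by (intro continuous_intros)
  then obtain x0 where x0: "x0 \<in> K" "\<And>x. x \<in> K \<Longrightarrow> \<bar>poly Q x0\<bar> \<le> \<bar>poly Q x\<bar>"
    using continuous_attains_inf[OF compact_K K_nonempty] by blast
  define \<eta> where "\<eta> = \<bar>poly Q x0\<bar>"
  have \<eta>: "\<eta> > 0" using Q_nz[OF x0(1)] by (simp add: \<eta>_def)
  obtain M where M: "M > 0" "\<And>x. x \<in> K \<Longrightarrow> \<bar>x\<bar> \<le> M"
    using compact_imp_bounded[OF compact_K] by (auto simp: bounded_pos)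
  \<comment> \<open>A competitor with positive leading coefficient: |x| <= M on K gives |W| <=
    \<eta>, the minimum of |Q| on K.\<close>
  define W where "W = monom (\<eta> / M ^ n) n"
  have "\<bar>poly W x\<bar> \<le> \<bar>poly Q x\<bar>" if "x \<in> K" for x
  proof -
    have "\<bar>x\<bar> ^ n \<le> M ^ n" using M that by (intro power_mono) auto
    then have "\<bar>poly W x\<bar> \<le> \<eta>"
      using M \<eta> by (simp add: W_def poly_monom abs_mult power_abs field_simps mult_left_mono)
    then show ?thesis using x0(2)[OF that] by (simp add: \<eta>_def)
  qed
  from maximal[OF _ this] have "coeff W n \<le> coeff U n"
    by (simp add: W_def degree_monom_le)
  then show ?thesis using M \<eta> by (simp add: W_def) (smt (verit) divide_pos_pos zero_less_power)
qed

lemma degree_U_eq: "degree U = n"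
  using degree_U coeff_U_pos le_degree by (metis antisym less_irrefl)

lemma U_nz: "U \<noteq> 0"
  using coeff_U_pos by auto

text \<open>Kolmogorov's criterion: otherwise \<open>U - \<epsilon> S\<close>, which has the same leading coefficient,
  would be strictly smaller than \<open>Q\<close> on \<open>K\<close>, and could be scaled up.\<close>

lemma kolmogorov:
  assumes S: "degree S < n"
  shows "\<exists>y\<in>K. \<bar>poly U y\<bar> = \<bar>poly Q y\<bar> \<and> poly U y * poly S y \<le> 0"
proof (rule ccontr)
  assume "\<not> ?thesis"
  then have pos: "poly U y * poly S y > 0" if "y \<in> K" "\<bar>poly U y\<bar> = \<bar>poly Q y\<bar>" for y
    using that by force
  \<comment> \<open>Where |U| < |Q| the first entry is positive, where |U| = |Q| the second one is.
    Taking the maximum gives one continuous positive function, so compactness yields a uniform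
    \<eta> without choosing a neighbourhood of the contact set.\<close>
  define h where "h y = max ((poly Q y)\<^sup>2 - (poly U y)\<^sup>2) (poly U y * poly S y)" for y
  have "continuous_on K h" unfolding h_def by (intro continuous_intros)
  then obtain y0 where y0: "y0 \<in> K" "\<And>y. y \<in> K \<Longrightarrow> h y0 \<le> h y"
    using continuous_attains_inf[OF compact_K K_nonempty] by blast
  define \<eta> where "\<eta> = h y0"
  have \<eta>: "\<eta> > 0"
  proof (cases "\<bar>poly U y0\<bar> = \<bar>poly Q y0\<bar>")
    case True
    then show ?thesis using pos[OF y0(1)] by (simp add: \<eta>_def h_def)
  next
    case False
    then have "\<bar>poly U y0\<bar> < \<bar>poly Q y0\<bar>" using bound[OF y0(1)] by simp
    then have "(poly U y0)\<^sup>2 < (poly Q y0)\<^sup>2"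
      by (meson abs_le_square_iff not_le)
    then show ?thesis by (simp add: \<eta>_def h_def less_max_iff_disj)
  qed
  have "continuous_on K (\<lambda>y. max (\<bar>poly U y * poly S y\<bar>) ((poly S y)\<^sup>2))"
    by (intro continuous_intros)
  then obtain y1 where y1: "y1 \<in> K" "\<And>y. y \<in> K \<Longrightarrow>
      max (\<bar>poly U y * poly S y\<bar>) ((poly S y)\<^sup>2) \<le> max (\<bar>poly U y1 * poly S y1\<bar>) ((poly S y1)\<^sup>2)"
    using continuous_attains_sup[OF compact_K K_nonempty] by blast
  define M where "M = max (\<bar>poly U y1 * poly S y1\<bar>) ((poly S y1)\<^sup>2) + 1"
  have M: "\<bar>poly U y * poly S y\<bar> \<le> M" "(poly S y)\<^sup>2 \<le> M" if "y \<in> K" for y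
    using y1(2)[OF that] by (auto simp: M_def)
  have Mpos: "M > 0" by (auto simp: M_def add_nonneg_pos le_max_iff_disj)
  \<comment> \<open>The bound \<epsilon> M < \<eta> / 3 serves both cases: if U S >= \<eta>, the
    term \<epsilon> S^2 stays below 2 U S; if Q^2 - U^2 >= \<eta>, the change of at most 3
    \<epsilon> M cannot use up \<eta>.\<close>
  define \<epsilon> where "\<epsilon> = min 1 (\<eta> / (4 * M))"
  have \<epsilon>: "\<epsilon> > 0" "\<epsilon> \<le> 1" "\<epsilon> * M < \<eta> / 3"
    using \<eta> Mpos by (auto simp: \<epsilon>_def min_def field_simps)
  define W where "W = U - smult \<epsilon> S"
  have less: "(poly W y)\<^sup>2 < (poly Q y)\<^sup>2" if y: "y \<in> K" for y
  proof -
    have eq: "(poly Q y)\<^sup>2 - (poly W y)\<^sup>2 =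
      ((poly Q y)\<^sup>2 - (poly U y)\<^sup>2) + \<epsilon> * (2 * (poly U y * poly S y) - \<epsilon> * (poly S y)\<^sup>2)"
      by (simp add: W_def power2_eq_square algebra_simps)
    have s: "\<epsilon> * (poly S y)\<^sup>2 \<le> \<epsilon> * M" using M(2)[OF y] \<epsilon> by (simp add: mult_left_mono)
    have "(poly U y)\<^sup>2 \<le> (poly Q y)\<^sup>2" using bound[OF y] by (simp add: abs_le_square_iff)
    moreover have "\<eta> \<le> h y" using y0(2)[OF y] by (simp add: \<eta>_def)
    ultimately consider "(poly U y)\<^sup>2 \<le> (poly Q y)\<^sup>2" "\<eta> \<le> poly U y * poly S y"
      | "(poly Q y)\<^sup>2 - (poly U y)\<^sup>2 \<ge> \<eta>"
      by (auto simp: h_def le_max_iff_disj)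
    then have "(poly Q y)\<^sup>2 - (poly W y)\<^sup>2 > 0"
    proof cases
      case 1
      then have "2 * (poly U y * poly S y) - \<epsilon> * (poly S y)\<^sup>2 > 0" using s \<epsilon> \<eta> by argo
      then have "\<epsilon> * (2 * (poly U y * poly S y) - \<epsilon> * (poly S y)\<^sup>2) > 0"
        using \<epsilon> by simp
      then show ?thesis using eq 1 by linarith
    next
      case 2
      have "\<epsilon> * (poly S y)\<^sup>2 \<le> M"
        by (smt (verit) M(2)[OF y] \<epsilon> Mpos mult_left_le_one_le s zero_le_power2)
      then have "2 * (poly U y * poly S y) - \<epsilon> * (poly S y)\<^sup>2 \<ge> - (3 * M)"
        using M(1)[OF y] by argo
      then have "\<epsilon> * (2 * (poly U y * poly S y) - \<epsilon> * (poly S y)\<^sup>2) \<ge> \<epsilon> * - (3 * M)"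
        using \<epsilon> by (intro mult_left_mono) auto
      then show ?thesis using eq 2 \<epsilon> by argo
    qed
    then show ?thesis by simp
  qed
  have "continuous_on K (\<lambda>y. \<bar>poly W y\<bar> / \<bar>poly Q y\<bar>)"
    using Q_nz by (intro continuous_intros) auto
  then obtain y2 where y2: "y2 \<in> K"
      "\<And>y. y \<in> K \<Longrightarrow> \<bar>poly W y\<bar> / \<bar>poly Q y\<bar> \<le> \<bar>poly W y2\<bar> / \<bar>poly Q y2\<bar>"
    using continuous_attains_sup[OF compact_K K_nonempty] by blast
  define \<delta> where "\<delta> = \<bar>poly W y2\<bar> / \<bar>poly Q y2\<bar>"
  have "\<bar>poly W y2\<bar> < \<bar>poly Q y2\<bar>" using less[OF y2(1)]
    by (meson abs_le_square_iff not_le)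
  then have \<delta>1: "\<delta> < 1" "\<delta> \<ge> 0" by (auto simp: \<delta>_def)
  \<comment> \<open>Only \<open>\<delta> \<ge> 0\<close> is known, so the scaling uses the midpoint
    of \<delta> and 1, which is positive and still below 1.\<close>
  define \<rho> where "\<rho> = (1 + \<delta>) / 2"
  have \<rho>: "\<rho> < 1" "\<rho> > 0" "\<delta> \<le> \<rho>" using \<delta>1 by (auto simp: \<rho>_def)
  have Wn: "coeff W n = coeff U n" using S by (simp add: W_def coeff_eq_0)
  have "degree W \<le> n" using S degree_U
    by (metis W_def degree_diff_le degree_smult_le less_imp_le order_trans)
  then have "degree (smult (1 / \<rho>) W) \<le> n" using degree_smult_le order_trans by blast
  moreover have "\<bar>poly (smult (1 / \<rho>) W) x\<bar> \<le> \<bar>poly Q x\<bar>" if "x \<in> K" for x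
  proof -
    have "\<bar>poly W x\<bar> \<le> \<rho> * \<bar>poly Q x\<bar>"
      using y2(2)[OF that] \<rho>(3) Q_nz[OF that] unfolding \<delta>_def[symmetric]
      by (simp add: divide_le_eq) (smt (verit) mult_right_mono zero_le_mult_iff)
    then show ?thesis using \<rho> by (simp add: abs_mult field_simps)
  qed
  ultimately have "coeff (smult (1 / \<rho>) W) n \<le> coeff U n" by (rule maximal)
  then have "coeff U n \<le> \<rho> * coeff U n" using \<rho> Wn by (simp add: field_simps)
  then show False using coeff_U_pos \<rho> by simp
qed

definition X :: "real set" where
  "X = {y \<in> K. \<bar>poly U y\<bar> = \<bar>poly Q y\<bar>}"

text \<open>For S = U / W the product U S equals W S^2, so the sign in Kolmogorov's criterion is the
  sign of W. Neither factor vanishes at the point found, because |U| = |Q| is nonzero there.\<close>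

lemma factor_negative:
  assumes "W dvd U" "degree W \<ge> 1"
  shows "\<exists>y\<in>X. poly W y < 0"
proof -
  obtain S where S: "U = W * S" using assms by (elim dvdE)
  have "W \<noteq> 0" "S \<noteq> 0" using U_nz S by auto
  then have "degree S < n" using assms degree_mult_eq[of W S] degree_U_eq S by simp
  from kolmogorov[OF this] obtain y where y: "y \<in> K" "\<bar>poly U y\<bar> = \<bar>poly Q y\<bar>"
      "poly U y * poly S y \<le> 0" by blast
  have "poly W y * (poly S y * poly S y) \<le> 0" using y(3) by (simp add: S mult.assoc)
  moreover have "poly U y \<noteq> 0" using y Q_nz by auto
  then have "poly S y * poly S y > 0" "poly W y \<noteq> 0"
    by (auto simp: S zero_less_mult_iff)
  ultimately have "poly W y < 0" by (meson mult_nonneg_nonneg mult_pos_pos not_le linorder_neqE)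
  then show ?thesis using y by (auto simp: X_def)
qed

section \<open>Zeros and contact points\<close>

lemma extremal_left: "poly U x = 0 \<Longrightarrow> \<exists>y\<in>X. y < x"
  using factor_negative[of "[:-x, 1:]"] by (auto simp: poly_eq_0_iff_dvd)

lemma extremal_right: "poly U x = 0 \<Longrightarrow> \<exists>y\<in>X. x < y"
proof -
  assume "poly U x = 0"
  then have "- [:-x, 1:] dvd U" by (simp only: poly_eq_0_iff_dvd minus_dvd_iff)
  from factor_negative[OF this] show ?thesis by auto
qed

lemma extremal_between:
  assumes "poly U x = 0" "poly U x' = 0" "x < x'"
  shows "\<exists>y\<in>X. x < y \<and> y < x'"
proof -
  have "\<exists>y\<in>X. poly ([:-x, 1:] * [:-x', 1:]) y < 0"
    using assms by (intro factor_negative two_roots_dvd) (auto simp: degree_mult_eq)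
  then obtain y where "y \<in> X" "(y - x) * (y - x') < 0" by (auto simp: algebra_simps)
  then show ?thesis using assms by (auto simp: mult_less_0_iff intro!: bexI[of _ y])
qed

text \<open>A double zero would make the square of a linear polynomial a divisor of U, and a square
  is nowhere negative.\<close>

lemma simple_zero:
  assumes "poly U x = 0"
  shows "poly (pderiv U) x \<noteq> 0"
proof
  assume d: "poly (pderiv U) x = 0"
  obtain S where S: "U = [:-x, 1:] * S" using assms by (auto simp: poly_eq_0_iff_dvd elim: dvdE)
  have "poly S x = 0" using d unfolding S pderiv_mult by (simp add: pderiv_pCons)
  then have "[:-x, 1:] * [:-x, 1:] dvd U" unfolding S
    by (intro mult_dvd_mono dvd_refl) (simp add: poly_eq_0_iff_dvd)
  from factor_negative[OF this] obtain y where "(y - x) * (y - x) < 0"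
    by (auto simp: degree_mult_eq algebra_simps)
  then show False by (simp add: mult_less_0_iff)
qed

lemma zeros_real:
  assumes z: "poly (cpoly U) z = 0"
  shows "z \<in> \<real>"
proof (rule ccontr)
  assume "z \<notin> \<real>"
  then have im: "Im z \<noteq> 0" by (simp add: complex_is_Real_iff)
  \<comment> \<open>The real quadratic with zeros z and its conjugate, positive on the whole real
    line. It divides U because the remainder is real of degree below 2 and vanishes at the nonreal
    z.\<close>
  define w where "w = [:(Re z)\<^sup>2 + (Im z)\<^sup>2, - 2 * Re z, 1:]"
  have wz: "poly (cpoly w) z = 0"
    by (simp add: w_def map_poly_pCons complex_eq_iff power2_eq_square algebra_simps)
  define r where "r = U mod w"
  have deg: "degree w = 2" by (simp add: w_def)
  then have w0: "w \<noteq> 0" by auto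
  have "degree r < 2" using degree_mod_less[OF w0, of U] deg unfolding r_def by force
  then obtain r0 r1 where r: "r = [:r0, r1:]"
    by (cases r rule: pCons_cases) (metis degree_eq_zeroE degree_pCons_eq_if less_2_cases Suc_inject
        degree_pCons_0 pCons_0_0 One_nat_def)
  have "cpoly U = cpoly w * cpoly (U div w) + cpoly r"
    by (simp add: r_def flip: cpoly_mult cpoly_add)
  then have "poly (cpoly r) z = 0" using z wz by simp
  then have "r0 + Re z * r1 = 0" "Im z * r1 = 0"
    by (auto simp: r map_poly_pCons complex_eq_iff)
  then have "r = 0" using im r by auto
  then have "w dvd U" by (simp add: r_def mod_eq_0_iff_dvd)
  from factor_negative[OF this] deg obtain y where "poly w y < 0" by auto
  moreover have "poly w y = (y - Re z)\<^sup>2 + (Im z)\<^sup>2"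
    by (simp add: w_def power2_eq_square algebra_simps)
  ultimately show False by (smt (verit) zero_le_power2)
qed

lemma rsquarefree_cpoly_U: "rsquarefree (cpoly U)"
proof (unfold rsquarefree_roots, safe)
  fix z assume z: "poly (cpoly U) z = 0" "poly (pderiv (cpoly U)) z = 0"
  then obtain x where "z = of_real x" using zeros_real Reals_cases by metis
  then show False using z simple_zero[of x] by (simp add: pderiv_cpoly)
qed

lemma zeros_cpoly_U: "{z. poly (cpoly U) z = 0} = complex_of_real ` {x. poly U x = 0}"
proof safe
  fix z assume z: "poly (cpoly U) z = 0"
  then obtain x where "z = of_real x" using zeros_real Reals_cases by metis
  then show "z \<in> complex_of_real ` {x. poly U x = 0}" using z by auto
qed auto

text \<open>Besides counting the zeros, this gives the sign of U at a contact point as the parity of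
  the number of zeros to its right.\<close>

lemma U_factorization: "U = smult (coeff U n) (\<Prod>x|poly U x = 0. [:-x, 1:])"
proof -
  have "cpoly U = smult (lead_coeff (cpoly U)) (\<Prod>z|poly (cpoly U) z = 0. [:-z, 1:])"
    by (rule complex_poly_decompose_rsquarefree[OF rsquarefree_cpoly_U, symmetric])
  also have "\<dots> = cpoly (smult (coeff U n) (\<Prod>x|poly U x = 0. [:-x, 1:]))"
    by (simp add: zeros_cpoly_U prod.reindex inj_on_def degree_U_eq cpoly_smult cpoly_prod cpoly_linear)
  finally have "cpoly (U - smult (coeff U n) (\<Prod>x|poly U x = 0. [:-x, 1:])) = 0"
    by (simp add: cpoly_diff)
  then show ?thesis by (simp only: cpoly_eq_0_iff right_minus_eq)
qed

lemma card_zeros: "card {x. poly U x = 0} = n"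
proof -
  have "degree U = degree (\<Prod>x|poly U x = 0. [:-x, 1:])"
    using coeff_U_pos by (subst U_factorization) simp
  then show ?thesis by (simp add: degree_U_eq degree_prod_sum_eq)
qed

lemma finite_zeros: "finite {x. poly U x = 0}"
  using poly_roots_finite[OF U_nz] .

lemma eq_0_if_zero_on_X:
  fixes V :: "real poly"
  assumes "degree V \<le> n" "\<And>y. y \<in> X \<Longrightarrow> poly V y = 0"
  shows "V = 0"
proof (rule ccontr)
  assume "V \<noteq> 0"
  have "{x. poly U x = 0} \<noteq> {}" using card_zeros n_pos by (metis card.empty not_one_le_zero)
  then obtain Y where Y: "Y \<subseteq> X" "finite Y" "card Y = Suc n"
    using interlacing_card[OF finite_zeros, of X] extremal_left extremal_right extremal_between
      card_zeros by auto
  have "card Y \<le> card {x. poly V x = 0}"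
    using Y assms by (intro card_mono poly_roots_finite \<open>V \<noteq> 0\<close>) auto
  also have "\<dots> \<le> degree V" by (rule card_poly_roots_bound[OF \<open>V \<noteq> 0\<close>])
  finally show False using Y assms by simp
qed

end

text \<open>The mean of two maximizers is again a maximizer. At its contact points the triangle
  inequality is an equality, which forces U = U' there, and there are too many such points for a
  nonzero difference.\<close>

lemma extremal_poly_unique:
  assumes "extremal_poly K Q U n" "extremal_poly K Q U' n"
  shows "U = U'"
proof -
  interpret U: extremal_poly K Q U n by fact
  interpret U': extremal_poly K Q U' n by fact
  define M where "M = smult (1/2) (U + U')"
  have c: "coeff U n = coeff U' n"
    using U.maximal[of U'] U'.maximal[of U] U.bound U'.bound U.degree_U U'.degree_U by force
  have M: "poly M x = (poly U x + poly U' x) / 2" for x by (simp add: M_def)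
  interpret M: extremal_poly K Q M n
  proof
    show "degree M \<le> n" unfolding M_def
      using U.degree_U U'.degree_U degree_smult_le degree_add_le order_trans by blast
    show "\<bar>poly M x\<bar> \<le> \<bar>poly Q x\<bar>" if "x \<in> K" for x
      using U.bound[OF that] U'.bound[OF that] unfolding M by (auto simp: abs_if field_simps split: if_splits)
    show "coeff W n \<le> coeff M n"
      if "degree W \<le> n" "\<And>x. x \<in> K \<Longrightarrow> \<bar>poly W x\<bar> \<le> \<bar>poly Q x\<bar>" for W
      using U.maximal[OF that] c by (simp add: M_def)
  qed (use U.n_pos U.compact_K U.infinite_K U.Q_nz in auto)
  have "U - U' = 0"
  proof (rule M.eq_0_if_zero_on_X)
    show "degree (U - U') \<le> n" using U.degree_U U'.degree_U degree_diff_le by blast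
    show "poly (U - U') y = 0" if "y \<in> M.X" for y
    proof -
      have y: "y \<in> K" "\<bar>poly U y + poly U' y\<bar> = 2 * \<bar>poly Q y\<bar>"
        using that by (auto simp: M.X_def M)
      then show ?thesis using U.bound[OF y(1)] U'.bound[OF y(1)] by simp
    qed
  qed
  then show ?thesis by simp
qed

text \<open>The real part of P is itself extremal among real polynomials. Where it touches Q in
  modulus, |P| <= |Q| leaves no room for the imaginary part, which therefore vanishes on the contact
  set.\<close>

lemma complex_extremal:
  fixes P :: "complex poly"
  assumes n: "n \<ge> 1" and K: "compact K" "infinite K" "\<And>x. x \<in> K \<Longrightarrow> poly Q x \<noteq> 0"
    and P: "degree P \<le> n" "\<And>x. x \<in> K \<Longrightarrow> cmod (poly P (of_real x)) \<le> \<bar>poly Q x\<bar>"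
    and max: "\<And>W. degree W \<le> n \<Longrightarrow>
      (\<And>x. x \<in> K \<Longrightarrow> cmod (poly W (of_real x)) \<le> \<bar>poly Q x\<bar>) \<Longrightarrow> Re (coeff W n) \<le> Re (coeff P n)"
  shows "\<exists>U. extremal_poly K Q U n \<and> P = cpoly U"
proof -
  define U V where "U = map_poly Re P" and "V = map_poly Im P"
  have coeffs: "coeff U k = Re (coeff P k)" "coeff V k = Im (coeff P k)" for k
    by (simp_all add: U_def V_def coeff_map_poly)
  have split: "P = cpoly U + smult \<i> (cpoly V)"
    by (rule poly_eqI) (simp add: coeffs complex_eq_iff)
  then have val: "poly P (of_real x) = of_real (poly U x) + \<i> * of_real (poly V x)" for x
    by simp
  have norm: "(cmod (poly P (of_real x)))\<^sup>2 = (poly U x)\<^sup>2 + (poly V x)\<^sup>2" for x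
    unfolding val cmod_power2 by simp
  have le: "(poly U x)\<^sup>2 + (poly V x)\<^sup>2 \<le> (poly Q x)\<^sup>2" if "x \<in> K" for x
    using P(2)[OF that] unfolding norm[symmetric] by (metis abs_le_square_iff abs_norm_cancel)
  have degs: "degree U \<le> n" "degree V \<le> n"
    unfolding U_def V_def using P(1) map_poly_degree_leq[of _ P] order_trans by blast+
  have "\<bar>poly U x\<bar> \<le> \<bar>poly Q x\<bar>" if "x \<in> K" for x
  proof -
    have "(poly U x)\<^sup>2 \<le> (poly Q x)\<^sup>2" using le[OF that] zero_le_power2[of "poly V x"] by linarith
    then show ?thesis by (simp add: abs_le_square_iff)
  qed
  moreover have "coeff W n \<le> coeff U n"
    if "degree W \<le> n" "\<And>x. x \<in> K \<Longrightarrow> \<bar>poly W x\<bar> \<le> \<bar>poly Q x\<bar>" for W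
    using max[of "cpoly W"] that by (simp add: coeffs)
  ultimately interpret extremal_poly K Q U n
    unfolding extremal_poly_def using n K degs by blast
  have "V = 0"
  proof (rule eq_0_if_zero_on_X)
    show "degree V \<le> n" by (rule degs)
    fix y assume "y \<in> X"
    then have "y \<in> K" "(poly U y)\<^sup>2 = (poly Q y)\<^sup>2" by (simp_all add: X_def power2_eq_iff abs_eq_iff)
    then have "(poly V y)\<^sup>2 \<le> 0" using le[of y] by simp
    then show "poly V y = 0" by simp
  qed
  then have "P = cpoly U" using split by simp
  then show ?thesis using extremal_poly_axioms by blast
qed

section \<open>Bands of a rational function with interlacing unit values\<close>

lemma first_zero_right:
  fixes f :: "real \<Rightarrow> real"
  assumes cont: "continuous_on UNIV f" and f: "f z < 0" "f y \<ge> 0" "z < y"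
  shows "\<exists>v. z < v \<and> f v = 0 \<and> (\<forall>x. z \<le> x \<and> x < v \<longrightarrow> f x < 0)"
proof -
  define A where "A = {z..y} \<inter> {x. f x \<ge> 0}"
  have "closed {x. 0 \<le> f x}"
    by (intro closed_Collect_le continuous_on_const cont)
  then have "compact A" unfolding A_def by (intro compact_Int_closed) auto
  moreover have "y \<in> A" using f by (auto simp: A_def)
  ultimately obtain v where v: "v \<in> A" "\<And>x. x \<in> A \<Longrightarrow> v \<le> x"
    using compact_attains_inf[of A] by blast
  have neg: "f x < 0" if "z \<le> x" "x < v" for x
    using v(1) v(2)[of x] that by (force simp: A_def)
  have zv: "z < v" using v(1) f by (auto simp: A_def less_le)
  have "continuous_on {z..v} f" using cont continuous_on_subset by blast
  then obtain x where "z \<le> x" "x \<le> v" "f x = 0"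
    using IVT'[of f z 0 v] f v(1) zv by (auto simp: A_def)
  then have "f v = 0" using neg[of x] by force
  then show ?thesis using zv neg by blast
qed

lemma last_zero_left:
  fixes f :: "real \<Rightarrow> real"
  assumes cont: "continuous_on UNIV f" and f: "f z < 0" "f y \<ge> 0" "y < z"
  shows "\<exists>u. u < z \<and> f u = 0 \<and> (\<forall>x. u < x \<and> x \<le> z \<longrightarrow> f x < 0)"
proof -
  have "continuous_on UNIV (\<lambda>x. f (- x))"
    by (intro continuous_on_compose2[OF cont] continuous_intros) auto
  from first_zero_right[OF this, of "-z" "-y"] f obtain v where
    v: "-z < v" "f (-v) = 0" "\<forall>x. -z \<le> x \<and> x < v \<longrightarrow> f (-x) < 0" by auto
  have "f x < 0" if "-v < x" "x \<le> z" for x using v(3)[rule_format, of "-x"] that by simp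
  then show ?thesis using v by (intro exI[of _ "-v"]) auto
qed

text \<open>The set A, contained in the multiset of roots, already has its full size, so
  multiplicities above one are excluded.\<close>

lemma poly_eq_prod_roots:
  fixes P :: "complex poly"
  assumes "P \<noteq> 0" "finite A" "card A = degree P" "\<And>a. a \<in> A \<Longrightarrow> poly P a = 0"
  shows "P = smult (lead_coeff P) (\<Prod>a\<in>A. [:-a, 1:])"
proof -
  have "mset_set A \<subseteq># proots P"
    using assms by (intro mset_subset_eqI) (auto simp: count_mset_set' order_gt_0_iff Suc_le_eq)
  moreover have "size (mset_set A) = size (proots P)"
    using assms by (simp add: size_proots_complex)
  ultimately have "mset_set A = proots P"
    by (metis mset_subset_size subset_mset.le_less nat_less_le)
  then show ?thesis
    using complex_poly_decompose_multiset[of P] by (simp flip: prod_unfold_prod_mset add: prod_unfold_prod_mset)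
qed

text \<open>Passage to the limit in the estimates for t = s (1 - \<epsilon>) below; \<epsilon> = a /
  (2 C) would give a <= a / 2.\<close>

lemma le_0_if_le_small:
  fixes a C :: real
  assumes "\<And>\<epsilon>. 0 < \<epsilon> \<Longrightarrow> \<epsilon> < 1 \<Longrightarrow> a \<le> \<epsilon> * C"
  shows "a \<le> 0"
proof (rule ccontr)
  assume a: "\<not> a \<le> 0"
  have "a \<le> 1/2 * C" by (rule assms) auto
  then have C: "C > 0" using a by simp
  have "a \<le> min (1/2) (a / (2 * C)) * C" using a C by (intro assms) auto
  also have "\<dots> \<le> a / (2 * C) * C" using C by (intro mult_right_mono) auto
  finally show False using a C by simp
qed

text \<open>What the contact points provide for the reduced fraction p / q, with K forgotten. The
  degree condition bounds the degree of p - t q by that of p, on which the counting of solutions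
  rests.\<close>

locale interlaced =
  fixes p q :: "real poly"
  assumes degree_le: "degree q \<le> degree p" and degree_pos: "degree p \<ge> 1"
    and card_zeros: "card {x. poly p x = 0} = degree p"
    and no_common: "\<And>x. poly p x = 0 \<Longrightarrow> poly q x \<noteq> 0"
    and left: "\<And>z. poly p z = 0 \<Longrightarrow> \<exists>y<z. \<bar>poly p y\<bar> = \<bar>poly q y\<bar>"
    and right: "\<And>z. poly p z = 0 \<Longrightarrow> \<exists>y>z. \<bar>poly p y\<bar> = \<bar>poly q y\<bar>"
    and between: "\<And>z z'. poly p z = 0 \<Longrightarrow> poly p z' = 0 \<Longrightarrow> z < z' \<Longrightarrow>
      \<exists>y. z < y \<and> y < z' \<and> \<bar>poly p y\<bar> = \<bar>poly q y\<bar>"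
begin

section \<open>Bands around the zeros of p\<close>

definition Z :: "real set" where "Z = {x. poly p x = 0}"

lemma p_nz: "p \<noteq> 0"
  using degree_pos by auto

lemma finite_Z: "finite Z"
  unfolding Z_def by (rule poly_roots_finite[OF p_nz])

lemma card_Z: "card Z = degree p"
  by (simp add: Z_def card_zeros)

lemma Z_nonempty: "Z \<noteq> {}"
  using card_Z degree_pos by auto

text \<open>Comparing |p| with |q| instead of |p / q| with 1 keeps both sides continuous; at a zero
  of q the strict inequality just fails.\<close>

definition lo :: "real \<Rightarrow> real" where
  "lo z = (SOME u. u < z \<and> \<bar>poly p u\<bar> = \<bar>poly q u\<bar> \<and> (\<forall>x. u < x \<and> x \<le> z \<longrightarrow> \<bar>poly p x\<bar> < \<bar>poly q x\<bar>))"

definition hi :: "real \<Rightarrow> real" where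
  "hi z = (SOME v. z < v \<and> \<bar>poly p v\<bar> = \<bar>poly q v\<bar> \<and> (\<forall>x. z \<le> x \<and> x < v \<longrightarrow> \<bar>poly p x\<bar> < \<bar>poly q x\<bar>))"

lemma lo: assumes "z \<in> Z"
  shows "lo z < z" "\<bar>poly p (lo z)\<bar> = \<bar>poly q (lo z)\<bar>"
    "\<And>x. lo z < x \<Longrightarrow> x \<le> z \<Longrightarrow> \<bar>poly p x\<bar> < \<bar>poly q x\<bar>"
proof -
  define f where "f x = \<bar>poly p x\<bar> - \<bar>poly q x\<bar>" for x
  have "continuous_on UNIV f" unfolding f_def by (intro continuous_intros)
  moreover have "f z < 0" using assms no_common by (auto simp: f_def Z_def)
  moreover obtain y where "y < z" "f y \<ge> 0" using left[of z] assms by (force simp: f_def Z_def)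
  ultimately have "\<exists>u. u < z \<and> f u = 0 \<and> (\<forall>x. u < x \<and> x \<le> z \<longrightarrow> f x < 0)"
    by (intro last_zero_left)
  then have "\<exists>u. u < z \<and> \<bar>poly p u\<bar> = \<bar>poly q u\<bar> \<and> (\<forall>x. u < x \<and> x \<le> z \<longrightarrow> \<bar>poly p x\<bar> < \<bar>poly q x\<bar>)"
    by (simp add: f_def)
  from someI_ex[OF this] show "lo z < z" "\<bar>poly p (lo z)\<bar> = \<bar>poly q (lo z)\<bar>"
    "\<And>x. lo z < x \<Longrightarrow> x \<le> z \<Longrightarrow> \<bar>poly p x\<bar> < \<bar>poly q x\<bar>"
    unfolding lo_def[symmetric] by blast+
qed

lemma hi: assumes "z \<in> Z"
  shows "z < hi z" "\<bar>poly p (hi z)\<bar> = \<bar>poly q (hi z)\<bar>"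
    "\<And>x. z \<le> x \<Longrightarrow> x < hi z \<Longrightarrow> \<bar>poly p x\<bar> < \<bar>poly q x\<bar>"
proof -
  define f where "f x = \<bar>poly p x\<bar> - \<bar>poly q x\<bar>" for x
  have "continuous_on UNIV f" unfolding f_def by (intro continuous_intros)
  moreover have "f z < 0" using assms no_common by (auto simp: f_def Z_def)
  moreover obtain y where "z < y" "f y \<ge> 0" using right[of z] assms by (force simp: f_def Z_def)
  ultimately have "\<exists>u. z < u \<and> f u = 0 \<and> (\<forall>x. z \<le> x \<and> x < u \<longrightarrow> f x < 0)"
    by (intro first_zero_right)
  then have "\<exists>u. z < u \<and> \<bar>poly p u\<bar> = \<bar>poly q u\<bar> \<and> (\<forall>x. z \<le> x \<and> x < u \<longrightarrow> \<bar>poly p x\<bar> < \<bar>poly q x\<bar>)"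
    by (simp add: f_def)
  from someI_ex[OF this] show "z < hi z" "\<bar>poly p (hi z)\<bar> = \<bar>poly q (hi z)\<bar>"
    "\<And>x. z \<le> x \<Longrightarrow> x < hi z \<Longrightarrow> \<bar>poly p x\<bar> < \<bar>poly q x\<bar>"
    unfolding hi_def[symmetric] by blast+
qed

definition band :: "real \<Rightarrow> real set" where "band z = {lo z<..<hi z}"

lemma less_on_band: "z \<in> Z \<Longrightarrow> x \<in> band z \<Longrightarrow> \<bar>poly p x\<bar> < \<bar>poly q x\<bar>"
  using lo(3)[of z x] hi(3)[of z x] by (cases "x \<le> z") (auto simp: band_def)

lemma zero_in_band: "z \<in> Z \<Longrightarrow> z \<in> band z"
  using lo hi by (auto simp: band_def)

lemma bands_ordered:
  assumes "z \<in> Z" "z' \<in> Z" "z < z'"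
  shows "hi z \<le> lo z'"
proof -
  obtain y where y: "z < y" "y < z'" "\<bar>poly p y\<bar> = \<bar>poly q y\<bar>"
    using between assms by (auto simp: Z_def)
  then have "hi z \<le> y" using hi(3)[OF assms(1), of y] by force
  moreover have "y \<le> lo z'" using lo(3)[OF assms(2), of y] y by force
  ultimately show ?thesis by simp
qed

lemma bands_disjoint:
  assumes "z \<in> Z" "z' \<in> Z" "x \<in> band z" "x \<in> band z'"
  shows "z = z'"
  using bands_ordered[of z z'] bands_ordered[of z' z] assms
  by (cases z z' rule: linorder_cases) (auto simp: band_def)

lemma q_nz:
  assumes "\<bar>poly p x\<bar> \<le> \<bar>poly q x\<bar>"
  shows "poly q x \<noteq> 0"
  using no_common[of x] assms by auto

text \<open>On the closed band |p| <= |q|, so a zero of q would be a common zero: q keeps its sign.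
  The only zero of p there is z, and it is simple, so p changes sign. Hence p / q runs from one of
  1, -1 to the other.\<close>

lemma ends: assumes "z \<in> Z"
  shows "poly p (lo z) * poly p (hi z) < 0" "poly q (lo z) * poly q (hi z) > 0"
proof -
  have lh: "lo z < hi z" using lo(1) hi(1) assms by (meson less_trans)
  have qnz: "poly q x \<noteq> 0" if "lo z \<le> x" "x \<le> hi z" for x
  proof (rule q_nz)
    show "\<bar>poly p x\<bar> \<le> \<bar>poly q x\<bar>"
      using less_on_band[OF assms, of x] lo(2)[OF assms] hi(2)[OF assms] that
      by (cases "x = lo z"; cases "x = hi z") (auto simp: band_def)
  qed
  show q: "poly q (lo z) * poly q (hi z) > 0"
    using poly_IVT[OF lh, of q] qnz lh
    by (metis less_imp_le linorder_neqE_linordered_idom mult_eq_0_iff order_refl)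
  obtain r where r: "p = [:-z, 1:] * r"
    using assms by (auto simp: Z_def poly_eq_0_iff_dvd elim: dvdE)
  have rnz: "r \<noteq> 0" using p_nz r by auto
  have degr: "degree p = Suc (degree r)" unfolding r by (subst degree_mult_eq) (use rnz in auto)
  \<comment> \<open>If z were a double zero, all of Z would consist of zeros of r, whose degree is
    one less than \<open>card Z\<close>.\<close>
  have "poly r z \<noteq> 0"
  proof
    assume "poly r z = 0"
    then have "{x. poly ([:-z, 1:] * r) x = 0} = {x. poly r x = 0}" by auto
    then have "Z = {x. poly r x = 0}" unfolding Z_def r[symmetric] .
    then have "card Z \<le> degree r" using card_poly_roots_bound[OF rnz] by simp
    then show False using card_Z degr by simp
  qed
  moreover have "poly p x \<noteq> 0" if x: "lo z \<le> x" "x \<le> hi z" "x \<noteq> z" for x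
  proof
    assume p: "poly p x = 0"
    then have xZ: "x \<in> Z" by (simp add: Z_def)
    have "x \<noteq> lo z" "x \<noteq> hi z" using no_common[OF p] p lo(2)[OF assms] hi(2)[OF assms] by auto
    then have "x \<in> band z" using x by (auto simp: band_def)
    then show False using bands_disjoint[OF xZ assms zero_in_band[OF xZ]] x by blast
  qed
  ultimately have rx: "poly r x \<noteq> 0" if "lo z \<le> x" "x \<le> hi z" for x
    using that unfolding r by (cases "x = z") auto
  have "poly r (lo z) * poly r (hi z) > 0"
    using poly_IVT[OF lh, of r] rx lh
    by (metis less_imp_le linorder_neqE_linordered_idom mult_eq_0_iff order_refl)
  moreover have "(lo z - z) * (hi z - z) < 0" using lo(1) hi(1) assms by (simp add: mult_less_0_iff)
  moreover have "poly p (lo z) * poly p (hi z) = ((lo z - z) * (hi z - z)) * (poly r (lo z) * poly r (hi z))"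
    unfolding r by (simp add: algebra_simps)
  ultimately show "poly p (lo z) * poly p (hi z) < 0" by (simp add: mult_neg_pos)
qed

definition f :: "real \<Rightarrow> real" where "f x = poly p x / poly q x"

lemma f_ends: assumes "z \<in> Z"
  shows "f (lo z) = 1 \<and> f (hi z) = -1 \<or> f (lo z) = -1 \<and> f (hi z) = 1"
proof -
  have "f (lo z) * f (hi z) < 0"
    using ends[OF assms] by (simp add: f_def divide_neg_pos)
  moreover have "\<bar>f (lo z)\<bar> = 1" "\<bar>f (hi z)\<bar> = 1"
    using lo(2)[OF assms] hi(2)[OF assms] q_nz by (auto simp: f_def abs_divide)
  ultimately show ?thesis by (auto simp: abs_if split: if_splits)
qed

lemma level_in_band:
  assumes "z \<in> Z" "\<bar>t\<bar> < 1"
  shows "\<exists>x\<in>band z. poly p x = t * poly q x"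
proof -
  have lh: "lo z < hi z" using lo(1) hi(1) assms by (meson less_trans)
  have nz: "poly q (lo z) \<noteq> 0" "poly q (hi z) \<noteq> 0" using ends(2)[OF assms(1)] by auto
  have "poly (p - smult t q) x = poly q x * (f x - t)" if "poly q x \<noteq> 0" for x
    using that by (simp add: f_def field_simps)
  then have "poly (p - smult t q) (lo z) * poly (p - smult t q) (hi z) =
      (poly q (lo z) * poly q (hi z)) * ((f (lo z) - t) * (f (hi z) - t))" using nz by simp
  moreover have "(f (lo z) - t) * (f (hi z) - t) < 0"
    using f_ends[OF assms(1)] assms(2) by (auto simp: mult_less_0_iff)
  ultimately have "poly (p - smult t q) (lo z) * poly (p - smult t q) (hi z) < 0"
    using ends(2)[OF assms(1)] by (simp add: mult_pos_neg)
  from poly_IVT[OF lh this] show ?thesis by (auto simp: band_def)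
qed

text \<open>Each of the \<open>degree p\<close> bands contains a solution of \<open>p = t q\<close>, so these are all.\<close>

lemma level_set:
  assumes t: "\<bar>t\<bar> < 1"
  obtains g where "\<And>z. z \<in> Z \<Longrightarrow> g z \<in> band z" "inj_on g Z"
    "{w. poly (cpoly p) w = of_real t * poly (cpoly q) w} = of_real ` g ` Z"
    "degree (p - smult t q) = degree p"
proof -
  obtain g where g: "\<And>z. z \<in> Z \<Longrightarrow> g z \<in> band z \<and> poly p (g z) = t * poly q (g z)"
    using level_in_band[OF _ t] by metis
  have inj: "inj_on g Z" by (rule inj_onI) (metis bands_disjoint g)
  define P where "P = p - smult t q"
  obtain z0 where z0: "z0 \<in> Z" using Z_nonempty by auto
  \<comment> \<open>At a band end |p| = |q| is nonzero, so p = t q fails there for |t| < 1. This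
    excludes P = 0, after which the \<open>degree p\<close> roots already found meet the root
    bound.\<close>
  have "poly P (lo z0) \<noteq> 0"
    using lo(2)[OF z0] q_nz[of "lo z0"] t by (auto simp: P_def abs_mult)
  then have P0: "P \<noteq> 0" by auto
  have degP: "degree P \<le> degree p"
    unfolding P_def using degree_le degree_smult_le by (metis degree_diff_le order_refl order_trans)
  have sub: "complex_of_real ` g ` Z \<subseteq> {w. poly (cpoly P) w = 0}"
    using g by (auto simp: P_def)
  have card: "card (complex_of_real ` g ` Z) = degree p"
    using inj by (simp add: card_image inj_on_def card_Z[symmetric] inj_on_def)
  have fin: "finite {w. poly (cpoly P) w = 0}" using P0 by (intro poly_roots_finite) auto
  have bnd: "card {w. poly (cpoly P) w = 0} \<le> degree P"
    using card_poly_roots_bound[of "cpoly P"] P0 by simp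
  have eq: "complex_of_real ` g ` Z = {w. poly (cpoly P) w = 0}"
    using sub card bnd degP by (intro card_seteq fin) auto
  then have "degree P = degree p" using card bnd degP by simp
  moreover have "{w. poly (cpoly P) w = 0} = {w. poly (cpoly p) w = of_real t * poly (cpoly q) w}"
    by (simp add: P_def cpoly_diff cpoly_smult)
  ultimately show ?thesis using that[of g] g inj eq by (simp add: P_def)
qed

text \<open>All solutions of p = t q are known and each band holds exactly one, so a value cannot
  repeat within a band. By continuity this injectivity is strict monotonicity.\<close>

lemma inj_on_band:
  assumes "z \<in> Z"
  shows "inj_on f (band z)"
proof (rule inj_onI)
  fix x x' assume x: "x \<in> band z" "x' \<in> band z" "f x = f x'"
  have less: "\<bar>poly p x\<bar> < \<bar>poly q x\<bar>" "\<bar>poly p x'\<bar> < \<bar>poly q x'\<bar>"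
    using less_on_band assms x by auto
  then have t: "\<bar>f x\<bar> < 1" by (simp add: f_def abs_divide)
  obtain g where g: "\<And>z. z \<in> Z \<Longrightarrow> g z \<in> band z"
    "{w. poly (cpoly p) w = of_real (f x) * poly (cpoly q) w} = of_real ` g ` Z"
    using level_set[OF t] by metis
  have "y = g z" if "y \<in> band z" "f y = f x" for y
  proof -
    have "poly p y = f x * poly q y" using less_on_band[OF assms that(1)] that(2)
      by (auto simp: f_def field_simps)
    then have "complex_of_real y \<in> of_real ` g ` Z"
      unfolding g(2)[symmetric] by (simp flip: of_real_mult)
    then obtain z' where "z' \<in> Z" "y = g z'" by auto
    then show ?thesis using g(1) bands_disjoint[OF assms] that by blast
  qed
  then show "x = x'" using x by metis
qed

lemma monotone_on_band:
  assumes "z \<in> Z"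
  shows "strict_mono_on (band z) f \<or> strict_antimono_on (band z) f"
proof -
  have "continuous_on (band z) f"
    unfolding f_def using less_on_band[OF assms] by (intro continuous_intros) force
  then show ?thesis
    using injective_eq_monotone_map[of "band z" f] inj_on_band[OF assms]
    by (auto simp: band_def is_interval_oo)
qed

lemma image_band:
  assumes "z \<in> Z"
  shows "f ` band z = {-1<..<1}"
proof safe
  fix x assume "x \<in> band z"
  then have "\<bar>f x\<bar> < 1" using less_on_band[OF assms, of x] by (simp add: f_def abs_divide)
  then show "f x \<in> {-1<..<1}" by auto
next
  fix t :: real assume "t \<in> {-1<..<1}"
  then obtain x where x: "x \<in> band z" "poly p x = t * poly q x"
    using level_in_band[OF assms, of t] by (auto simp: abs_less_iff)
  then have "f x = t" using less_on_band[OF assms x(1)] by (auto simp: f_def)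
  then show "t \<in> f ` band z" using x(1) by blast
qed

text \<open>Quantitative form of \<open>level_set\<close>: the size of p - t q is controlled by
  distances to roots that stay in fixed bounded bands, an estimate that survives |t| -> 1.\<close>

lemma level_factorization:
  assumes t: "\<bar>t\<bar> < 1"
  obtains g where "\<And>z. z \<in> Z \<Longrightarrow> g z \<in> band z"
    "\<And>w. poly (cpoly p) w - of_real t * poly (cpoly q) w =
      of_real (coeff p (degree p) - t * coeff q (degree p)) * (\<Prod>z\<in>Z. w - of_real (g z))"
proof -
  obtain g where g: "\<And>z. z \<in> Z \<Longrightarrow> g z \<in> band z" "inj_on g Z"
    "{w. poly (cpoly p) w = of_real t * poly (cpoly q) w} = of_real ` g ` Z"
    "degree (p - smult t q) = degree p"
    using level_set[OF t] by metis
  define P where "P = cpoly (p - smult t q)"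
  have P: "poly P w = poly (cpoly p) w - of_real t * poly (cpoly q) w" for w
    by (simp add: P_def cpoly_diff cpoly_smult)
  have degP: "degree P = degree p" by (simp add: P_def g)
  have inj: "inj_on (\<lambda>z. complex_of_real (g z)) Z" using g(2) by (auto simp: inj_on_def)
  have roots: "poly P a = 0" if "a \<in> (\<lambda>z. complex_of_real (g z)) ` Z" for a
    using that g(3) unfolding P by (auto simp: image_image)
  have "P = smult (lead_coeff P) (\<Prod>a\<in>(\<lambda>z. complex_of_real (g z)) ` Z. [:-a, 1:])"
    using degP degree_pos finite_Z inj roots
    by (intro poly_eq_prod_roots) (auto simp: card_image card_Z)
  also have "\<dots> = smult (lead_coeff P) (\<Prod>z\<in>Z. [:- of_real (g z), 1:])"
    using inj by (simp add: prod.reindex)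
  finally have eq: "P = smult (lead_coeff P) (\<Prod>z\<in>Z. [:- of_real (g z), 1:])" .
  have "poly P w = lead_coeff P * (\<Prod>z\<in>Z. w - of_real (g z))" for w
    by (subst eq) (simp add: poly_prod)
  moreover have "lead_coeff P = of_real (coeff p (degree p) - t * coeff q (degree p))"
    unfolding degP by (simp add: P_def)
  ultimately show ?thesis using that[of g] g(1) by (simp add: P)
qed

text \<open>Excludes F = s at infinity. If the coefficients matched at s, then for t = s (1 -
  \<epsilon>) the leading factor of p - t q would be of size \<epsilon> while its roots stay
  bounded. Evaluation at a zero z0 of p then gives q(z0) = 0, a common zero.\<close>

lemma lead_coeff_ne:
  assumes s: "\<bar>s\<bar> = 1"
  shows "coeff p (degree p) \<noteq> s * coeff q (degree p)"
proof
  assume eq: "coeff p (degree p) = s * coeff q (degree p)"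
  obtain z0 where z0: "z0 \<in> Z" using Z_nonempty by auto
  have "bounded (\<Union>z\<in>Z. band z)" using finite_Z by (auto simp: band_def)
  then obtain B where B: "B > 0" "\<And>z x. z \<in> Z \<Longrightarrow> x \<in> band z \<Longrightarrow> \<bar>x\<bar> \<le> B"
    by (auto simp: bounded_pos)
  define C where "C = \<bar>coeff q (degree p)\<bar> * (\<bar>z0\<bar> + B) ^ degree p"
  have "\<bar>poly q z0\<bar> \<le> 0"
  proof (rule le_0_if_le_small)
    fix \<epsilon> :: real assume \<epsilon>: "0 < \<epsilon>" "\<epsilon> < 1"
    define t where "t = s * (1 - \<epsilon>)"
    have t: "\<bar>t\<bar> = 1 - \<epsilon>" using s \<epsilon> by (simp add: t_def abs_mult)
    then have "\<bar>t\<bar> < 1" using \<epsilon> by simp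
    then obtain g where g: "\<And>z. z \<in> Z \<Longrightarrow> g z \<in> band z"
      "\<And>w. poly (cpoly p) w - of_real t * poly (cpoly q) w =
        of_real (coeff p (degree p) - t * coeff q (degree p)) * (\<Prod>z\<in>Z. w - of_real (g z))"
      using level_factorization by metis
    have "(1 - \<epsilon>) * \<bar>poly q z0\<bar> = cmod (poly (cpoly p) z0 - of_real t * poly (cpoly q) z0)"
      using z0 t by (simp add: Z_def norm_mult)
    also have "\<dots> = \<bar>coeff p (degree p) - t * coeff q (degree p)\<bar> * (\<Prod>z\<in>Z. \<bar>z0 - g z\<bar>)"
      unfolding g(2) norm_mult norm_of_real by (simp add: prod_norm[symmetric] flip: of_real_diff)
    also have "coeff p (degree p) - t * coeff q (degree p) = s * \<epsilon> * coeff q (degree p)"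
      by (simp add: eq t_def algebra_simps)
    also have "\<bar>s * \<epsilon> * coeff q (degree p)\<bar> = \<epsilon> * \<bar>coeff q (degree p)\<bar>"
      using s \<epsilon> by (simp add: abs_mult)
    also have "(\<Prod>z\<in>Z. \<bar>z0 - g z\<bar>) \<le> (\<Prod>z\<in>Z. \<bar>z0\<bar> + B)"
      using B(2)[OF _ g(1)] by (intro prod_mono conjI abs_ge_zero order_trans[OF abs_triangle_ineq4] add_left_mono)
    also have "\<dots> = (\<bar>z0\<bar> + B) ^ degree p" by (simp add: card_Z)
    finally have "(1 - \<epsilon>) * \<bar>poly q z0\<bar> \<le> \<epsilon> * C"
      using \<epsilon> by (simp add: C_def mult_left_mono mult.assoc)
    then show "\<bar>poly q z0\<bar> \<le> \<epsilon> * (C + \<bar>poly q z0\<bar>)" by (simp add: algebra_simps)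
  qed
  then show False using no_common z0 by (simp add: Z_def)
qed

text \<open>Says that |p / q| > 1 at infinity, the coefficient of q being 0 when its degree is
  smaller. A value t in (-1,1) there would lower the degree of p - t q, against
  \<open>level_set\<close>; a value of modulus one is \<open>lead_coeff_ne\<close>.\<close>

lemma degree_p_coeff_less: "\<bar>coeff q (degree p)\<bar> < \<bar>coeff p (degree p)\<bar>"
proof (rule ccontr)
  assume neg: "\<not> ?thesis"
  have lp: "coeff p (degree p) \<noteq> 0" using p_nz by simp
  define t where "t = coeff p (degree p) / coeff q (degree p)"
  have nz: "coeff q (degree p) \<noteq> 0" using neg lp by auto
  then have eq: "coeff p (degree p) = t * coeff q (degree p)" by (simp add: t_def)
  then have "\<bar>t\<bar> \<le> 1" using neg nz by (simp add: abs_mult)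
  then consider "\<bar>t\<bar> < 1" | "\<bar>t\<bar> = 1" by linarith
  then show False
  proof cases
    case 1
    then have "degree (p - smult t q) = degree p" using level_set by metis
    then have "coeff (p - smult t q) (degree p) \<noteq> 0"
      using degree_pos by (metis leading_coeff_0_iff degree_0 not_one_le_zero)
    then show False using eq by simp
  next
    case 2
    then show False using lead_coeff_ne eq by blast
  qed
qed

text \<open>The solutions of \<open>p = s q\<close> are limits of those of \<open>p = t q\<close> as \<open>t \<rightarrow> s\<close>.\<close>

lemma unit_level:
  assumes s: "\<bar>s\<bar> = 1" and w: "poly (cpoly p) w = of_real s * poly (cpoly q) w"
  shows "w \<in> of_real ` (lo ` Z \<union> hi ` Z)"
proof -
  \<comment> \<open>The closed bands contain all roots of p - t q for |t| < 1. At distance d > 0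
    from them |p - t q| is bounded below as t -> s, whereas p = s q at w makes it equal to
    \<epsilon> |q(w)|.\<close>
  define S where "S = complex_of_real ` (\<Union>z\<in>Z. {lo z..hi z})"
  have "compact (\<Union>z\<in>Z. {lo z..hi z})" using finite_Z by auto
  then have "compact S" unfolding S_def
    by (intro compact_continuous_image continuous_intros)
  then have cl: "closed S" by (rule compact_imp_closed)
  obtain z0 where z0: "z0 \<in> Z" using Z_nonempty by auto
  have ne: "S \<noteq> {}" using z0 zero_in_band[OF z0] by (force simp: S_def band_def)
  have "w \<in> S"
  proof (rule ccontr)
    assume "w \<notin> S"
    define d where "d = infdist w S"
    have d: "d > 0" using \<open>w \<notin> S\<close> cl ne unfolding d_def
      by (metis in_closed_iff_infdist_zero infdist_nonneg less_eq_real_def)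
    define c where "c = coeff p (degree p) - s * coeff q (degree p)"
    have c: "c \<noteq> 0" using lead_coeff_ne[OF s] by (simp add: c_def)
    have "\<bar>c\<bar> * d ^ degree p \<le> 0"
    proof (rule le_0_if_le_small)
      fix \<epsilon> :: real assume \<epsilon>: "0 < \<epsilon>" "\<epsilon> < 1"
      define t where "t = s * (1 - \<epsilon>)"
      have "\<bar>t\<bar> = 1 - \<epsilon>" using s \<epsilon> by (simp add: t_def abs_mult)
      then have "\<bar>t\<bar> < 1" using \<epsilon> by simp
      then obtain g where g: "\<And>z. z \<in> Z \<Longrightarrow> g z \<in> band z"
        "\<And>w. poly (cpoly p) w - of_real t * poly (cpoly q) w =
          of_real (coeff p (degree p) - t * coeff q (degree p)) * (\<Prod>z\<in>Z. w - of_real (g z))"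
        using level_factorization by metis
      have dist: "d \<le> cmod (w - of_real (g z))" if "z \<in> Z" for z
      proof -
        have "complex_of_real (g z) \<in> S" using g(1)[OF that] that by (force simp: S_def band_def)
        then show ?thesis unfolding d_def by (metis infdist_le dist_norm)
      qed
      have "d ^ degree p = (\<Prod>z\<in>Z. d)" by (simp add: card_Z)
      also have "\<dots> \<le> (\<Prod>z\<in>Z. cmod (w - of_real (g z)))"
        using dist d by (intro prod_mono) auto
      finally have dm: "d ^ degree p \<le> (\<Prod>z\<in>Z. cmod (w - of_real (g z)))" .
      have "\<bar>c\<bar> \<le> \<bar>coeff p (degree p) - t * coeff q (degree p)\<bar> + \<bar>s * \<epsilon> * coeff q (degree p)\<bar>"
        unfolding c_def t_def by (simp add: algebra_simps)
      also have "\<bar>s * \<epsilon> * coeff q (degree p)\<bar> = \<epsilon> * \<bar>coeff q (degree p)\<bar>"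
        using s \<epsilon> by (simp add: abs_mult)
      finally have "\<bar>c\<bar> * d ^ degree p \<le>
        (\<bar>coeff p (degree p) - t * coeff q (degree p)\<bar> + \<epsilon> * \<bar>coeff q (degree p)\<bar>) * d ^ degree p"
        using d by (intro mult_right_mono) auto
      also have "\<dots> = \<bar>coeff p (degree p) - t * coeff q (degree p)\<bar> * d ^ degree p +
          \<epsilon> * (\<bar>coeff q (degree p)\<bar> * d ^ degree p)" by (simp add: algebra_simps)
      also have "\<bar>coeff p (degree p) - t * coeff q (degree p)\<bar> * d ^ degree p \<le>
          \<bar>coeff p (degree p) - t * coeff q (degree p)\<bar> * (\<Prod>z\<in>Z. cmod (w - of_real (g z)))"
        using dm by (intro mult_left_mono) auto
      also have "\<dots> = cmod (poly (cpoly p) w - of_real t * poly (cpoly q) w)"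
        unfolding g(2) norm_mult norm_of_real by (simp add: prod_norm)
      also have "poly (cpoly p) w - of_real t * poly (cpoly q) w = of_real (s * \<epsilon>) * poly (cpoly q) w"
        unfolding w t_def by (simp add: algebra_simps)
      also have "cmod \<dots> = \<epsilon> * cmod (poly (cpoly q) w)" using s \<epsilon> by (simp add: norm_mult)
      finally show "\<bar>c\<bar> * d ^ degree p \<le>
        \<epsilon> * (cmod (poly (cpoly q) w) + \<bar>coeff q (degree p)\<bar> * d ^ degree p)"
        by (simp add: algebra_simps)
    qed
    moreover have "\<bar>c\<bar> * d ^ degree p > 0" using c d by simp
    ultimately show False by simp
  qed
  then obtain z x where zx: "z \<in> Z" "w = of_real x" "lo z \<le> x" "x \<le> hi z" by (auto simp: S_def)
  have "complex_of_real (poly p x) = of_real (s * poly q x)" using w by (simp add: zx)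
  then have "\<bar>poly p x\<bar> = \<bar>poly q x\<bar>" using s by (simp only: of_real_eq_iff abs_mult)
  then have "x \<notin> band z" using less_on_band[OF zx(1), of x] by auto
  then have "x = lo z \<or> x = hi z" using zx by (auto simp: band_def)
  then show ?thesis using zx by auto
qed

end

section \<open>Rational functions and divisors, with the extremal point at infinity\<close>

lemma poly_eq_if_eq_generic:
  fixes a b r :: "complex poly"
  assumes "r \<noteq> 0" "\<And>z. poly r z \<noteq> 0 \<Longrightarrow> poly a z = poly b z"
  shows "a = b"
proof -
  have "poly (r * (a - b)) z = 0" for z using assms(2)[of z] by auto
  then have "r * (a - b) = 0" using poly_all_0_iff_0 by blast
  then show ?thesis using assms(1) by simp
qed

lemma coprime_cpoly:
  assumes "coprime p q"
  shows "coprime (cpoly p) (cpoly q)"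
proof -
  obtain a b where "a * p + b * q = 1"
    using bezout_coefficients_fst_snd[of p q] assms by (auto simp: coprime_iff_gcd_eq_1)
  then have "cpoly (a * p + b * q) = 1" by simp
  then have 1: "cpoly a * cpoly p + cpoly b * cpoly q = 1" by (simp add: cpoly_add cpoly_mult)
  show ?thesis
    by (rule coprimeI) (metis 1 dvd_add dvd_mult)
qed

lemma rat_rep_rep: "is_ratfun F \<Longrightarrow> rat_rep (fst (rep F)) (snd (rep F)) F"
  unfolding is_ratfun_def rep_def by (rule someI_ex) auto

lemma rat_rep_cross:
  assumes "rat_rep p q F" "rat_rep p' q' F"
  shows "p * q' = p' * q"
proof (rule poly_eq_if_eq_generic[of "q * q'"])
  show "q * q' \<noteq> 0" using assms by (auto simp: rat_rep_def)
  fix z assume z: "poly (q * q') z \<noteq> 0"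
  have "eval_rat p q (Some z) = eval_rat p' q' (Some z)" using assms by (metis rat_rep_def)
  then show "poly (p * q') z = poly (p' * q) z" using z by (simp add: eval_rat_def field_simps)
qed

lemma coprime_cross:
  fixes p q p' q' :: "complex poly"
  assumes "coprime p q" "coprime p' q'" "q \<noteq> 0" "q' \<noteq> 0" "p * q' = p' * q"
  shows "\<exists>k. k \<noteq> 0 \<and> p' = smult k p \<and> q' = smult k q"
proof -
  have "q dvd p * q'" "q' dvd p' * q" using assms(5) by (metis dvd_triv_right)+
  then have dvd: "q dvd q'" "q' dvd q"
    using assms(1,2) by (metis coprime_commute coprime_dvd_mult_right_iff)+
  then obtain r where r: "q' = q * r" by (elim dvdE)
  have "r \<noteq> 0" using r assms by auto
  have "degree q' \<le> degree q" using dvd(2) assms(3) by (rule dvd_imp_degree_le)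
  then have "degree r = 0" using assms(3) \<open>r \<noteq> 0\<close> by (simp add: r degree_mult_eq)
  then obtain k where k: "r = [:k:]" by (auto elim: degree_eq_zeroE)
  have q': "q' = smult k q" by (simp add: r k)
  then have "q * p' = q * smult k p" using assms(5) by (simp add: mult.commute)
  then have "p' = smult k p" using assms(3) by (metis mult_left_cancel)
  then show ?thesis using q' assms(4) by (intro exI[of _ k]) auto
qed

lemma rat_rep_unique:
  assumes "rat_rep p q F" "rat_rep p' q' F"
  shows "\<exists>k. k \<noteq> 0 \<and> p' = smult k p \<and> q' = smult k q"
  using coprime_cross rat_rep_cross[OF assms] assms by (auto simp: rat_rep_def)

lemma eval_rat_smult: "k \<noteq> 0 \<Longrightarrow> eval_rat (smult k p) (smult k q) = eval_rat p q"
  by (rule ext) (simp add: eval_rat_def split: option.split)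

lemma rat_rep_eqI:
  assumes "rat_rep p q F" "rat_rep p' q' G" "p * q' = p' * q"
  shows "F = G"
  using coprime_cross[of p q p' q'] assms by (auto simp: rat_rep_def eval_rat_smult)

lemma polar_div_rat_rep:
  assumes "rat_rep p q F"
  shows "polar_div F x = (case x of None \<Rightarrow> max 0 (int (degree p) - int (degree q)) | Some z \<Rightarrow> int (order z q))"
proof -
  have "is_ratfun F" using assms by (auto simp: is_ratfun_def)
  from rat_rep_unique[OF assms rat_rep_rep[OF this]] obtain k where
    "k \<noteq> 0" "fst (rep F) = smult k p" "snd (rep F) = smult k q" by auto
  then show ?thesis
    by (auto simp: polar_div_def case_prod_beta order_smult split: option.split)
qed

lemma zero_div_rat_rep:
  assumes "rat_rep p q F"
  shows "zero_div F x = (if p = 0 then 0 else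
    (case x of None \<Rightarrow> max 0 (int (degree q) - int (degree p)) | Some z \<Rightarrow> int (order z p)))"
proof -
  have "is_ratfun F" using assms by (auto simp: is_ratfun_def)
  from rat_rep_unique[OF assms rat_rep_rep[OF this]] obtain k where
    "k \<noteq> 0" "fst (rep F) = smult k p" "snd (rep F) = smult k q" by auto
  then show ?thesis
    by (auto simp: zero_div_def case_prod_beta order_smult split: option.split)
qed

lemma order_prod:
  fixes f :: "'a \<Rightarrow> 'b::idom poly"
  assumes "finite A" "\<And>a. a \<in> A \<Longrightarrow> f a \<noteq> 0"
  shows "order z (\<Prod>a\<in>A. f a) = (\<Sum>a\<in>A. order z (f a))"
  using assms by (induction A rule: finite_induct) (auto simp: order_mult)

lemma order_linear_power: "order z ([:-c, 1:] ^ k) = (if z = c then k else 0)"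
  by (auto simp: order_power_n_n intro: order_0I)

lemma dvd_if_order_le:
  fixes p q :: "complex poly"
  assumes "p \<noteq> 0" "q \<noteq> 0" "\<And>z. order z p \<le> order z q"
  shows "p dvd q"
proof -
  have sub: "{z. poly p z = 0} \<subseteq> {z. poly q z = 0}"
  proof safe
    fix z assume "poly p z = 0"
    then have "order z p > 0" using assms by (simp add: order_gt_0_iff)
    then have "order z q > 0" using assms(3)[of z] by simp
    then show "poly q z = 0" using assms by (simp add: order_gt_0_iff)
  qed
  have "(\<Prod>z|poly p z = 0. [:-z, 1:] ^ order z p) dvd (\<Prod>z|poly p z = 0. [:-z, 1:] ^ order z q)"
    using assms(3) by (intro prod_dvd_prod le_imp_power_dvd) auto
  also have "\<dots> dvd (\<Prod>z|poly q z = 0. [:-z, 1:] ^ order z q)"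
    using sub poly_roots_finite[OF assms(2)] by (intro prod_dvd_prod_subset)
  finally have "smult (lead_coeff p) (\<Prod>z|poly p z = 0. [:-z, 1:] ^ order z p) dvd
      smult (lead_coeff q) (\<Prod>z|poly q z = 0. [:-z, 1:] ^ order z q)"
    using assms by (simp add: smult_dvd_iff dvd_smult)
  then show ?thesis by (simp only: complex_poly_decompose)
qed

lemma poly_over_power_tendsto:
  fixes p :: "complex poly"
  assumes "degree p \<le> n"
  shows "((\<lambda>z. poly p z / z ^ n) \<longlongrightarrow> coeff p n) at_infinity"
proof (cases "degree p = n")
  case True
  then show ?thesis using poly_divide_tendsto_aux[of p] by simp
next
  case False
  then have "degree p < degree (monom 1 n :: complex poly)"
    using assms by (simp add: degree_monom_eq)
  from poly_divide_tendsto_0_at_infinity[OF this] show ?thesis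
    using False assms by (simp add: poly_monom coeff_eq_0)
qed

abbreviation R :: "real \<Rightarrow> complex option" where
  "R t \<equiv> Some (complex_of_real t)"

lemma Rbar_iff: "x \<in> Rbar \<longleftrightarrow> x = None \<or> (\<exists>t. x = R t)"
  by (auto simp: Rbar_def)

text \<open>K is the set E in a coordinate that puts the extremal point at infinity; compactness in
  the reals expresses that E stays away from that point. The order \<open>D None\<close> at infinity
  may be zero.\<close>

locale infinity_problem =
  fixes K :: "real set" and D :: "complex option \<Rightarrow> int" and n :: nat
  assumes compact_K: "compact K" and infinite_K: "infinite K" and n_pos: "n \<ge> 1"
    and D_fin: "finite {x. D x \<noteq> 0}" and D_nonneg: "\<And>x. D x \<ge> 0"
    and D_deg: "div_deg D = int n"
    and D_supp: "\<And>x. D x \<noteq> 0 \<Longrightarrow> x \<in> Rbar - R ` K"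
begin

definition C :: "real set" where "C = {c. D (R c) \<noteq> 0}"

text \<open>The poles allowed at infinity are left out, so its degree is n - \<open>D None\<close>;
  the bound n on the numerator then permits exactly a pole of order \<open>D None\<close> at
  infinity.\<close>

definition Q :: "real poly" where "Q = (\<Prod>c\<in>C. [:-c, 1:] ^ nat (D (R c)))"

lemma finite_C: "finite C"
proof -
  have "R ` C \<subseteq> {x. D x \<noteq> 0}" by (auto simp: C_def)
  then have "finite (R ` C)" using D_fin finite_subset by blast
  then show ?thesis by (rule finite_imageD) (auto simp: inj_on_def)
qed

lemma cpoly_Q: "cpoly Q = (\<Prod>c\<in>C. [:- of_real c, 1:] ^ nat (D (R c)))"
  by (simp add: Q_def cpoly_prod cpoly_power cpoly_linear)

lemma Q_nz: "Q \<noteq> 0"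
  using finite_C by (simp add: Q_def)

lemma poly_Q: "poly Q x = (\<Prod>c\<in>C. (x - c) ^ nat (D (R c)))"
  by (simp add: Q_def poly_prod poly_power)

lemma poly_Q_eq_0_iff: "poly Q x = 0 \<longleftrightarrow> x \<in> C"
proof -
  have "nat (D (R c)) > 0" if "c \<in> C" for c using that D_nonneg[of "R c"] by (auto simp: C_def)
  then show ?thesis using finite_C by (auto simp: poly_Q)
qed

lemma Q_nz_on_K: "x \<in> K \<Longrightarrow> poly Q x \<noteq> 0"
  using D_supp[of "R x"] by (auto simp: poly_Q_eq_0_iff C_def)

lemma order_Q: "int (order z (cpoly Q)) = D (Some z)"
proof -
  have "order z (cpoly Q) = (\<Sum>c\<in>C. if z = of_real c then nat (D (R c)) else 0)"
    unfolding cpoly_Q using finite_C by (subst order_prod) (auto simp: order_linear_power intro!: sum.cong)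
  also have "\<dots> = nat (D (Some z))"
  proof (cases "z \<in> of_real ` C")
    case True
    then obtain c where c: "c \<in> C" "z = of_real c" by auto
    then have "(\<Sum>c\<in>C. if z = of_real c then nat (D (R c)) else 0) = (\<Sum>c'\<in>C. if c = c' then nat (D (R c')) else 0)"
      by (intro sum.cong) auto
    then show ?thesis using c finite_C by simp
  next
    case False
    then have "D (Some z) = 0" using D_supp[of "Some z"] by (auto simp: C_def Rbar_iff)
    moreover have "(\<Sum>c\<in>C. if z = of_real c then nat (D (R c)) else 0) = 0"
      using False by (intro sum.neutral) auto
    ultimately show ?thesis by simp
  qed
  finally show ?thesis using D_nonneg[of "Some z"] by simp
qed

lemma degree_Q: "int (degree Q) = int n - D None"
proof -
  have sub: "{x. D x \<noteq> 0} \<subseteq> insert None (R ` C)"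
    using D_supp by (auto simp: C_def Rbar_iff)
  have "int n = sum D (insert None (R ` C))"
    unfolding D_deg[symmetric] div_deg_def using sub finite_C
    by (intro sum.mono_neutral_left) (auto simp: C_def)
  also have "\<dots> = D None + sum D (R ` C)" using finite_C by (subst sum.insert) auto
  also have "sum D (R ` C) = (\<Sum>c\<in>C. D (R c))"
    by (subst sum.reindex) (auto simp: inj_on_def)
  also have "\<dots> = int (degree Q)"
    unfolding Q_def using finite_C D_nonneg
    by (subst degree_prod_sum_eq) (auto simp: degree_power_eq intro!: sum.cong)
  finally show ?thesis by simp
qed

lemma lead_coeff_Q: "lead_coeff Q = 1"
  by (simp add: Q_def lead_coeff_prod lead_coeff_power)

definition represents :: "(complex option \<Rightarrow> complex option) \<Rightarrow> complex poly \<Rightarrow> bool" where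
  "represents F P \<longleftrightarrow> (\<exists>p q s. rat_rep p q F \<and> P = p * s \<and> cpoly Q = q * s)"

lemma Lspace_represents:
  assumes "F \<in> Lspace D"
  shows "\<exists>P. represents F P \<and> degree P \<le> n"
proof -
  obtain p q where pq: "rat_rep p q F" using assms by (auto simp: Lspace_def is_ratfun_def)
  have q0: "q \<noteq> 0" using pq by (simp add: rat_rep_def)
  have le: "polar_div F x \<le> D x" for x using assms by (simp add: Lspace_def)
  have "q dvd cpoly Q"
  proof (rule dvd_if_order_le)
    show "order z q \<le> order z (cpoly Q)" for z
      using le[of "Some z"] order_Q[of z] by (simp add: polar_div_rat_rep[OF pq])
  qed (use q0 Q_nz in auto)
  then obtain s where s: "cpoly Q = q * s" by (elim dvdE)
  then have s0: "s \<noteq> 0" using Q_nz by auto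
  have "degree q + degree s = degree Q"
    using degree_mult_eq[OF q0 s0] by (simp flip: s)
  moreover have "int (degree p) - int (degree q) \<le> D None"
    using le[of None] by (simp add: polar_div_rat_rep[OF pq])
  moreover have "degree (p * s) \<le> degree p + degree s" by (rule degree_mult_le)
  ultimately have "degree (p * s) \<le> n" using degree_Q by linarith
  then show ?thesis using pq s by (auto simp: represents_def)
qed

lemma represents_Lspace:
  assumes "represents F P" "degree P \<le> n"
  shows "F \<in> Lspace D"
proof -
  obtain p q s where pq: "rat_rep p q F" "P = p * s" "cpoly Q = q * s"
    using assms by (auto simp: represents_def)
  have nz: "q \<noteq> 0" "s \<noteq> 0" using pq(3) Q_nz by auto
  have deg: "degree q + degree s = degree Q"
    using degree_mult_eq[OF nz] by (simp flip: pq(3))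
  have "polar_div F x \<le> D x" for x
  proof (cases x)
    case None
    show ?thesis
    proof (cases "p = 0")
      case True
      then show ?thesis using D_nonneg[of None] by (simp add: polar_div_rat_rep[OF pq(1)] None)
    next
      case False
      then have "degree p + degree s \<le> n" using assms(2) nz by (simp add: pq(2) degree_mult_eq)
      then show ?thesis using deg degree_Q D_nonneg[of None]
        by (simp add: polar_div_rat_rep[OF pq(1)] None)
    qed
  next
    case (Some z)
    have "order z q \<le> order z (cpoly Q)" using Q_nz pq(3) by (intro dvd_imp_order_le) auto
    then show ?thesis using order_Q[of z] by (simp add: polar_div_rat_rep[OF pq(1)] Some)
  qed
  then show ?thesis using pq(1) by (auto simp: Lspace_def is_ratfun_def)
qed

lemma ex_represents: "\<exists>F. represents F P"
proof -
  have "gcd P (cpoly Q) \<noteq> 0" using Q_nz by simp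
  from gcd_coprime_exists[OF this] obtain p q where
    "P = p * gcd P (cpoly Q)" "cpoly Q = q * gcd P (cpoly Q)" "coprime p q" by blast
  moreover have "q \<noteq> 0" using calculation(2) Q_nz by auto
  ultimately show ?thesis unfolding represents_def rat_rep_def by blast
qed

lemma represents_unique:
  assumes "represents F P" "represents G P"
  shows "F = G"
proof -
  obtain p q s where 1: "rat_rep p q F" "P = p * s" "cpoly Q = q * s"
    using assms by (auto simp: represents_def)
  obtain p' q' s' where 2: "rat_rep p' q' G" "P = p' * s'" "cpoly Q = q' * s'"
    using assms by (auto simp: represents_def)
  have nz: "s * s' \<noteq> 0" using 1 2 Q_nz by auto
  have "(p * q') * (s * s') = P * cpoly Q" using 1 2 by (simp add: mult_ac)
  also have "\<dots> = (p' * q) * (s * s')" using 1 2 by (metis mult.assoc mult.commute mult.left_commute)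
  finally have "p * q' = p' * q" using nz by (metis mult_right_cancel)
  then show ?thesis using rat_rep_eqI 1 2 by blast
qed

lemma represents_value:
  assumes "represents F P" "poly (cpoly Q) z \<noteq> 0"
  shows "F (Some z) = Some (poly P z / poly (cpoly Q) z)"
  using assms by (auto simp: represents_def rat_rep_def eval_rat_def)

lemma represents_norm:
  assumes "represents F P" "x \<in> K"
  shows "(\<exists>w. F (R x) = Some w \<and> cmod w \<le> 1) \<longleftrightarrow> cmod (poly P (of_real x)) \<le> \<bar>poly Q x\<bar>"
  using represents_value[OF assms(1), of "of_real x"] Q_nz_on_K[OF assms(2)]
  by (simp add: norm_divide divide_le_eq)

lemma admissible_represents:
  assumes "represents F P" "degree P \<le> n"
  shows "F \<in> admissible (R ` K) D \<longleftrightarrow> (\<forall>x\<in>K. cmod (poly P (of_real x)) \<le> \<bar>poly Q x\<bar>)"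
  using represents_Lspace[OF assms] represents_norm[OF assms(1)] by (auto simp: admissible_def)

text \<open>Since n = d + \<open>degree Q\<close> and Q is monic, F(z) / z^d is the quotient of P(z)
  / z^n and Q(z) / z^\<open>degree Q\<close>, the latter tending to 1.\<close>

lemma objective_represents:
  assumes "represents F P" "degree P \<le> n"
  shows "objective None (nat (D None)) F = Re (coeff P n)"
proof -
  define d where "d = nat (D None)"
  have n: "n = d + degree Q" using degree_Q D_nonneg[of None] by (simp add: d_def)
  have Q1: "((\<lambda>z. poly (cpoly Q) z / z ^ degree Q) \<longlongrightarrow> 1) at_infinity"
    using poly_divide_tendsto_aux[of "cpoly Q"] lead_coeff_Q by simp
  then have "((\<lambda>z. (poly P z / z ^ n) / (poly (cpoly Q) z / z ^ degree Q)) \<longlongrightarrow> coeff P n / 1) at_infinity"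
    using poly_over_power_tendsto[OF assms(2)] by (intro tendsto_divide) auto
  moreover have "eventually (\<lambda>z. (poly P z / z ^ n) / (poly (cpoly Q) z / z ^ degree Q) = fval F z / z ^ d) at_infinity"
  proof -
    have "eventually (\<lambda>z. poly (cpoly Q) z / z ^ degree Q \<noteq> 0) at_infinity"
      by (rule tendsto_imp_eventually_ne[OF Q1]) simp
    moreover have "eventually (\<lambda>z::complex. z \<noteq> 0) at_infinity"
      by (rule eventually_at_infinityI[of 1]) auto
    ultimately show ?thesis
    proof eventually_elim
      case (elim z)
      then have "fval F z = poly P z / poly (cpoly Q) z"
        using represents_value[OF assms(1), of z] by (simp add: fval_def)
      then show ?case using elim by (simp add: n power_add field_simps)
    qed
  qed
  ultimately have "((\<lambda>z. fval F z / z ^ d) \<longlongrightarrow> coeff P n) at_infinity"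
    by (auto dest: Lim_transform_eventually)
  then have "Lim at_infinity (\<lambda>z. fval F z / z ^ d) = coeff P n"
    using tendsto_Lim trivial_limit_at_infinity by blast
  then show ?thesis by (simp add: objective_def d_def)
qed

lemma div0_represents:
  assumes "represents F P" "P \<noteq> 0" "degree P \<le> n"
  shows "div0 F D x = (case x of None \<Rightarrow> int n - int (degree P) | Some z \<Rightarrow> int (order z P))"
proof -
  obtain p q s where pq: "rat_rep p q F" "P = p * s" "cpoly Q = q * s"
    using assms by (auto simp: represents_def)
  have nz: "q \<noteq> 0" "s \<noteq> 0" "p \<noteq> 0" using pq(2,3) Q_nz assms by auto
  have deg: "degree q + degree s = degree Q"
    using degree_mult_eq[OF nz(1,2)] by (simp flip: pq(3))
  have degP: "degree P = degree p + degree s" using nz by (simp add: pq degree_mult_eq)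
  have "order z (cpoly Q) = order z q + order z s" for z
    using nz unfolding pq(3) by (subst order_mult) auto
  then have "D (Some z) = int (order z q + order z s)" for z using order_Q[of z] by metis
  moreover have "order z P = order z p + order z s" for z
    using nz unfolding pq by (subst order_mult) auto
  ultimately show ?thesis using deg degP degree_Q nz
    by (auto simp: div0_def zero_div_rat_rep[OF pq(1)] polar_div_rat_rep[OF pq(1)] split: option.split)
qed

lemma maximizer_represents:
  assumes "is_maximizer (R ` K) D None F"
  shows "\<exists>U. extremal_poly K Q U n \<and> represents F (cpoly U)"
proof -
  have "F \<in> Lspace D" using assms by (simp add: is_maximizer_def admissible_def)
  then obtain P where P: "represents F P" "degree P \<le> n" using Lspace_represents by blast
  have "\<exists>U. extremal_poly K Q U n \<and> P = cpoly U"
  proof (rule complex_extremal[OF n_pos compact_K infinite_K Q_nz_on_K P(2)])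
    show "cmod (poly P (of_real x)) \<le> \<bar>poly Q x\<bar>" if "x \<in> K" for x
      using assms admissible_represents[OF P] that by (simp add: is_maximizer_def)
    fix W :: "complex poly" assume W: "degree W \<le> n"
      "\<And>x. x \<in> K \<Longrightarrow> cmod (poly W (of_real x)) \<le> \<bar>poly Q x\<bar>"
    \<comment> \<open>Every polynomial W is the numerator of some function, so each polynomial
      competitor is one in the original problem.\<close>
    obtain G where G: "represents G W" using ex_represents by blast
    have "G \<in> admissible (R ` K) D" using admissible_represents[OF G W(1)] W(2) by simp
    then have "objective None (nat (D None)) G \<le> objective None (nat (D None)) F"
      using assms by (simp add: is_maximizer_def)
    then show "Re (coeff W n) \<le> Re (coeff P n)"
      by (simp add: objective_represents[OF G W(1)] objective_represents[OF P])
  qed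
  then show ?thesis using P by blast
qed

lemma maximizer_unique:
  assumes "is_maximizer (R ` K) D None F" "is_maximizer (R ` K) D None G"
  shows "F = G"
  using maximizer_represents[OF assms(1)] maximizer_represents[OF assms(2)]
    extremal_poly_unique represents_unique by metis

end

section \<open>Cyclic order\<close>

lemma R_in_Rbar [simp]: "R t \<in> Rbar" and None_in_Rbar [simp]: "None \<in> Rbar"
  by (auto simp: Rbar_iff)

text \<open>The coordinate of \<open>y\<close> after a Moebius map that sends the pole \<open>x\<close> to infinity; any two such
  maps differ by an increasing affine map, so it decides the cyclic order of \<open>x, y, z\<close>.\<close>

definition pole_coord :: "complex option \<Rightarrow> complex option \<Rightarrow> real" where
  "pole_coord x y = (case x of None \<Rightarrow> Re (the y)
     | Some r \<Rightarrow> (case y of None \<Rightarrow> 0 | Some t \<Rightarrow> 1 / (Re r - Re t)))"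

lemma pole_coord_simps [simp]:
  "pole_coord None (R t) = t" "pole_coord (R r) None = 0" "pole_coord (R r) (R t) = 1 / (r - t)"
  by (simp_all add: pole_coord_def)

lemma mob_R: "mob a b c d (R t) = (if c * t + d = 0 then None else R ((a * t + b) / (c * t + d)))"
proof -
  have "complex_of_real c * of_real t + of_real d = of_real (c * t + d)" by simp
  then show ?thesis unfolding mob_def by (simp del: of_real_add of_real_mult) simp
qed

text \<open>With c = 0 the map is affine of slope a^2; with c nonzero and pole r the determinant
  condition gives the value a / c + (1 / c^2) / (r - t). Both slopes are positive, so no choice of
  the map reverses the order.\<close>

lemma mob_affine_pole_coord:
  assumes det: "a * d - b * c = 1" and x: "x \<in> Rbar" "mob a b c d x = None"
  shows "\<exists>k l. k > 0 \<and> (\<forall>y\<in>Rbar. y \<noteq> x \<longrightarrow>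
    mob a b c d y \<noteq> None \<and> Re (the (mob a b c d y)) = k * pole_coord x y + l)"
proof (cases x)
  case None
  then have c: "c = 0" using x by (simp add: mob_def split: if_splits)
  then have "a * d = 1" using det by simp
  then have ad: "a \<noteq> 0" "d = 1 / a" by (cases "a = 0"; simp add: field_simps)+
  show ?thesis
  proof (intro exI conjI ballI impI)
    show "a\<^sup>2 > 0" using ad by simp
    fix y assume "y \<in> Rbar" "y \<noteq> x"
    then obtain t where t: "y = R t" using None by (auto simp: Rbar_iff)
    show "mob a b c d y \<noteq> None" using ad by (simp add: t mob_R c)
    show "Re (the (mob a b c d y)) = a\<^sup>2 * pole_coord x y + a * b"
      using ad(1) unfolding ad(2) by (simp add: t mob_R c None pole_coord_def power2_eq_square field_simps)
  qed
next
  case (Some w)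
  then obtain r where r: "x = R r" using x by (auto simp: Rbar_iff)
  have cr: "c * r + d = 0" using x(2) by (simp add: r mob_R split: if_splits)
  then have c: "c \<noteq> 0" using det by (cases "c = 0") auto
  have d: "d = - c * r" using cr by simp
  show ?thesis
  proof (intro exI conjI ballI impI)
    show "1 / c\<^sup>2 > 0" using c by simp
    fix y assume y: "y \<in> Rbar" "y \<noteq> x"
    show "mob a b c d y \<noteq> None"
      using y c by (auto simp: Rbar_iff mob_R r d mob_def)
    show "Re (the (mob a b c d y)) = 1 / c\<^sup>2 * pole_coord x y + a / c"
    proof (cases y)
      case None
      then show ?thesis using c by (simp add: mob_def r pole_coord_def)
    next
      case (Some w)
      then obtain t where t: "y = R t" using y by (auto simp: Rbar_iff)
      have tr: "r - t \<noteq> 0" "t - r \<noteq> 0" using y by (auto simp: r t)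
      have ct: "c * t + d = c * (t - r)" by (simp add: d algebra_simps)
      have "b * c = - a * c * r - 1" using det by (simp add: d algebra_simps)
      then have "(a * t + b) * c = a * c * (t - r) - 1" by (simp add: algebra_simps)
      then have "a * t + b = (a * c * (t - r) - 1) / c" using c by (simp add: field_simps)
      then have "(a * t + b) / (c * t + d) = ((a * c * (t - r) - 1) / c) / (c * (t - r))"
        by (simp only: ct)
      also have "\<dots> = 1 / c\<^sup>2 * (1 / (r - t)) + a / c"
      proof -
        define u where "u = t - r"
        have u: "u \<noteq> 0" "r - t = - u" "t - r = u" using tr by (auto simp: u_def)
        show ?thesis unfolding u using u(1) c by (simp add: power2_eq_square field_simps)
      qed
      finally show ?thesis using c tr by (simp add: t r mob_R pole_coord_def ct)
    qed
  qed
qed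

lemma ex_mob_pole:
  assumes "x \<in> Rbar"
  shows "\<exists>a b c d. a * d - b * c = 1 \<and> mob a b c d x = None"
proof (cases x)
  case None
  then show ?thesis by (intro exI[of _ 1] exI[of _ 0]) (simp add: mob_def)
next
  case (Some w)
  then obtain r where "x = R r" using assms by (auto simp: Rbar_iff)
  then show ?thesis by (intro exI[of _ 0] exI[of _ 1] exI[of _ "-1"] exI[of _ r]) (simp add: mob_R)
qed

lemma cyc_ordered_iff:
  "cyc_ordered [x, y, z] \<longleftrightarrow> {x, y, z} \<subseteq> Rbar \<and> distinct [x, y, z] \<and> pole_coord x y < pole_coord x z"
proof (cases "{x, y, z} \<subseteq> Rbar \<and> distinct [x, y, z]")
  case True
  then have Rb: "x \<in> Rbar" "y \<in> Rbar" "z \<in> Rbar" "y \<noteq> x" "z \<noteq> x" by auto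
  have *: "mob a b c d y \<noteq> None \<and> mob a b c d z \<noteq> None \<and>
      (Re (the (mob a b c d y)) < Re (the (mob a b c d z)) \<longleftrightarrow> pole_coord x y < pole_coord x z)"
    if M: "a * d - b * c = 1" "mob a b c d x = None" for a b c d
  proof -
    obtain k l where "k > 0" "\<forall>y\<in>Rbar. y \<noteq> x \<longrightarrow>
      mob a b c d y \<noteq> None \<and> Re (the (mob a b c d y)) = k * pole_coord x y + l"
      using mob_affine_pole_coord[OF M(1) Rb(1) M(2)] by blast
    then show ?thesis using Rb by simp
  qed
  have "cyc_ordered [x, y, z] \<longleftrightarrow> (\<exists>a b c d. a * d - b * c = 1 \<and> mob a b c d x = None \<and>
      mob a b c d y \<noteq> None \<and> mob a b c d z \<noteq> None \<and>
      Re (the (mob a b c d y)) < Re (the (mob a b c d z)))"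
    using True by (simp add: cyc_ordered_def)
  also have "\<dots> \<longleftrightarrow> pole_coord x y < pole_coord x z"
  proof
    assume "pole_coord x y < pole_coord x z"
    moreover obtain a b c d where M: "a * d - b * c = 1" "mob a b c d x = None"
      using ex_mob_pole[OF Rb(1)] by blast
    ultimately show "\<exists>a b c d. a * d - b * c = 1 \<and> mob a b c d x = None \<and>
      mob a b c d y \<noteq> None \<and> mob a b c d z \<noteq> None \<and>
      Re (the (mob a b c d y)) < Re (the (mob a b c d z))" using *[OF M] M by metis
  qed (use * in metis)
  finally show ?thesis using True by simp
next
  case False
  then show ?thesis by (auto simp: cyc_ordered_def)
qed

lemma cyc_ordered_R:
  "cyc_ordered [R x, R y, R z] \<longleftrightarrow> x < y \<and> y < z \<or> y < z \<and> z < x \<or> z < x \<and> x < y"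
proof -
  have "1 / (x - y) < 1 / (x - z) \<longleftrightarrow> x < y \<and> y < z \<or> y < z \<and> z < x \<or> z < x \<and> x < y"
    if ne: "x \<noteq> y" "x \<noteq> z" "y \<noteq> z"
  proof -
    consider "x < y" "x < z" | "x < y" "z < x" | "y < x" "x < z" | "y < x" "z < x"
      using ne by linarith
    then show ?thesis
    proof cases
      case 1
      then show ?thesis
        using inverse_less_iff_less_neg[of "x - y" "x - z"] by (auto simp: inverse_eq_divide)
    next
      case 2
      then have "1 / (x - y) < 0" "1 / (x - z) > 0" by (auto simp: divide_less_0_iff)
      then show ?thesis using 2 by linarith
    next
      case 3
      then have "1 / (x - y) > 0" "1 / (x - z) < 0" by (auto simp: divide_less_0_iff)
      then show ?thesis using 3 by linarith
    next
      case 4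
      then show ?thesis
        using inverse_less_iff_less[of "x - y" "x - z"] by (auto simp: inverse_eq_divide)
    qed
  qed
  then show ?thesis by (cases "x = y \<or> x = z \<or> y = z") (auto simp: cyc_ordered_iff)
qed

lemma cint_subset_Rbar: "cint a b \<subseteq> Rbar"
  by (auto simp: cint_def cyc_ordered_def)

lemma R_in_cint: "R y \<in> cint (R x) (R z) \<longleftrightarrow> x < y \<and> y < z \<or> y < z \<and> z < x \<or> z < x \<and> x < y"
  by (simp add: cint_def cyc_ordered_R)

lemma None_in_cint: "None \<in> cint (R x) (R z) \<longleftrightarrow> z < x"
  by (auto simp: cint_def cyc_ordered_iff divide_less_0_iff)

lemma cint_None_right: "cint (R x) None = R ` {x<..}"
proof safe
  fix y assume y: "y \<in> cint (R x) None"
  then obtain t where "y = R t" using cint_subset_Rbar by (auto simp: cint_def cyc_ordered_iff Rbar_iff)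
  then show "y \<in> R ` {x<..}" using y by (auto simp: cint_def cyc_ordered_iff divide_less_0_iff)
qed (auto simp: cint_def cyc_ordered_iff divide_less_0_iff)

lemma cint_None_left: "cint None (R x) = R ` {..<x}"
proof safe
  fix y assume y: "y \<in> cint None (R x)"
  then obtain t where "y = R t" by (auto simp: cint_def cyc_ordered_iff Rbar_iff)
  then show "y \<in> R ` {..<x}" using y by (auto simp: cint_def cyc_ordered_iff)
qed (auto simp: cint_def cyc_ordered_iff)

section \<open>Maximizers for the extremal point at infinity\<close>

lemma sum_order_eq_degree:
  fixes p :: "complex poly"
  assumes "p \<noteq> 0"
  shows "(\<Sum>z|poly p z = 0. order z p) = degree p"
proof -
  have "degree p = degree (smult (lead_coeff p) (\<Prod>z|poly p z = 0. [:-z, 1:] ^ order z p))"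
    by (simp only: complex_poly_decompose)
  also have "\<dots> = degree (\<Prod>z|poly p z = 0. [:-z, 1:] ^ order z p)"
    using assms by simp
  also have "\<dots> = (\<Sum>z|poly p z = 0. order z p)"
    by (subst degree_prod_sum_eq) (auto simp: degree_power_eq)
  finally show ?thesis by simp
qed

lemma rat_deg_rat_rep:
  assumes "rat_rep p q F"
  shows "rat_deg F = max (int (degree p)) (int (degree q))"
proof -
  have q: "q \<noteq> 0" using assms by (simp add: rat_rep_def)
  have fin: "finite {z. poly q z = 0}" by (rule poly_roots_finite[OF q])
  let ?A = "insert None (Some ` {z. poly q z = 0})"
  have "rat_deg F = sum (polar_div F) ?A"
    unfolding rat_deg_def div_deg_def
  proof (rule sum.mono_neutral_left)
    show "finite ?A" using fin by simp
    show "{x. polar_div F x \<noteq> 0} \<subseteq> ?A"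
    proof
      fix x assume "x \<in> {x. polar_div F x \<noteq> 0}"
      then show "x \<in> ?A"
        using q by (cases x) (auto simp: polar_div_rat_rep[OF assms] order_eq_0_iff)
    qed
  qed auto
  also have "\<dots> = polar_div F None + (\<Sum>z|poly q z = 0. polar_div F (Some z))"
    using fin by (subst sum.insert) (auto simp: sum.reindex inj_on_def)
  also have "\<dots> = max 0 (int (degree p) - int (degree q)) + int (\<Sum>z|poly q z = 0. order z q)"
    by (simp add: polar_div_rat_rep[OF assms])
  also have "\<dots> = max (int (degree p)) (int (degree q))"
    by (simp add: sum_order_eq_degree[OF q])
  finally show ?thesis .
qed

lemma sgn_prod_linear:
  fixes x :: real
  assumes "finite A" "x \<notin> A"
  shows "sgn (\<Prod>c\<in>A. (x - c) ^ k c) = (-1) ^ (\<Sum>c\<in>{c\<in>A. x < c}. k c)"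
  using assms
proof (induction A rule: finite_induct)
  case (insert c A)
  show ?case
  proof (cases "x < c")
    case True
    then have "{c'\<in>insert c A. x < c'} = insert c {c'\<in>A. x < c'}" by auto
    then show ?thesis using insert True by (simp add: sgn_mult power_sgn[symmetric] power_add)
  next
    case False
    then have "{c'\<in>insert c A. x < c'} = {c'\<in>A. x < c'}" by auto
    then show ?thesis using insert False by (simp add: sgn_mult power_sgn[symmetric])
  qed
qed simp

text \<open>Both fractions are kept: U / Q carries extremality and the divisor \<open>div0\<close>,
  p / q the values of F. The zeros of s are the points where an allowed pole is cancelled.\<close>

locale infinity_solution = infinity_problem K D n
  for K :: "real set" and D :: "complex option \<Rightarrow> int" and n :: nat +
  fixes F :: "complex option \<Rightarrow> complex option" and U p q s :: "real poly"
  assumes extremal: "extremal_poly K Q U n" and F_U: "represents F (cpoly U)"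
    and U_eq: "U = p * s" and Q_eq: "Q = q * s" and coprime_pq: "coprime p q"

lemma (in infinity_problem) maximizer_solution:
  assumes "is_maximizer (R ` K) D None F"
  shows "\<exists>U p q s. infinity_solution K D n F U p q s"
proof -
  obtain U where U: "extremal_poly K Q U n" "represents F (cpoly U)"
    using maximizer_represents[OF assms] by blast
  have "gcd U Q \<noteq> 0" using Q_nz by simp
  from gcd_coprime_exists[OF this] obtain p q where
    "U = p * gcd U Q" "Q = q * gcd U Q" "coprime p q" by blast
  then show ?thesis using U infinity_problem_axioms
    unfolding infinity_solution_def infinity_solution_axioms_def by blast
qed

context infinity_solution
begin

sublocale E: extremal_poly K Q U n
  by (rule extremal)

lemma nz: "p \<noteq> 0" "q \<noteq> 0" "s \<noteq> 0"
  using U_eq Q_eq E.U_nz Q_nz by auto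

text \<open>\<open>represents\<close> only provides some reduced pair of complex polynomials;
  cross-multiplication identifies it with the real pair p, q.\<close>

lemma rat_rep_F: "rat_rep (cpoly p) (cpoly q) F"
proof -
  obtain p' q' s' where 1: "rat_rep p' q' F" "cpoly U = p' * s'" "cpoly Q = q' * s'"
    using F_U by (auto simp: represents_def)
  have 2: "rat_rep (cpoly p) (cpoly q) (eval_rat (cpoly p) (cpoly q))"
    using nz coprime_cpoly[OF coprime_pq] by (simp add: rat_rep_def)
  have "s' \<noteq> 0" using 1(3) Q_nz by auto
  have "(p' * cpoly q) * (s' * cpoly s) = cpoly U * cpoly Q"
    unfolding 1(2) Q_eq cpoly_mult by (simp add: mult_ac)
  also have "\<dots> = cpoly p * cpoly s * (q' * s')" unfolding 1(3) U_eq cpoly_mult ..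
  also have "\<dots> = (cpoly p * q') * (s' * cpoly s)" by (simp add: mult_ac)
  finally have "p' * cpoly q = cpoly p * q'"
    using \<open>s' \<noteq> 0\<close> nz by (metis mult_right_cancel mult_eq_0_iff cpoly_eq_0_iff)
  then show ?thesis using rat_rep_eqI[OF 1(1) 2] 2 by simp
qed

lemma F_eq: "F = eval_rat (cpoly p) (cpoly q)"
  using rat_rep_F by (simp add: rat_rep_def)

lemma degrees: "degree p + degree s = n" "degree q + degree s = degree Q" "degree q \<le> degree p"
proof -
  show 1: "degree p + degree s = n"
    using E.degree_U_eq nz by (simp add: U_eq degree_mult_eq)
  show 2: "degree q + degree s = degree Q" using nz by (simp add: Q_eq degree_mult_eq)
  show "degree q \<le> degree p" using 1 2 degree_Q D_nonneg[of None] by simp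
qed

lemma F_R: "poly q x \<noteq> 0 \<Longrightarrow> F (R x) = R (poly p x / poly q x)"
  by (simp add: F_eq eval_rat_def)

lemma F_K: "x \<in> K \<Longrightarrow> F (R x) = R (poly U x / poly Q x)"
  using represents_value[OF F_U, of "of_real x"] Q_nz_on_K by simp

lemma abs_one_K: "x \<in> K \<Longrightarrow> abs_one F (R x) \<longleftrightarrow> x \<in> E.X"
  using F_K[of x] Q_nz_on_K[of x] by (auto simp: abs_one_def E.X_def norm_divide)

lemma is_real: "F (map_option cnj z) = map_option cnj (F z)"
proof -
  have "poly (cpoly r) (cnj w) = cnj (poly (cpoly r) w)" for r w
    by (rule poly_cnj_real[symmetric]) simp
  then show ?thesis by (cases z) (auto simp: F_eq eval_rat_def)
qed

lemma div0_F: "div0 F D x = (case x of None \<Rightarrow> 0 | Some z \<Rightarrow> int (order z (cpoly U)))"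
  using div0_represents[OF F_U] E.U_nz E.degree_U_eq by (simp split: option.split)

lemma div0_pos_iff: "div0 F D x > 0 \<longleftrightarrow> (\<exists>t. x = R t \<and> poly U t = 0)"
proof -
  have "order z (cpoly U) > 0 \<longleftrightarrow> z \<in> complex_of_real ` {x. poly U x = 0}" for z
    unfolding E.zeros_cpoly_U[symmetric] using E.U_nz by (simp add: order_gt_0_iff)
  then show ?thesis by (auto simp: div0_F split: option.split)
qed

lemma div0_le_1: "div0 F D x \<le> 1"
proof -
  have "order z (cpoly U) \<le> 1" for z
    using E.rsquarefree_cpoly_U unfolding rsquarefree_def by (metis le_numeral_extra(4) zero_le)
  then show ?thesis by (auto simp: div0_F split: option.split)
qed

text \<open>A common zero would be a double zero of U = p s. As a consequence a zero of p is never a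
  point of D, which keeps zeros of F apart from cancelled poles.\<close>

lemma zero_p_not_s: "poly p x = 0 \<Longrightarrow> poly s x \<noteq> 0"
proof
  assume "poly p x = 0" "poly s x = 0"
  then have "poly U x = 0" "poly (pderiv U) x = 0" by (simp_all add: U_eq pderiv_mult)
  then show False using E.simple_zero by blast
qed

lemma zero_p_not_q: "poly p x = 0 \<Longrightarrow> poly q x \<noteq> 0"
  using coprime_poly_0[OF coprime_pq] by blast

lemma zero_p_not_C: "poly p x = 0 \<Longrightarrow> x \<notin> C"
  using zero_p_not_s zero_p_not_q by (simp add: Q_eq flip: poly_Q_eq_0_iff)

lemma zero_p_U: "poly p x = 0 \<Longrightarrow> poly U x = 0"
  by (simp add: U_eq)

lemma X_unit_level:
  assumes "y \<in> E.X"
  shows "\<bar>poly p y\<bar> = \<bar>poly q y\<bar>"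
proof -
  have "poly Q y \<noteq> 0" "\<bar>poly U y\<bar> = \<bar>poly Q y\<bar>" using assms Q_nz_on_K by (auto simp: E.X_def)
  then show ?thesis unfolding U_eq Q_eq by (auto simp: abs_mult)
qed

lemma X_nonempty: "E.X \<noteq> {}"
proof -
  have "{x. poly U x = 0} \<noteq> {}" using E.card_zeros n_pos by (metis card.empty not_one_le_zero)
  then show ?thesis using E.extremal_left by blast
qed

text \<open>All zeros of p are real and simple by counting: the n zeros of U are shared between p
  and s, whose degrees add up to n.\<close>

lemma interlaced:
  assumes "degree p \<ge> 1"
  shows "interlaced p q"
proof
  have "{x. poly U x = 0} = {x. poly p x = 0} \<union> {x. poly s x = 0}" by (auto simp: U_eq)
  then have "n \<le> card {x. poly p x = 0} + card {x. poly s x = 0}"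
    using card_Un_le E.card_zeros by metis
  then show "card {x. poly p x = 0} = degree p"
    using card_poly_roots_bound[OF nz(1)] card_poly_roots_bound[OF nz(3)] degrees(1) by linarith
  show "\<exists>y<z. \<bar>poly p y\<bar> = \<bar>poly q y\<bar>" "\<exists>y>z. \<bar>poly p y\<bar> = \<bar>poly q y\<bar>" if "poly p z = 0" for z
    using E.extremal_left E.extremal_right X_unit_level zero_p_U[OF that] by metis+
  show "\<exists>y. z < y \<and> y < z' \<and> \<bar>poly p y\<bar> = \<bar>poly q y\<bar>"
    if "poly p z = 0" "poly p z' = 0" "z < z'" for z z'
    using E.extremal_between zero_p_U X_unit_level that by metis
qed (use assms degrees zero_p_not_q in auto)

lemma const_iff: "is_const F \<longleftrightarrow> degree p = 0"
proof
  assume "degree p = 0"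
  then obtain c d where "p = [:c:]" "q = [:d:]" using degrees(3) by (auto elim!: degree_eq_zeroE)
  then have "F z = Some (of_real c / of_real d)" for z
    using nz by (cases z) (auto simp: F_eq eval_rat_def map_poly_pCons)
  then show "is_const F" by (auto simp: is_const_def)
next
  assume c: "is_const F"
  show "degree p = 0"
  proof (rule ccontr)
    assume "degree p \<noteq> 0"
    then interpret I: interlaced p q by (intro interlaced) simp
    obtain z where "z \<in> I.Z" using I.Z_nonempty by auto
    then have "poly p z = 0" by (simp add: I.Z_def)
    then have "F (R z) = R 0" using F_R[OF zero_p_not_q] by simp
    moreover obtain y where y: "y \<in> E.X" using X_nonempty by auto
    then have "abs_one F (R y)" using abs_one_K by (auto simp: E.X_def)
    ultimately show False using c by (auto simp: is_const_def abs_one_def)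
  qed
qed

lemma rat_deg_F: "rat_deg F = int (degree p)"
  using degrees(3) by (simp add: rat_deg_rat_rep[OF rat_rep_F])

text \<open>The value t = p(y) / q(y) has |t| < 1 and is taken only inside bands. So y shares a band
  with a zero z, and the segment between them contains no contact point.\<close>

lemma K_in_band:
  assumes y: "y \<in> K" "y \<notin> E.X"
  obtains z where "poly p z = 0" "\<And>x. x \<in> {min y z..max y z} \<Longrightarrow> \<bar>poly p x\<bar> < \<bar>poly q x\<bar>"
proof -
  have "\<bar>poly U y\<bar> < \<bar>poly Q y\<bar>" using y E.bound[of y] by (auto simp: E.X_def)
  then have less: "\<bar>poly p y\<bar> < \<bar>poly q y\<bar>"
    by (simp add: U_eq Q_eq abs_mult mult_less_cancel_right_disj)
  have "degree p \<ge> 1"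
  proof (rule ccontr)
    assume "\<not> 1 \<le> degree p"
    then have "degree p = 0" by simp
    then obtain c d where "p = [:c:]" "q = [:d:]" using degrees(3) by (auto elim!: degree_eq_zeroE)
    then show False using less X_nonempty X_unit_level by auto
  qed
  then interpret I: interlaced p q by (rule interlaced)
  define t where "t = poly p y / poly q y"
  have t: "\<bar>t\<bar> < 1" "poly p y = t * poly q y" using less by (auto simp: t_def abs_divide)
  obtain g where g: "\<And>z. z \<in> I.Z \<Longrightarrow> g z \<in> I.band z"
    "{w. poly (cpoly p) w = of_real t * poly (cpoly q) w} = of_real ` g ` I.Z"
    using I.level_set[OF t(1)] by metis
  have "complex_of_real y \<in> of_real ` g ` I.Z"
    unfolding g(2)[symmetric] using t(2) by (simp flip: of_real_mult)
  then obtain z where z: "z \<in> I.Z" "y = g z" by auto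
  have "\<bar>poly p x\<bar> < \<bar>poly q x\<bar>" if "x \<in> {min y z..max y z}" for x
    using that g(1)[OF z(1)] I.zero_in_band[OF z(1)] z(2)
    by (intro I.less_on_band[OF z(1)]) (auto simp: I.band_def)
  then show ?thesis using that[of z] z(1) by (simp add: I.Z_def)
qed

text \<open>Otherwise the last point \<alpha> of K is in a band with some zero z. The contact point
  right of z lies in K, hence between z and \<alpha>, hence in that band, where |p| < |q|.\<close>

lemma K_right_end:
  assumes "\<alpha> \<in> K" "\<And>y. y \<in> K \<Longrightarrow> y \<le> \<alpha>"
  shows "\<alpha> \<in> E.X"
proof (rule ccontr)
  assume "\<alpha> \<notin> E.X"
  then obtain z where z: "poly p z = 0" "\<And>x. x \<in> {min \<alpha> z..max \<alpha> z} \<Longrightarrow> \<bar>poly p x\<bar> < \<bar>poly q x\<bar>"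
    using K_in_band assms by metis
  obtain y where y: "y \<in> E.X" "z < y" using E.extremal_right zero_p_U[OF z(1)] by blast
  then have "y \<le> \<alpha>" using assms by (simp add: E.X_def)
  then show False using z(2)[of y] X_unit_level[OF y(1)] y(2) by auto
qed

lemma K_left_end:
  assumes "\<alpha> \<in> K" "\<And>y. y \<in> K \<Longrightarrow> \<alpha> \<le> y"
  shows "\<alpha> \<in> E.X"
proof (rule ccontr)
  assume "\<alpha> \<notin> E.X"
  then obtain z where z: "poly p z = 0" "\<And>x. x \<in> {min \<alpha> z..max \<alpha> z} \<Longrightarrow> \<bar>poly p x\<bar> < \<bar>poly q x\<bar>"
    using K_in_band assms by metis
  obtain y where y: "y \<in> E.X" "y < z" using E.extremal_left zero_p_U[OF z(1)] by blast
  then have "\<alpha> \<le> y" using assms by (simp add: E.X_def)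
  then show False using z(2)[of y] X_unit_level[OF y(1)] y(2) by auto
qed

lemma F_X_sgn:
  assumes "y \<in> E.X"
  shows "F (R y) = R (sgn (poly U y) * sgn (poly Q y))"
proof -
  have y: "y \<in> K" "\<bar>poly U y\<bar> = \<bar>poly Q y\<bar>" using assms by (simp_all add: E.X_def)
  have "poly U y / poly Q y = sgn (poly U y) * sgn (poly Q y)"
    using y(2) Q_nz_on_K[OF y(1)] unfolding abs_eq_iff by (auto simp: sgn_if)
  then show ?thesis using F_K[OF y(1)] by (simp only:)
qed

lemma sgn_U: "y \<in> E.X \<Longrightarrow> sgn (poly U y) = (-1) ^ card {x. poly U x = 0 \<and> y < x}"
proof -
  assume "y \<in> E.X"
  then have "poly U y \<noteq> 0" using Q_nz_on_K[of y] by (auto simp: E.X_def)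
  then have "sgn (\<Prod>x|poly U x = 0. (y - x) ^ 1) = (-1) ^ (\<Sum>x\<in>{x\<in>{x. poly U x = 0}. y < x}. 1)"
    using E.finite_zeros by (intro sgn_prod_linear) auto
  moreover have "poly U y = coeff U n * (\<Prod>x|poly U x = 0. y - x)"
    using arg_cong[OF E.U_factorization, of "\<lambda>r. poly r y"] by (simp add: poly_prod)
  from arg_cong[OF this, of sgn] have "sgn (poly U y) = sgn (\<Prod>x|poly U x = 0. y - x)"
    unfolding sgn_mult using E.coeff_U_pos by (simp only: sgn_pos mult_1)
  ultimately show ?thesis by simp
qed

lemma sgn_Q:
  assumes "y \<in> K"
  shows "sgn (poly Q y) = (-1) ^ (\<Sum>c\<in>{c\<in>C. y < c}. nat (D (R c)))"
proof -
  have "y \<notin> C" using Q_nz_on_K[OF assms] poly_Q_eq_0_iff by blast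
  then show ?thesis unfolding poly_Q by (rule sgn_prod_linear[OF finite_C])
qed

lemma X_K: "y \<in> E.X \<Longrightarrow> y \<in> K"
  by (simp add: E.X_def)

lemma extremal_in_cint:
  assumes "poly U x = 0" "poly U x' = 0" "x \<noteq> x'"
  shows "\<exists>y\<in>E.X. R y \<in> cint (R x) (R x')"
proof (cases "x < x'")
  case True
  then show ?thesis using E.extremal_between[OF assms(1,2)] by (auto simp: R_in_cint)
next
  case False
  \<comment> \<open>For x' < x the cyclic interval from x to x' passes through infinity and contains
    everything left of x'.\<close>
  then show ?thesis using E.extremal_left[OF assms(2)] assms(3) by (force simp: R_in_cint)
qed

lemma sum_D:
  "sum D (R ` S \<inter> {x. D x \<noteq> 0}) = int (\<Sum>c\<in>{c\<in>C. c \<in> S}. nat (D (R c)))"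
proof -
  have "R ` S \<inter> {x. D x \<noteq> 0} = R ` {c\<in>C. c \<in> S}" by (auto simp: C_def)
  then show ?thesis using D_nonneg by (simp add: sum.reindex inj_on_def)
qed

lemma sum_D_None:
  "sum D (insert None (R ` S) \<inter> {x. D x \<noteq> 0}) = D None + int (\<Sum>c\<in>{c\<in>C. c \<in> S}. nat (D (R c)))"
proof -
  have fin: "finite (R ` S \<inter> {x. D x \<noteq> 0})" using D_fin by auto
  show ?thesis
  proof (cases "D None = 0")
    case True
    then have "insert None (R ` S) \<inter> {x. D x \<noteq> 0} = R ` S \<inter> {x. D x \<noteq> 0}" by auto
    then show ?thesis using True by (simp only: sum_D)
  next
    case False
    then have "insert None (R ` S) \<inter> {x. D x \<noteq> 0} = insert None (R ` S \<inter> {x. D x \<noteq> 0})" by auto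
    moreover have "None \<notin> R ` S \<inter> {x. D x \<noteq> 0}" by auto
    from sum.insert[OF fin this, of D] have "sum D (insert None (R ` S \<inter> {x. D x \<noteq> 0})) =
      D None + sum D (R ` S \<inter> {x. D x \<noteq> 0})" .
    ultimately show ?thesis by (simp only: sum_D)
  qed
qed

section \<open>Gaps of K; a gap with \<beta> < \<alpha> passes through infinity\<close>

context
  fixes \<alpha> \<beta> :: real
  assumes ends: "\<alpha> \<in> K" "\<beta> \<in> K" "\<alpha> \<noteq> \<beta>" and gap: "cint (R \<alpha>) (R \<beta>) \<inter> R ` K = {}"
begin

lemma gap_K: "y \<in> K \<Longrightarrow> \<not> (\<alpha> < y \<and> y < \<beta> \<or> y < \<beta> \<and> \<beta> < \<alpha> \<or> \<beta> < \<alpha> \<and> \<alpha> < y)"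
  using gap by (auto simp: R_in_cint[symmetric])

lemma gap_zero_unique_less:
  assumes "poly U x = 0" "poly U x' = 0" "R x \<in> cint (R \<alpha>) (R \<beta>)" "R x' \<in> cint (R \<alpha>) (R \<beta>)"
  shows "\<not> x < x'"
proof
  assume less: "x < x'"
  \<comment> \<open>If \<alpha> < \<beta>, then y1 falls into the gap. If \<beta> < \<alpha>, then x
    < \<beta> puts y0 into it, and x > \<alpha> puts y2 into it.\<close>
  obtain y0 y1 y2 where "y0 \<in> K" "y1 \<in> K" "y2 \<in> K" "y0 < x" "x < y1" "y1 < x'" "x' < y2"
    using E.extremal_left[OF assms(1)] E.extremal_between[OF assms(1,2) less]
      E.extremal_right[OF assms(2)] X_K by metis
  then show False
    using gap_K[of y0] gap_K[of y1] gap_K[of y2] assms(3,4) unfolding R_in_cint by argo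
qed

lemma gap_zero_unique:
  assumes "poly U x = 0" "poly U x' = 0" "R x \<in> cint (R \<alpha>) (R \<beta>)" "R x' \<in> cint (R \<alpha>) (R \<beta>)"
  shows "x = x'"
  using gap_zero_unique_less assms by (metis linorder_neqE)

lemma outer_gap:
  assumes "None \<in> cint (R \<alpha>) (R \<beta>)" "y \<in> K"
  shows "\<beta> \<le> y" "y \<le> \<alpha>"
  using gap_K[OF assms(2)] assms(1) unfolding None_in_cint by argo+

lemma outer_gap_X:
  assumes "None \<in> cint (R \<alpha>) (R \<beta>)"
  shows "\<alpha> \<in> E.X" "\<beta> \<in> E.X"
  using K_right_end K_left_end ends outer_gap[OF assms] by auto

lemma zero_between_ends:
  assumes "None \<in> cint (R \<alpha>) (R \<beta>)" "poly U x = 0"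
  shows "\<beta> < x" "x < \<alpha>"
  using E.extremal_left[OF assms(2)] E.extremal_right[OF assms(2)] outer_gap[OF assms(1)] X_K
  by (meson le_less_trans less_le_trans)+

lemma outer_gap_div0:
  assumes "None \<in> cint (R \<alpha>) (R \<beta>)" "x \<in> cint (R \<alpha>) (R \<beta>)"
  shows "div0 F D x = 0"
proof (rule ccontr)
  assume "div0 F D x \<noteq> 0"
  moreover have "div0 F D x \<ge> 0" by (simp add: div0_F split: option.split)
  ultimately obtain t where t: "x = R t" "poly U t = 0" using div0_pos_iff[of x] by auto
  then show False
    using zero_between_ends[OF assms(1) t(2)] assms unfolding None_in_cint t(1) R_in_cint by argo
qed

text \<open>No zero of U lies right of \<alpha>, so U is positive there and only the poles between
  \<alpha> and infinity contribute to the sign.\<close>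

lemma value_right_end:
  assumes "None \<in> cint (R \<alpha>) (R \<beta>)"
  shows "F (R \<alpha>) = Some ((-1) ^ nat (sum D (cint (R \<alpha>) None \<inter> {c. D c \<noteq> 0})))"
proof -
  have none: "{x. poly U x = 0 \<and> \<alpha> < x} = {}" using zero_between_ends[OF assms] by force
  have "sgn (poly U \<alpha>) = 1"
    unfolding sgn_U[OF outer_gap_X(1)[OF assms]] none by simp
  moreover have "F (R \<alpha>) = R (sgn (poly U \<alpha>) * sgn (poly Q \<alpha>))"
    by (rule F_X_sgn[OF outer_gap_X(1)[OF assms]])
  ultimately show ?thesis
    unfolding sgn_Q[OF ends(1)] cint_None_right sum_D nat_int by simp
qed

text \<open>All n zeros of U lie right of \<beta>, and with l and r counting the poles left and
  right of \<beta> one has n = \<open>D None\<close> + l + r. The sign of Q cancels r, leaving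
  \<open>D None\<close> + l; hence the interval includes the extremal point itself.\<close>

lemma value_left_end:
  assumes "None \<in> cint (R \<alpha>) (R \<beta>)"
  shows "F (R \<beta>) = Some ((-1) ^ nat (sum D (cint_lc None (R \<beta>) \<inter> {c. D c \<noteq> 0})))"
proof -
  have all: "{x. poly U x = 0 \<and> \<beta> < x} = {x. poly U x = 0}" using zero_between_ends[OF assms] by auto
  define l r where "l = (\<Sum>c\<in>{c\<in>C. c \<in> {..<\<beta>}}. nat (D (R c)))" and "r = (\<Sum>c\<in>{c\<in>C. \<beta> < c}. nat (D (R c)))"
  have "\<beta> \<notin> C" using Q_nz_on_K[OF ends(2)] poly_Q_eq_0_iff by blast
  then have split: "C = {c\<in>C. c \<in> {..<\<beta>}} \<union> {c\<in>C. \<beta> < c}"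
    by auto (metis linorder_neqE)
  have "degree Q = (\<Sum>c\<in>C. nat (D (R c)))"
    unfolding Q_def using finite_C
    by (subst degree_prod_sum_eq) (auto simp: degree_power_eq intro!: sum.cong)
  also have "\<dots> = l + r" unfolding l_def r_def using finite_C
    by (subst split, subst sum.union_disjoint) auto
  finally have n: "int n = D None + int (l + r)" using degree_Q by simp
  define m where "m = nat (D None + int l)"
  have "n = m + r" using n D_nonneg[of None] by (simp add: m_def)
  then have "(-1) ^ n * (-1) ^ r = (-1 :: real) ^ m" by (simp add: power_add flip: power_mult_distrib)
  moreover have "F (R \<beta>) = R (sgn (poly U \<beta>) * sgn (poly Q \<beta>))"
    by (rule F_X_sgn[OF outer_gap_X(2)[OF assms]])
  ultimately have "F (R \<beta>) = R ((-1) ^ m)"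
    unfolding sgn_U[OF outer_gap_X(2)[OF assms]] sgn_Q[OF ends(2)] all E.card_zeros r_def by simp
  then show ?thesis unfolding cint_lc_def cint_None_left sum_D_None m_def l_def by simp
qed

lemma pole_gap:
  assumes c: "c \<in> cint (R \<alpha>) (R \<beta>)" "D c > 0"
  shows "\<alpha> \<in> E.X \<or> \<beta> \<in> E.X" "div0 F D c = 1 \<Longrightarrow> \<alpha> \<in> E.X \<and> \<beta> \<in> E.X"
proof -
  have "(\<alpha> \<in> E.X \<or> \<beta> \<in> E.X) \<and> (div0 F D c = 1 \<longrightarrow> \<alpha> \<in> E.X \<and> \<beta> \<in> E.X)"
  proof (cases "None \<in> cint (R \<alpha>) (R \<beta>)")
    case True
    then show ?thesis using outer_gap_X by simp
  next
    case False
    then have ab: "\<alpha> < \<beta>" using ends(3) by (simp add: None_in_cint)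
    obtain t where t: "c = R t"
      using c(1) False cint_subset_Rbar Rbar_iff[of c] by blast
    then have tab: "\<alpha> < t" "t < \<beta>" using c(1) ab by (auto simp: R_in_cint)
    have tC: "t \<in> C" using c(2) by (simp add: C_def t)
    have noK: "y \<le> \<alpha> \<or> \<beta> \<le> y" if "y \<in> E.X" for y using gap_K[OF X_K[OF that]] by argo
    show ?thesis
    proof (cases "poly U t = 0")
      case True
      \<comment> \<open>An end e outside X shares a band with a zero z of p, and z differs from t.
        The contact point between z and t must lie in the gap or between e and z, and neither is
        possible.\<close>
      have "e \<in> E.X" if e: "e = \<alpha> \<or> e = \<beta>" for e
      proof (rule ccontr)
        assume "e \<notin> E.X"
        then obtain z where z: "poly p z = 0"
          "\<And>x. x \<in> {min e z..max e z} \<Longrightarrow> \<bar>poly p x\<bar> < \<bar>poly q x\<bar>"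
          using K_in_band e ends by metis
        have nX: "y \<notin> {min e z..max e z}" if "y \<in> E.X" for y
          using z(2)[of y] X_unit_level[OF that] by force
        have "z \<noteq> t" using zero_p_not_C[OF z(1)] tC by auto
        then consider "z < t" | "t < z" by linarith
        then show False
        proof cases
          case 1
          then obtain y where "y \<in> E.X" "z < y" "y < t"
            using E.extremal_between[OF zero_p_U[OF z(1)] True] by auto
          then show False using noK[of y] nX[of y] e tab by auto
        next
          case 2
          then obtain y where "y \<in> E.X" "t < y" "y < z"
            using E.extremal_between[OF True zero_p_U[OF z(1)]] by auto
          then show False using noK[of y] nX[of y] e tab by auto
        qed
      qed
      then show ?thesis by blast
    next
      case False
      \<comment> \<open>A zero of Q = q s that is no zero of U = p s belongs to q: a genuine pole of
        F, which no band contains. So bands reaching \<alpha> and \<beta> have their zeros on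
        opposite sides of t, and the contact point between these zeros has no place.\<close>
      have q0: "poly q t = 0"
        using False tC poly_Q_eq_0_iff[of t] by (auto simp: U_eq Q_eq)
      have "\<alpha> \<in> E.X \<or> \<beta> \<in> E.X"
      proof (rule ccontr)
        assume nX: "\<not> ?thesis"
        obtain z where z: "poly p z = 0"
          "\<And>x. x \<in> {min \<alpha> z..max \<alpha> z} \<Longrightarrow> \<bar>poly p x\<bar> < \<bar>poly q x\<bar>"
          using K_in_band ends nX by metis
        obtain z' where z': "poly p z' = 0"
          "\<And>x. x \<in> {min \<beta> z'..max \<beta> z'} \<Longrightarrow> \<bar>poly p x\<bar> < \<bar>poly q x\<bar>"
          using K_in_band ends nX by metis
        have "z < t" using z(2)[of t] q0 tab by force
        moreover have "t < z'" using z'(2)[of t] q0 tab by force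
        ultimately obtain y where y: "y \<in> E.X" "z < y" "y < z'"
          using E.extremal_between[OF zero_p_U[OF z(1)] zero_p_U[OF z'(1)]] by auto
        then show False
          using noK[OF y(1)] z(2)[of y] z'(2)[of y] X_unit_level[OF y(1)] by auto
      qed
      moreover have "div0 F D c \<noteq> 1" using div0_pos_iff[of c] False t by auto
      ultimately show ?thesis by simp
    qed
  qed
  then show "\<alpha> \<in> E.X \<or> \<beta> \<in> E.X" "div0 F D c = 1 \<Longrightarrow> \<alpha> \<in> E.X \<and> \<beta> \<in> E.X" by auto
qed

end

end

locale infinity_nonconstant = infinity_solution +
  assumes nonconst: "\<not> is_const F"
begin

sublocale I: interlaced p q
  using interlaced nonconst const_iff by (simp add: Suc_le_eq)

text \<open>Reduces to \<open>degree_p_coeff_less\<close> when the degrees agree; otherwise infinity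
  is a pole. Hence all solutions with values in [-1,1] are finite and fall under the polynomial
  count.\<close>

lemma F_None: "\<bar>t\<bar> \<le> 1 \<Longrightarrow> F None \<noteq> R t"
proof
  assume t: "\<bar>t\<bar> \<le> 1" "F None = R t"
  then have deg: "degree q = degree p" "degree q < degree p \<Longrightarrow> False"
    using degrees(3) by (auto simp: F_eq eval_rat_def split: if_splits)
  then have "complex_of_real (lead_coeff p / lead_coeff q) = of_real t"
    using t(2) by (simp add: F_eq eval_rat_def)
  then have "lead_coeff p = t * lead_coeff q"
    using nz by (simp only: of_real_eq_iff) (simp add: field_simps)
  then have "\<bar>lead_coeff p\<bar> \<le> \<bar>lead_coeff q\<bar>" using t(1) by (simp add: abs_mult mult_left_le_one_le)
  then show False using I.degree_p_coeff_less deg by simp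
qed

lemma F_Some: "F (Some w) = R t \<longleftrightarrow>
  poly (cpoly q) w \<noteq> 0 \<and> poly (cpoly p) w = of_real t * poly (cpoly q) w"
  by (auto simp: F_eq eval_rat_def field_simps)

lemma F_band: "z \<in> I.Z \<Longrightarrow> x \<in> I.band z \<Longrightarrow> F (R x) = R (I.f x)"
  using I.less_on_band[of z x] F_R[of x] by (force simp: I.f_def)

lemma preimage_open: "real_preim F {-1<..<1} = (\<Union>z\<in>I.Z. R ` I.band z)"
proof safe
  fix x assume "x \<in> real_preim F {-1<..<1}"
  then obtain t where t: "F x = R t" "\<bar>t\<bar> < 1" by (auto simp: real_preim_def abs_less_iff)
  then obtain w where w: "x = Some w" using F_None[of t] by (cases x) auto
  obtain g where g: "\<And>z. z \<in> I.Z \<Longrightarrow> g z \<in> I.band z"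
    "{w. poly (cpoly p) w = of_real t * poly (cpoly q) w} = of_real ` g ` I.Z"
    using I.level_set[OF t(2)] by metis
  have "w \<in> of_real ` g ` I.Z" using t(1) unfolding w F_Some g(2)[symmetric] by simp
  then show "x \<in> (\<Union>z\<in>I.Z. R ` I.band z)" using g(1) w by auto
next
  fix z x assume "z \<in> I.Z" "x \<in> I.band z"
  moreover have "I.f x \<in> {-1<..<1}" using calculation I.image_band by blast
  ultimately show "R x \<in> real_preim F {-1<..<1}"
    using F_band unfolding real_preim_def by blast
qed

lemma unit_points: "{x. F x = Some 1 \<or> F x = Some (-1)} = R ` (I.lo ` I.Z \<union> I.hi ` I.Z)"
proof safe
  fix x assume "F x = Some 1"
  then have F: "F x = R 1" by simp
  then obtain w where w: "x = Some w" using F_None[of 1] by (cases x) auto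
  show "x \<in> R ` (I.lo ` I.Z \<union> I.hi ` I.Z)"
    using I.unit_level[of 1 w] F unfolding w F_Some by auto
next
  fix x assume "F x = Some (-1)"
  then have F: "F x = R (-1)" by simp
  then obtain w where w: "x = Some w" using F_None[of "-1"] by (cases x) auto
  show "x \<in> R ` (I.lo ` I.Z \<union> I.hi ` I.Z)"
    using I.unit_level[of "-1" w] F unfolding w F_Some by auto
next
  fix z assume z: "z \<in> I.Z" "F (R (I.lo z)) \<noteq> Some (-1)"
  have "F (R (I.lo z)) = R (I.f (I.lo z))"
    unfolding I.f_def using I.ends(2)[OF z(1)] by (intro F_R) auto
  then show "F (R (I.lo z)) = Some 1" using I.f_ends[OF z(1)] z(2) by auto
next
  fix z assume z: "z \<in> I.Z" "F (R (I.hi z)) \<noteq> Some (-1)"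
  have "F (R (I.hi z)) = R (I.f (I.hi z))"
    unfolding I.f_def using I.ends(2)[OF z(1)] by (intro F_R) auto
  then show "F (R (I.hi z)) = Some 1" using I.f_ends[OF z(1)] z(2) by auto
qed

lemma preimage_closed: "real_preim F {-1..1} \<subseteq> Rbar"
proof -
  have "real_preim F {-1..1} \<subseteq> real_preim F {-1<..<1} \<union> {x. F x = Some 1 \<or> F x = Some (-1)}"
  proof
    fix x assume "x \<in> real_preim F {-1..1}"
    then obtain t where t: "F x = R t" "-1 \<le> t" "t \<le> 1" by (auto simp: real_preim_def)
    then consider "t \<in> {-1<..<1}" | "t = 1" | "t = -1" by force
    then show "x \<in> real_preim F {-1<..<1} \<union> {x. F x = Some 1 \<or> F x = Some (-1)}"
      using t(1) by cases (auto simp: real_preim_def)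
  qed
  also have "\<dots> \<subseteq> Rbar" unfolding preimage_open unit_points by (auto simp: Rbar_def)
  finally show ?thesis .
qed

end

section \<open>Moebius maps\<close>

lemma mob_Some: "mob a b c d (Some z) =
  (if of_real c * z + of_real d = 0 then None else Some ((of_real a * z + of_real b) / (of_real c * z + of_real d)))"
  by (simp add: mob_def)

lemma mob_None: "mob a b c d None = (if c = 0 then None else R (a / c))"
  by (simp add: mob_def)

lemma mob_id: "mob 1 0 0 1 x = x"
  by (cases x) (simp_all add: mob_def)

lemma mob_det_nz:
  assumes "a * d - b * c = (1::real)" "of_real c * z + of_real d = (0::complex)"
  shows "of_real a * z + of_real b \<noteq> 0"
proof
  assume z: "of_real a * z + of_real b = 0"
  have "of_real (a * d - b * c) = of_real a * (of_real c * z + of_real d) - of_real c * (of_real a * z + of_real b)"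
    by (simp add: algebra_simps)
  also have "\<dots> = 0" using z assms(2) by simp
  finally show False using assms(1) by simp
qed

text \<open>Homogeneous coordinates: the map becomes linear, and composition is the matrix product
  without cases for poles and infinity.\<close>

definition ratio :: "complex \<Rightarrow> complex \<Rightarrow> complex option" where
  "ratio u v = (if v = 0 then None else Some (u / v))"

lemma ex_ratio: "\<exists>u v. x = ratio u v \<and> (u \<noteq> 0 \<or> v \<noteq> 0)"
proof (cases x)
  case None
  then show ?thesis by (intro exI[of _ 1] exI[of _ 0]) (simp add: ratio_def)
next
  case (Some z)
  then show ?thesis by (intro exI[of _ z] exI[of _ 1]) (simp add: ratio_def)
qed

lemma mob_ratio:
  assumes "u \<noteq> 0 \<or> v \<noteq> 0"
  shows "mob a b c d (ratio u v) = ratio (of_real a * u + of_real b * v) (of_real c * u + of_real d * v)"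
proof (cases "v = 0")
  case True
  then show ?thesis using assms by (simp add: ratio_def mob_None)
next
  case False
  define k l where "k = of_real a * u + of_real b * v" and "l = of_real c * u + of_real d * v"
  have "of_real c * (u / v) + of_real d = l / v" "of_real a * (u / v) + of_real b = k / v"
    using False by (simp_all add: k_def l_def add_divide_distrib)
  then have "mob a b c d (Some (u / v)) = ratio k l"
    unfolding mob_Some ratio_def using False by simp
  then show ?thesis using False by (simp add: ratio_def[of u v] k_def l_def)
qed

lemma mob_mob:
  assumes "a' * d' - b' * c' = 1"
  shows "mob a b c d (mob a' b' c' d' x) =
    mob (a * a' + b * c') (a * b' + b * d') (c * a' + d * c') (c * b' + d * d') x"
proof -
  obtain u v where x: "x = ratio u v" "u \<noteq> 0 \<or> v \<noteq> 0" using ex_ratio by blast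
  let ?u = "of_real a' * u + of_real b' * v" and ?v = "of_real c' * u + of_real d' * v"
  \<comment> \<open>The adjugate matrix recovers (u, v), so the image vector is nonzero and again
    represents a point.\<close>
  have "of_real d' * ?u - of_real b' * ?v = of_real (a' * d' - b' * c') * u"
    "of_real a' * ?v - of_real c' * ?u = of_real (a' * d' - b' * c') * v"
    by (simp_all add: algebra_simps)
  then have "?u \<noteq> 0 \<or> ?v \<noteq> 0" using x(2) assms by auto
  then show ?thesis unfolding x(1) mob_ratio[OF x(2)]
    by (subst mob_ratio) (simp_all add: algebra_simps)
qed

lemma mob_inverse:
  assumes "a * d - b * c = 1"
  shows "mob d (-b) (-c) a (mob a b c d x) = x" "mob a b c d (mob d (-b) (-c) a x) = x"
proof -
  have "mob d (-b) (-c) a (mob a b c d x) = mob (d * a + (-b) * c) (d * b + (-b) * d) ((-c) * a + a * c) ((-c) * b + a * d) x"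
    using assms by (intro mob_mob) (simp add: mult.commute)
  also have "\<dots> = mob 1 0 0 1 x" using assms by (simp add: algebra_simps)
  finally show "mob d (-b) (-c) a (mob a b c d x) = x" by (simp add: mob_id)
  have "mob a b c d (mob d (-b) (-c) a x) = mob (a * d + b * (-c)) (a * (-b) + b * a) (c * d + d * (-c)) (c * (-b) + d * a) x"
    using assms by (intro mob_mob) (simp add: mult.commute)
  also have "\<dots> = mob 1 0 0 1 x" using assms by (simp add: algebra_simps)
  finally show "mob a b c d (mob d (-b) (-c) a x) = x" by (simp add: mob_id)
qed

lemma mob_Rbar: "x \<in> Rbar \<Longrightarrow> mob a b c d x \<in> Rbar"
  by (auto simp: Rbar_iff[of x] mob_R mob_None simp del: of_real_divide)

lemma mob_cnj: "mob a b c d (map_option cnj x) = map_option cnj (mob a b c d x)"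
proof (cases x)
  case (Some z)
  have "of_real c * cnj z + of_real d = cnj (of_real c * z + of_real d)"
    "of_real a * cnj z + of_real b = cnj (of_real a * z + of_real b)" by simp_all
  then show ?thesis unfolding Some by (simp only: mob_Some option.map complex_cnj_zero_iff) simp
qed (simp add: mob_None)

lemma cyc_ordered_mob_imp:
  assumes det: "a * d - b * c = 1" and cyc: "cyc_ordered ts"
  shows "cyc_ordered (map (mob a b c d) ts)"
proof -
  note inv = mob_inverse[OF det]
  obtain a' b' c' d' where M: "a' * d' - b' * c' = 1" "mob a' b' c' d' (hd ts) = None"
    "\<forall>t\<in>set (tl ts). mob a' b' c' d' t \<noteq> None"
    "sorted_wrt (<) (map (\<lambda>t. Re (the (mob a' b' c' d' t))) (tl ts))"
    using cyc unfolding cyc_ordered_def by blast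
  \<comment> \<open>The matrix of the given normalizing map times the inverse of the Moebius map: it
    normalizes the image list with the same resulting coordinates.\<close>
  define e f g h where "e = a' * d + b' * (-c)" "f = a' * (-b) + b' * a" "g = c' * d + d' * (-c)" "h = c' * (-b) + d' * a"
  have "e * h - f * g = (a' * d' - b' * c') * (a * d - b * c)"
    by (simp add: e_f_g_h_def algebra_simps)
  then have 1: "e * h - f * g = 1" using M(1) det by simp
  have 2: "mob e f g h (mob a b c d t) = mob a' b' c' d' t" for t
    using mob_mob[of d a "-b" "-c" a' b' c' d' "mob a b c d t"] det inv(1)[of t]
    by (simp add: e_f_g_h_def mult.commute)
  have "ts \<noteq> []" using cyc by (auto simp: cyc_ordered_def)
  then have 3: "hd (map (mob a b c d) ts) = mob a b c d (hd ts)" "tl (map (mob a b c d) ts) = map (mob a b c d) (tl ts)"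
    by (simp_all add: hd_map map_tl)
  have "inj_on (mob a b c d) A" for A using inv(1) by (metis inj_onI)
  moreover have "set ts \<subseteq> Rbar" "distinct ts" "length ts \<ge> 3" using cyc by (auto simp: cyc_ordered_def)
  ultimately have "3 \<le> length (map (mob a b c d) ts)" "distinct (map (mob a b c d) ts)"
    "set (map (mob a b c d) ts) \<subseteq> Rbar"
    by (auto simp: distinct_map mob_Rbar subset_iff)
  moreover have "mob e f g h (hd (map (mob a b c d) ts)) = None"
    "\<forall>t\<in>set (tl (map (mob a b c d) ts)). mob e f g h t \<noteq> None"
    using M(2,3) by (simp_all add: 2 3)
  moreover have "sorted_wrt (<) (map (\<lambda>t. Re (the (mob e f g h t))) (tl (map (mob a b c d) ts)))"
    using M(4) by (simp add: 2 3 o_def)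
  ultimately show ?thesis unfolding cyc_ordered_def using 1 by blast
qed

lemma cyc_ordered_mob:
  assumes det: "a * d - b * c = 1"
  shows "cyc_ordered (map (mob a b c d) ts) \<longleftrightarrow> cyc_ordered ts"
proof
  assume "cyc_ordered (map (mob a b c d) ts)"
  then have "cyc_ordered (map (mob d (-b) (-c) a) (map (mob a b c d) ts))"
    by (rule cyc_ordered_mob_imp[rotated]) (use det in \<open>simp add: mult.commute\<close>)
  then show "cyc_ordered ts" by (simp add: o_def mob_inverse[OF det])
qed (rule cyc_ordered_mob_imp[OF det])

text \<open>Polynomials are treated as binary forms of degree \<open>N\<close>: the value at infinity is the \<open>N\<close>-th
  coefficient, and \<open>pullback\<close> substitutes a Moebius map and clears the denominator \<open>(c z + d)^N\<close>.\<close>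

definition hval :: "nat \<Rightarrow> complex poly \<Rightarrow> complex option \<Rightarrow> complex" where
  "hval N p x = (case x of None \<Rightarrow> coeff p N | Some z \<Rightarrow> poly p z)"

definition hord :: "nat \<Rightarrow> complex poly \<Rightarrow> complex option \<Rightarrow> nat" where
  "hord N p x = (case x of None \<Rightarrow> N - degree p | Some z \<Rightarrow> order z p)"

lemma eval_rat_hval:
  assumes "q \<noteq> 0" "N = max (degree p) (degree q)"
  shows "eval_rat p q x = (if hval N q x = 0 then None else Some (hval N p x / hval N q x))"
proof (cases x)
  case None
  have "coeff q N = 0 \<longleftrightarrow> degree q < degree p"
    using assms by (auto simp: coeff_eq_0 max_def split: if_splits)
  moreover have "coeff p N = 0" if "degree p < degree q" using that assms by (simp add: coeff_eq_0)
  ultimately show ?thesis using assms(2) by (auto simp: None eval_rat_def hval_def)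
qed (simp add: eval_rat_def hval_def)

lemma coprime_hval:
  assumes "q \<noteq> 0" "coprime p q" "N = max (degree p) (degree q)"
  shows "hval N p x \<noteq> 0 \<or> hval N q x \<noteq> 0"
proof (cases x)
  case None
  have "coeff q N \<noteq> 0" if "degree q = N" using that assms(1) by auto
  moreover have "coeff p N \<noteq> 0" if "degree q \<noteq> N"
  proof -
    have "degree p = N" "degree q < degree p" using that assms(3) by (auto simp: max_def split: if_splits)
    then show ?thesis by (metis degree_0 leading_coeff_0_iff not_less_zero)
  qed
  ultimately show ?thesis by (auto simp: hval_def None)
next
  case (Some z)
  then show ?thesis using coprime_poly_0[OF assms(2)] by (simp add: hval_def)
qed

lemma coprime_if_no_common_root:
  fixes p q :: "complex poly"
  assumes "q \<noteq> 0" "\<And>z. poly p z \<noteq> 0 \<or> poly q z \<noteq> 0"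
  shows "coprime p q"
proof (rule coprimeI)
  fix r assume r: "r dvd p" "r dvd q"
  then have "r \<noteq> 0" using assms(1) by auto
  show "is_unit r"
  proof (rule ccontr)
    assume "\<not> is_unit r"
    then have "degree r \<noteq> 0" using \<open>r \<noteq> 0\<close> by (auto simp: is_unit_iff_degree)
    then obtain z where "poly r z = 0"
      using fundamental_theorem_of_algebra[of r] constant_degree[of r] by auto
    then have "poly p z = 0" "poly q z = 0" using r by (auto elim!: dvdE)
    then show False using assms(2) by blast
  qed
qed

definition pullback :: "real \<Rightarrow> real \<Rightarrow> real \<Rightarrow> real \<Rightarrow> nat \<Rightarrow> complex poly \<Rightarrow> complex poly" where
  "pullback a b c d N p = (\<Sum>k\<le>N. smult (coeff p k) ([:of_real b, of_real a:] ^ k * [:of_real d, of_real c:] ^ (N - k)))"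

lemma degree_pullback: "degree (pullback a b c d N p) \<le> N"
  unfolding pullback_def
proof (intro degree_sum_le order_trans[OF degree_smult_le])
  fix k assume k: "k \<in> {..N}"
  have "degree ([:of_real b, of_real a:] ^ k :: complex poly) \<le> k"
    "degree ([:of_real d, of_real c:] ^ (N - k) :: complex poly) \<le> N - k"
    by (auto intro!: order_trans[OF degree_power_le])
  then show "degree ([:of_real b, of_real a:] ^ k * [:of_real d, of_real c:] ^ (N - k) :: complex poly) \<le> N"
    using k degree_mult_le[of "[:of_real b, of_real a:] ^ k :: complex poly" "[:of_real d, of_real c:] ^ (N - k)"] by simp
qed simp

lemma poly_pullback_aux: "poly (pullback a b c d N p) w =
  (\<Sum>k\<le>N. coeff p k * ((of_real a * w + of_real b) ^ k * (of_real c * w + of_real d) ^ (N - k)))"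
  by (simp add: pullback_def poly_sum poly_power algebra_simps)

lemma poly_pullback:
  assumes "degree p \<le> N" "of_real c * w + of_real d \<noteq> 0"
  shows "poly (pullback a b c d N p) w =
    (of_real c * w + of_real d) ^ N * poly p ((of_real a * w + of_real b) / (of_real c * w + of_real d))"
proof -
  let ?u = "of_real a * w + of_real b" and ?v = "of_real c * w + of_real d"
  have "coeff p k * (?u ^ k * ?v ^ (N - k)) = ?v ^ N * (coeff p k * (?u / ?v) ^ k)" if "k \<le> N" for k
  proof -
    have "?v ^ N = ?v ^ k * ?v ^ (N - k)" using that by (simp flip: power_add)
    then show ?thesis using assms(2) by (simp add: power_divide)
  qed
  moreover have "poly p x = (\<Sum>k\<le>N. coeff p k * x ^ k)" for x
    unfolding poly_altdef using assms(1) by (intro sum.mono_neutral_left) (auto simp: coeff_eq_0)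
  ultimately show ?thesis unfolding poly_pullback_aux sum_distrib_left
    by (simp only: sum_distrib_left) (intro sum.cong refl, simp)
qed

lemma poly_pullback_pole:
  assumes "of_real c * w + of_real d = 0"
  shows "poly (pullback a b c d N p) w = coeff p N * (of_real a * w + of_real b) ^ N"
proof -
  have "poly (pullback a b c d N p) w = (\<Sum>k\<le>N. if k = N then coeff p N * (of_real a * w + of_real b) ^ N else 0)"
    unfolding poly_pullback_aux assms by (intro sum.cong) (auto simp: power_0_left)
  then show ?thesis by simp
qed

context
  fixes a b c d :: real
  assumes det: "a * d - b * c = 1"
begin

lemma lin_nz: "[:complex_of_real d, of_real c:] \<noteq> 0"
  using det by auto

lemma lin_eval: "poly [:complex_of_real d, of_real c:] w = of_real c * w + of_real d"
  by simp

lemma pullback_mult: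
  assumes "degree p \<le> M" "degree q \<le> N"
  shows "pullback a b c d (M + N) (p * q) = pullback a b c d M p * pullback a b c d N q"
proof (rule poly_eq_if_eq_generic[OF lin_nz])
  fix w assume "poly [:complex_of_real d, of_real c:] w \<noteq> 0"
  then have w: "of_real c * w + of_real d \<noteq> 0" unfolding lin_eval .
  have "degree (p * q) \<le> M + N" using assms degree_mult_le[of p q] by simp
  then show "poly (pullback a b c d (M + N) (p * q)) w = poly (pullback a b c d M p * pullback a b c d N q) w"
    using w assms by (simp add: poly_pullback power_add mult_ac)
qed

lemma pullback_inverse:
  assumes "degree p \<le> N"
  shows "pullback d (-b) (-c) a N (pullback a b c d N p) = p"
proof (rule poly_eq_if_eq_generic)
  show "[:complex_of_real a, of_real (-c):] \<noteq> 0" using det by auto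
  fix w assume "poly [:complex_of_real a, of_real (-c):] w \<noteq> 0"
  then have v: "of_real (-c) * w + of_real a \<noteq> 0" by (simp add: mult.commute)
  define u where "u = (of_real d * w + of_real (-b)) / (of_real (-c) * w + of_real a)"
  define x y where "x = of_real d * w + of_real (-b)" and "y = of_real (-c) * w + of_real a"
  have y: "y \<noteq> 0" and u: "u = x / y" using v by (simp_all add: u_def x_def y_def)
  have "of_real c * u + of_real d = (of_real c * x + of_real d * y) / y"
    "of_real a * u + of_real b = (of_real a * x + of_real b * y) / y"
    using y by (simp_all add: u add_divide_distrib)
  moreover have "of_real c * x + of_real d * y = of_real (a * d - b * c)"
    "of_real a * x + of_real b * y = of_real (a * d - b * c) * w"
    by (simp_all add: x_def y_def algebra_simps)
  ultimately have cu: "of_real c * u + of_real d = 1 / (of_real (-c) * w + of_real a)"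
    and au: "of_real a * u + of_real b = w / (of_real (-c) * w + of_real a)"
    using det by (simp_all add: y_def)
  have "poly (pullback d (-b) (-c) a N (pullback a b c d N p)) w =
      (of_real (-c) * w + of_real a) ^ N * poly (pullback a b c d N p) u"
    unfolding u_def by (rule poly_pullback[OF degree_pullback v])
  also have "poly (pullback a b c d N p) u = (of_real c * u + of_real d) ^ N *
      poly p ((of_real a * u + of_real b) / (of_real c * u + of_real d))"
    by (rule poly_pullback[OF assms]) (use cu v in simp)
  also have "(of_real a * u + of_real b) / (of_real c * u + of_real d) = w"
    unfolding au cu using v by simp
  finally show "poly (pullback d (-b) (-c) a N (pullback a b c d N p)) w = poly p w"
    unfolding cu using v by (simp add: power_divide)
qed

end

context

  \<comment> \<open>Values and orders under a Moebius map that moves infinity\<close>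
  fixes a b c d :: real
  assumes det: "a * d - b * c = 1" and c_nz: "c \<noteq> 0"
begin

lemma det_inv: "d * a - (- b) * (- c) = 1"
  using det by (simp add: mult.commute)

text \<open>The factor k depends on x and N but not on p, so it cancels in quotients and does not
  affect common zeros.\<close>

lemma hval_pullback:
  "\<exists>k. k \<noteq> 0 \<and> (\<forall>p. degree p \<le> N \<longrightarrow> hval N (pullback a b c d N p) x = k * hval N p (mob a b c d x))"
proof (cases x)
  case None
  \<comment> \<open>Infinity goes to a / c, the pole of the inverse map, so its value is read off by
    pulling back with the inverse at that pole.\<close>
  define w where "w = complex_of_real (a / c)"
  have pole: "of_real (-c) * w + of_real a = 0" using c_nz by (simp add: w_def)
  define k where "k = (of_real d * w + of_real (-b)) ^ N"
  have k: "k \<noteq> 0" unfolding k_def using mob_det_nz[OF det_inv pole] by simp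
  have "coeff (pullback a b c d N p) N = 1 / k * poly p w" if "degree p \<le> N" for p
    using poly_pullback_pole[OF pole, of d "-b" N "pullback a b c d N p"] k
    unfolding pullback_inverse[OF det that] k_def[symmetric] by (simp add: field_simps)
  then show ?thesis using k c_nz
    by (intro exI[of _ "1 / k"]) (simp add: None hval_def mob_None w_def)
next
  case (Some w)
  show ?thesis
  proof (cases "of_real c * w + of_real d = 0")
    case True
    then show ?thesis using mob_det_nz[OF det True]
      by (intro exI[of _ "(of_real a * w + of_real b) ^ N"]) (simp add: Some hval_def mob_Some poly_pullback_pole)
  next
    case False
    then show ?thesis
      by (intro exI[of _ "(of_real c * w + of_real d) ^ N"]) (simp add: Some hval_def mob_Some poly_pullback)
  qed
qed

lemma pullback_nz: "degree p \<le> N \<Longrightarrow> p \<noteq> 0 \<Longrightarrow> pullback a b c d N p \<noteq> 0"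
proof
  assume p: "degree p \<le> N" "p \<noteq> 0" "pullback a b c d N p = 0"
  have "pullback d (-b) (-c) a N 0 = 0" by (simp add: pullback_def)
  then show False using pullback_inverse[OF det p(1)] p(2,3) by simp
qed

lemma pullback_power:
  assumes "degree p \<le> 1"
  shows "pullback a b c d k (p ^ k) = pullback a b c d 1 p ^ k"
proof (induction k)
  case 0
  then show ?case by (simp add: pullback_def)
next
  case (Suc k)
  have "degree (p ^ k) \<le> degree p * k" by (rule degree_power_le)
  also have "\<dots> \<le> k" using mult_le_mono1[OF assms, of k] by simp
  finally have "degree (p ^ k) \<le> k" .
  then show ?case using pullback_mult[OF det assms, of "p ^ k" k] Suc by simp
qed

lemma pullback_linear_factor:
  fixes w :: complex
  assumes w: "of_real c * w + of_real d \<noteq> 0"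
  shows "pullback a b c d 1 [:- ((of_real a * w + of_real b) / (of_real c * w + of_real d)), 1:] =
    smult (1 / (of_real c * w + of_real d)) [:-w, 1:]"
proof (rule poly_eq_if_eq_generic[OF lin_nz[OF det]])
  let ?u = "of_real a * w + of_real b" and ?v = "of_real c * w + of_real d"
  fix y assume "poly [:complex_of_real d, of_real c:] y \<noteq> 0"
  then have y: "of_real c * y + of_real d \<noteq> 0" by (simp add: mult.commute add.commute)
  have "poly (pullback a b c d 1 [:- (?u / ?v), 1:]) y =
      (of_real c * y + of_real d) * ((of_real a * y + of_real b) / (of_real c * y + of_real d) - ?u / ?v)"
    using poly_pullback[OF _ y, of "[:- (?u / ?v), 1:]" 1 a b] by simp
  also have "\<dots> = ((of_real a * y + of_real b) * ?v - ?u * (of_real c * y + of_real d)) / ?v"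
    using w y by (simp add: right_diff_distrib diff_divide_distrib)
  also have "(of_real a * y + of_real b) * ?v - ?u * (of_real c * y + of_real d) = of_real (a * d - b * c) * (y - w)"
    by (simp add: algebra_simps)
  finally show "poly (pullback a b c d 1 [:- (?u / ?v), 1:]) y = poly (smult (1 / ?v) [:-w, 1:]) y"
    using det by (simp add: diff_divide_distrib)
qed

text \<open>Split off the full power of the linear factor at the image point: that factor pulls back
  to a multiple of x - w, and the cofactor stays nonzero at w.\<close>

lemma order_pullback_finite:
  assumes p: "p \<noteq> 0" "degree p \<le> N" and w: "of_real c * w + of_real d \<noteq> 0"
  shows "order w (pullback a b c d N p) = order ((of_real a * w + of_real b) / (of_real c * w + of_real d)) p"
proof -
  define z where "z = (of_real a * w + of_real b) / (of_real c * w + of_real d)"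
  define k where "k = order z p"
  obtain r where r: "p = [:-z, 1:] ^ k * r" "\<not> [:-z, 1:] dvd r"
    using order_decomp[OF p(1)] unfolding k_def by blast
  have rz: "poly r z \<noteq> 0" using r(2) by (simp add: poly_eq_0_iff_dvd)
  then have r0: "r \<noteq> 0" by auto
  have "degree p = k + degree r"
    using r0 by (subst r(1), subst degree_mult_eq) (simp_all add: degree_linear_power)
  then have deg: "k \<le> N" "degree r \<le> N - k" using p(2) by auto
  have "pullback a b c d N p = pullback a b c d k ([:-z, 1:] ^ k) * pullback a b c d (N - k) r"
    using pullback_mult[OF det, of "[:-z, 1:] ^ k" k r "N - k"] deg
    by (simp add: degree_linear_power flip: r(1))
  also have "pullback a b c d k ([:-z, 1:] ^ k) = pullback a b c d 1 [:-z, 1:] ^ k" by (rule pullback_power) simp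
  also have "pullback a b c d 1 [:-z, 1:] = smult (1 / (of_real c * w + of_real d)) [:-w, 1:]"
    unfolding z_def by (rule pullback_linear_factor[OF w])
  also have "\<dots> ^ k = smult ((1 / (of_real c * w + of_real d)) ^ k) ([:-w, 1:] ^ k)"
    by (rule smult_power)
  finally have eq: "pullback a b c d N p =
      smult ((1 / (of_real c * w + of_real d)) ^ k) ([:-w, 1:] ^ k) * pullback a b c d (N - k) r" .
  have "poly (pullback a b c d (N - k) r) w \<noteq> 0"
    using poly_pullback[OF deg(2) w] w rz by (simp add: z_def)
  moreover have "pullback a b c d N p \<noteq> 0" by (rule pullback_nz[OF p(2,1)])
  ultimately show ?thesis using w
    by (simp add: eq order_mult order_smult order_linear_power order_0I flip: z_def k_def)
qed

text \<open>Write p as 1 times p, with 1 viewed as a form of degree N - \<open>degree p\<close>.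
  This form pulls back to a power of c x + d, which carries the whole order at the pole.\<close>

lemma order_pullback_pole:
  assumes p: "p \<noteq> 0" "degree p \<le> N" and w: "of_real c * w + of_real d = 0"
  shows "order w (pullback a b c d N p) = N - degree p"
proof -
  define k where "k = N - degree p"
  have wd: "complex_of_real d = - of_real c * w" using w by (simp add: eq_neg_iff_add_eq_0 add.commute)
  have "pullback a b c d k 1 = (\<Sum>i\<le>k. if i = 0 then [:of_real d, of_real c:] ^ k else 0)"
    unfolding pullback_def by (intro sum.cong) auto
  then have "pullback a b c d k 1 = [:of_real d, of_real c:] ^ k" by simp
  also have "[:of_real d, of_real c:] = smult (of_real c) [:-w, 1:]"
    by (simp add: wd)
  also have "\<dots> ^ k = smult (of_real c ^ k) ([:-w, 1:] ^ k)" by (rule smult_power)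
  finally have "pullback a b c d k 1 = smult (of_real c ^ k) ([:-w, 1:] ^ k)" .
  moreover have "pullback a b c d N (1 * p) = pullback a b c d k 1 * pullback a b c d (degree p) p"
    using pullback_mult[OF det, of 1 k p "degree p"] p(2) by (simp add: k_def)
  ultimately have eq: "pullback a b c d N p = smult (of_real c ^ k) ([:-w, 1:] ^ k) * pullback a b c d (degree p) p"
    by (simp only: mult_1)
  have "poly (pullback a b c d (degree p) p) w \<noteq> 0"
    using poly_pullback_pole[OF w] mob_det_nz[OF det w] p(1) by simp
  moreover have "pullback a b c d N p \<noteq> 0" by (rule pullback_nz[OF p(2,1)])
  ultimately show ?thesis using c_nz
    by (simp add: eq order_mult order_smult order_linear_power order_0I flip: k_def)
qed

end

lemma hord_pullback:
  assumes det: "a * d - b * c = 1" "c \<noteq> 0" and p: "p \<noteq> 0" "degree p \<le> N"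
  shows "hord N (pullback a b c d N p) x = hord N p (mob a b c d x)"
proof (cases x)
  case None
  define w where "w = complex_of_real (a / c)"
  have pole: "of_real (-c) * w + of_real a = 0" using det by (simp add: w_def)
  have "order w (pullback d (-b) (-c) a N (pullback a b c d N p)) = N - degree (pullback a b c d N p)"
    using det_inv[OF det] det(2) pullback_nz[OF det p(2,1)] pole by (intro order_pullback_pole degree_pullback) auto
  then show ?thesis using det
    by (simp add: None hord_def mob_None pullback_inverse[OF det(1) p(2)] w_def)
next
  case (Some w)
  then show ?thesis
    using order_pullback_finite[OF det p, of w] order_pullback_pole[OF det p, of w]
    by (simp add: hord_def mob_Some)
qed

lemma polar_div_hord:
  assumes "rat_rep p q F" "N = max (degree p) (degree q)"
  shows "polar_div F x = int (hord N q x)"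
  using assms(2) by (auto simp: polar_div_rat_rep[OF assms(1)] hord_def split: option.split)

lemma zero_div_hord:
  assumes "rat_rep p q F" "N = max (degree p) (degree q)"
  shows "zero_div F x = (if p = 0 then 0 else int (hord N p x))"
  using assms(2) by (auto simp: zero_div_rat_rep[OF assms(1)] hord_def split: option.split)

section \<open>Transport of divisors and of the objective\<close>

definition transports :: "(complex option \<Rightarrow> complex option) \<Rightarrow> bool" where
  "transports \<psi> \<longleftrightarrow> (\<forall>F. is_ratfun F \<longrightarrow> is_ratfun (F \<circ> \<psi>) \<and>
    (\<forall>x. polar_div (F \<circ> \<psi>) x = polar_div F (\<psi> x) \<and> zero_div (F \<circ> \<psi>) x = zero_div F (\<psi> x)))"

lemma transports_mob:
  assumes det: "a * d - b * c = 1" "c \<noteq> 0"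
  shows "transports (mob a b c d)"
  unfolding transports_def
proof (intro allI impI)
  fix F assume "is_ratfun F"
  then obtain p q where pq: "rat_rep p q F" by (auto simp: is_ratfun_def)
  then have q: "q \<noteq> 0" and cop: "coprime p q" and F: "F = eval_rat p q" by (auto simp: rat_rep_def)
  define N where "N = max (degree p) (degree q)"
  define p' q' where "p' = pullback a b c d N p" and "q' = pullback a b c d N q"
  have deg: "degree p \<le> N" "degree q \<le> N" "degree p' \<le> N" "degree q' \<le> N"
    by (simp_all add: N_def p'_def q'_def degree_pullback[of a b c d "max (degree p) (degree q)"])
  have q'0: "q' \<noteq> 0" using pullback_nz[OF det deg(2) q] by (simp add: q'_def)
  have nv: "hval N p' x \<noteq> 0 \<or> hval N q' x \<noteq> 0" for x
    using hval_pullback[OF det, of N x] coprime_hval[OF q cop N_def, of "mob a b c d x"] deg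
    unfolding p'_def q'_def by (metis mult_eq_0_iff)
  \<comment> \<open>Nonvanishing at infinity means that p' and q' do not both lose their N-th
    coefficient, so N remains the common formal degree.\<close>
  have N': "N = max (degree p') (degree q')"
  proof -
    have "coeff p' N \<noteq> 0 \<or> coeff q' N \<noteq> 0" using nv[of None] by (simp add: hval_def)
    then have "N \<le> degree p' \<or> N \<le> degree q'" using le_degree by blast
    then show ?thesis using deg(3,4) by linarith
  qed
  have cop': "coprime p' q'"
  proof (rule coprime_if_no_common_root[OF q'0])
    show "poly p' z \<noteq> 0 \<or> poly q' z \<noteq> 0" for z using nv[of "Some z"] by (simp add: hval_def)
  qed
  have "eval_rat p' q' x = F (mob a b c d x)" for x
  proof -
    obtain k where "k \<noteq> 0" "\<And>p. degree p \<le> N \<Longrightarrow> hval N (pullback a b c d N p) x = k * hval N p (mob a b c d x)"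
      using hval_pullback[OF det, of N x] by blast
    then show ?thesis unfolding F eval_rat_hval[OF q N_def] eval_rat_hval[OF q'0 N']
      unfolding p'_def q'_def using deg by simp
  qed
  then have rr: "rat_rep p' q' (F \<circ> mob a b c d)"
    using q'0 cop' by (auto simp: rat_rep_def)
  have "p' = 0 \<longleftrightarrow> p = 0" using pullback_nz[OF det deg(1)] by (auto simp: p'_def pullback_def)
  then have zero: "zero_div (F \<circ> mob a b c d) x = zero_div F (mob a b c d x)" for x
    using hord_pullback[OF det _ deg(1), of x]
    by (simp add: zero_div_hord[OF rr N'] zero_div_hord[OF pq N_def] p'_def)
  have polar: "polar_div (F \<circ> mob a b c d) x = polar_div F (mob a b c d x)" for x
    using hord_pullback[OF det q deg(2), of x]
    by (simp add: polar_div_hord[OF rr N'] polar_div_hord[OF pq N_def] q'_def)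
  show "is_ratfun (F \<circ> mob a b c d) \<and>
    (\<forall>x. polar_div (F \<circ> mob a b c d) x = polar_div F (mob a b c d x) \<and>
         zero_div (F \<circ> mob a b c d) x = zero_div F (mob a b c d x))"
    using rr zero polar unfolding is_ratfun_def by blast
qed

text \<open>The map sends w to r - 1 / w, under which 1 / (r - z) becomes w; substituting z = r - u
  and w = 1 / u matches the two limits.\<close>

lemma objective_transport:
  "objective None k (F \<circ> mob r (-1) 1 0) = objective (R r) k F"
proof -
  define g where "g z = fval F z / (1 / (of_real r - z)) ^ k" for z
  define h where "h w = fval (F \<circ> mob r (-1) 1 0) w / w ^ k" for w
  have gh: "g (of_real r - u) = h (inverse u)" if "u \<noteq> 0" for u
  proof -
    have "mob r (-1) 1 0 (Some (inverse u)) = Some (of_real r - u)"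
      using that by (simp add: mob_Some field_simps)
    then show ?thesis by (simp add: g_def h_def fval_def inverse_eq_divide)
  qed
  have "(g \<longlongrightarrow> l) (at (of_real r)) \<longleftrightarrow> (h \<longlongrightarrow> l) at_infinity" for l
  proof -
    have "(g \<longlongrightarrow> l) (at (of_real r)) \<longleftrightarrow> ((\<lambda>u. g (of_real r + u)) \<longlongrightarrow> l) (at 0)"
      by (rule LIM_offset_zero_iff) simp
    also have "\<dots> \<longleftrightarrow> ((\<lambda>u. g (of_real r - u)) \<longlongrightarrow> l) (at 0)"
      using tendsto_compose_filtermap[of "\<lambda>u. g (of_real r + u)" uminus l "at 0"]
      by (simp add: filtermap_at_minus o_def)
    also have "\<dots> \<longleftrightarrow> ((\<lambda>u. h (inverse u)) \<longlongrightarrow> l) (at 0)"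
      by (intro tendsto_cong) (auto simp: eventually_at_filter gh intro!: always_eventually)
    also have "\<dots> \<longleftrightarrow> (h \<longlongrightarrow> l) at_infinity"
      by (rule lim_at_infinity_0[symmetric, unfolded o_def])
    finally show ?thesis .
  qed
  \<comment> \<open>The equivalence holds for every l, so the two \<open>Lim\<close> values agree
    whether or not the limits exist.\<close>
  then have "Lim (at (of_real r)) g = Lim at_infinity h" by (simp add: Topological_Spaces.Lim_def)
  then show ?thesis by (simp add: objective_def g_def[abs_def] h_def[abs_def])
qed

section \<open>Topology of the sphere and of bands\<close>

lemma sph_R: "sph (R t) = (2 * t / (1 + t\<^sup>2), 0, (t\<^sup>2 - 1) / (t\<^sup>2 + 1))"
  by (simp add: sph_def norm_of_real)

text \<open>The sphere coordinates are homogeneous of degree 0 in numerator and denominator, so one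
  formula also covers the pole; continuity of the curve follows from it.\<close>

lemma sph_mob_R:
  assumes det: "a * d - b * c = 1"
  shows "sph (mob a b c d (R t)) =
    (2 * (a * t + b) * (c * t + d) / ((a * t + b)\<^sup>2 + (c * t + d)\<^sup>2), 0,
     ((a * t + b)\<^sup>2 - (c * t + d)\<^sup>2) / ((a * t + b)\<^sup>2 + (c * t + d)\<^sup>2))"
proof -
  define u v where "u = a * t + b" and "v = c * t + d"
  show ?thesis
  proof (cases "v = 0")
    case True
    have "a * v - c * u = 1" using det by (simp add: u_def v_def algebra_simps)
    then have "u \<noteq> 0" using True by auto
    then show ?thesis using True by (simp add: mob_R sph_def flip: u_def v_def)
  next
    case False
    have nz: "1 + (u / v)\<^sup>2 \<noteq> 0" "u\<^sup>2 + v\<^sup>2 \<noteq> 0"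
      using False by (simp_all add: add_pos_nonneg add_nonneg_pos less_imp_neq[symmetric])
    have e: "1 + (u / v)\<^sup>2 = (u\<^sup>2 + v\<^sup>2) / v\<^sup>2" "(u / v)\<^sup>2 - 1 = (u\<^sup>2 - v\<^sup>2) / v\<^sup>2"
      using False by (simp_all add: power_divide add_divide_distrib diff_divide_distrib)
    have "2 * (u / v) / (1 + (u / v)\<^sup>2) = 2 * u * v / (u\<^sup>2 + v\<^sup>2)"
      unfolding e using False nz by (simp add: power2_eq_square)
    moreover have "((u / v)\<^sup>2 - 1) / ((u / v)\<^sup>2 + 1) = (u\<^sup>2 - v\<^sup>2) / (u\<^sup>2 + v\<^sup>2)"
      unfolding add.commute[of _ 1] e using False nz by simp
    ultimately show ?thesis unfolding mob_R u_def[symmetric] v_def[symmetric]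
      using False by (simp only: sph_R if_False)
  qed
qed

lemma continuous_sph_mob_R:
  assumes det: "a * d - b * c = 1"
  shows "continuous_on UNIV (\<lambda>t. sph (mob a b c d (R t)))"
proof -
  have "(a * t + b)\<^sup>2 + (c * t + d)\<^sup>2 \<noteq> 0" for t
  proof
    assume "(a * t + b)\<^sup>2 + (c * t + d)\<^sup>2 = 0"
    then have "a * t + b = 0" "c * t + d = 0" by (simp_all add: sum_power2_eq_zero_iff)
    moreover have "a * (c * t + d) - c * (a * t + b) = 1" using det by (simp add: algebra_simps)
    ultimately show False by simp
  qed
  then show ?thesis unfolding sph_mob_R[OF det] by (intro continuous_intros) auto
qed

lemma inj_sph: "inj sph"
proof (rule injI)
  have third: "((cmod z)\<^sup>2 - 1) / ((cmod z)\<^sup>2 + 1) = 1 - 2 / ((cmod z)\<^sup>2 + 1)" for z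
  proof -
    have "(cmod z)\<^sup>2 + 1 \<noteq> 0" by (metis add_nonneg_pos less_irrefl zero_le_power2 zero_less_one)
    then show ?thesis by (simp add: field_simps)
  qed
  have pos: "(cmod z)\<^sup>2 + 1 > 0" for z by (simp add: add_nonneg_pos)
  fix x y assume eq: "sph x = sph y"
  show "x = y"
  proof (cases x; cases y)
    fix z w assume xy: "x = Some z" "y = Some w"
    have "2 / ((cmod z)\<^sup>2 + 1) = 2 / ((cmod w)\<^sup>2 + 1)" using eq by (simp add: xy sph_def third)
    then have n: "(cmod z)\<^sup>2 = (cmod w)\<^sup>2" using pos[of z] pos[of w] by (simp add: frac_eq_eq)
    have "1 + (cmod w)\<^sup>2 \<noteq> 0" using pos[of w] by simp
    then have "Re z = Re w" "Im z = Im w" using eq by (simp_all add: xy sph_def n)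
    then show ?thesis by (simp add: xy complex_eq_iff)
  next
    fix z assume "x = None" "y = Some z"
    then have "2 / ((cmod z)\<^sup>2 + 1) = 0" using eq by (simp add: sph_def third)
    then show ?thesis using pos[of z] by simp
  next
    fix z assume "x = Some z" "y = None"
    then have "2 / ((cmod z)\<^sup>2 + 1) = 0" using eq by (simp add: sph_def third)
    then show ?thesis using pos[of z] by simp
  qed simp
qed

text \<open>On the circle \<open>Y = 0\<close> of the sphere, \<open>2 t / (1 + t\<^sup>2) = X\<close>, \<open>2 / (1 + t\<^sup>2) = 1 - Z\<close>
  and \<open>2 t\<^sup>2 / (1 + t\<^sup>2) = 1 + Z\<close>, so a Moebius map becomes a quotient of linear forms
  after multiplying its numerator and denominator by \<open>c t + d\<close>.\<close>

lemma compact_mob_coord: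
  assumes det: "a * d - b * c = 1" and E: "E \<subseteq> Rbar" "compact (sph ` E)"
    and pole: "\<And>x. x \<in> E \<Longrightarrow> mob a b c d x \<noteq> None"
  shows "compact ((\<lambda>x. Re (the (mob a b c d x))) ` E)"
proof -
  define num where "num X Z = a * c * (1 + Z) + b * d * (1 - Z) + (a * d + b * c) * X" for X Z
  define den where "den X Z = c\<^sup>2 * (1 + Z) + d\<^sup>2 * (1 - Z) + 2 * c * d * X" for X Z
  define h :: "real \<times> real \<times> real \<Rightarrow> real" where "h s = num (fst s) (snd (snd s)) / den (fst s) (snd (snd s))" for s
  have key: "den (fst (sph x)) (snd (snd (sph x))) \<noteq> 0 \<and> h (sph x) = Re (the (mob a b c d x))"
    if x: "x \<in> E" for x
  proof (cases x)
    case None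
    then have "c \<noteq> 0" using pole[OF x] by (auto simp: mob_None)
    then show ?thesis by (simp add: None sph_def mob_None h_def num_def den_def power2_eq_square)
  next
    case (Some z)
    moreover have "x \<in> Rbar" using E(1) x by blast
    ultimately obtain t where t: "x = R t" by (auto simp: Rbar_iff)
    have v: "c * t + d \<noteq> 0" using pole[OF x] by (simp add: t mob_R split: if_splits)
    have pos: "1 + t\<^sup>2 \<noteq> 0" by (metis add_pos_nonneg less_irrefl zero_le_power2 zero_less_one)
    have 1: "1 + (t\<^sup>2 - 1) / (t\<^sup>2 + 1) = 2 * t\<^sup>2 / (1 + t\<^sup>2)" "1 - (t\<^sup>2 - 1) / (t\<^sup>2 + 1) = 2 / (1 + t\<^sup>2)"
      using pos by (simp_all add: field_simps)
    have "num (2 * t / (1 + t\<^sup>2)) ((t\<^sup>2 - 1) / (t\<^sup>2 + 1)) = 2 * ((a * t + b) * (c * t + d)) / (1 + t\<^sup>2)"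
      unfolding num_def 1 by (simp add: algebra_simps add_divide_distrib power2_eq_square)
    moreover have "den (2 * t / (1 + t\<^sup>2)) ((t\<^sup>2 - 1) / (t\<^sup>2 + 1)) = 2 * ((c * t + d) * (c * t + d)) / (1 + t\<^sup>2)"
      unfolding den_def 1 by (simp add: algebra_simps add_divide_distrib power2_eq_square)
    ultimately show ?thesis using v pos
      by (simp add: h_def t sph_R mob_R del: of_real_divide)
  qed
  have "continuous_on (sph ` E) h"
    unfolding h_def using key
    by (intro continuous_intros) (auto simp: num_def den_def intro!: continuous_intros)
  then have "compact (h ` sph ` E)" using E(2) by (rule compact_continuous_image)
  moreover have "h ` sph ` E = (\<lambda>x. Re (the (mob a b c d x))) ` E"
    unfolding image_image using key by (intro image_cong) auto
  ultimately show ?thesis by simp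
qed

lemma closure_inj_image_interval:
  fixes g :: "real \<Rightarrow> 'a::t2_space"
  assumes "continuous_on UNIV g" "u < v"
  shows "closure (g ` {u<..<v}) = g ` {u..v}"
proof
  have cont: "continuous_on {u..v} g" using assms(1) continuous_on_subset by blast
  then have "closed (g ` {u..v})" by (intro compact_imp_closed compact_continuous_image) auto
  then show "closure (g ` {u<..<v}) \<subseteq> g ` {u..v}" by (intro closure_minimal) auto
  have "g ` closure {u<..<v} \<subseteq> closure (g ` {u<..<v})"
    using assms by (intro image_closure_subset closure_subset closed_closure) (auto intro: continuous_on_subset)
  then show "g ` {u..v} \<subseteq> closure (g ` {u<..<v})" using assms(2) by simp
qed

text \<open>Neighbouring intervals may touch. The shared end belongs to neither, and a connected
  subset of the union cannot jump over it.\<close>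

lemma components_separated_intervals:
  fixes lo hi :: "'i::linorder \<Rightarrow> real"
  assumes lh: "\<And>z. z \<in> Z \<Longrightarrow> lo z < hi z"
    and ord: "\<And>z z'. z \<in> Z \<Longrightarrow> z' \<in> Z \<Longrightarrow> z < z' \<Longrightarrow> hi z \<le> lo z'"
  shows "components (\<Union>z\<in>Z. {lo z<..<hi z}) = (\<lambda>z. {lo z<..<hi z}) ` Z"
proof -
  let ?S = "\<Union>z\<in>Z. {lo z<..<hi z}"
  have ends: "lo z \<notin> ?S" "hi z \<notin> ?S" if z: "z \<in> Z" for z
  proof -
    have "\<not> (lo z' < e \<and> e < hi z')" if "z' \<in> Z" "e = lo z \<or> e = hi z" for z' e
    proof (cases z z' rule: linorder_cases)
      case less
      then show ?thesis using ord[OF z \<open>z' \<in> Z\<close>] lh[OF z] that by force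
    next
      case greater
      then show ?thesis using ord[OF \<open>z' \<in> Z\<close> z] lh[OF z] that by force
    qed (use that in auto)
    then show "lo z \<notin> ?S" "hi z \<notin> ?S" by auto
  qed
  have comp: "connected_component_set ?S x = {lo z<..<hi z}" if z: "z \<in> Z" "x \<in> {lo z<..<hi z}" for z x
  proof
    show "{lo z<..<hi z} \<subseteq> connected_component_set ?S x"
      using z by (intro connected_component_maximal) auto
    show "connected_component_set ?S x \<subseteq> {lo z<..<hi z}"
    proof
      fix y assume "y \<in> connected_component_set ?S x"
      then obtain T where T: "connected T" "T \<subseteq> ?S" "x \<in> T" "y \<in> T"
        by (auto simp: connected_component_def)
      have "lo z \<notin> T" "hi z \<notin> T" using ends[OF z(1)] T(2) by blast+
      then show "y \<in> {lo z<..<hi z}"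
        using connectedD_interval[OF T(1,3,4), of "hi z"] connectedD_interval[OF T(1,4,3), of "lo z"] z(2)
        by force
    qed
  qed
  show ?thesis unfolding components_def
  proof safe
    fix z assume "z \<in> Z"
    then have "(lo z + hi z) / 2 \<in> {lo z<..<hi z}" using lh by auto
    then show "{lo z<..<hi z} \<in> connected_component_set ?S ` ?S" using comp[OF \<open>z \<in> Z\<close>] \<open>z \<in> Z\<close> by blast
  qed (use comp in auto)
qed

text \<open>Finitely many bounded intervals lie in one compact interval, on which a continuous
  injective curve is a homeomorphism onto its image; components then transfer.\<close>

lemma components_curve_intervals:
  fixes lo hi :: "'i::linorder \<Rightarrow> real" and g :: "real \<Rightarrow> 'a::t2_space"
  assumes fin: "finite Z" and lh: "\<And>z. z \<in> Z \<Longrightarrow> lo z < hi z"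
    and ord: "\<And>z z'. z \<in> Z \<Longrightarrow> z' \<in> Z \<Longrightarrow> z < z' \<Longrightarrow> hi z \<le> lo z'"
    and g: "continuous_on UNIV g" "inj g"
  shows "components (\<Union>z\<in>Z. g ` {lo z<..<hi z}) = (\<lambda>z. g ` {lo z<..<hi z}) ` Z"
proof -
  let ?S = "\<Union>z\<in>Z. {lo z<..<hi z}"
  have "bounded ?S" using fin by auto
  then obtain B where "\<And>x. x \<in> ?S \<Longrightarrow> \<bar>x\<bar> \<le> B" unfolding bounded_iff real_norm_def by blast
  then have B: "?S \<subseteq> {-B..B}" by (force simp: abs_le_iff)
  have "continuous_on {-B..B} g" "inj_on g {-B..B}"
    using g continuous_on_subset by (blast, metis inj_on_subset subset_UNIV)
  then obtain g' where hom: "homeomorphism {-B..B} (g ` {-B..B}) g g'"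
    using homeomorphism_compact[of "{-B..B}" g "g ` {-B..B}"] by blast
  have hom': "homeomorphism ?S (g ` ?S) g g'"
    using homeomorphism_of_subsets[OF hom B] by blast
  have "components (g ` ?S) = (\<lambda>x. connected_component_set (g ` ?S) (g x)) ` ?S"
    by (simp add: components_def image_image)
  also have "\<dots> = (\<lambda>x. g ` connected_component_set ?S x) ` ?S"
    using connected_component_set_homeomorphism[OF hom'] by (intro image_cong) auto
  also have "\<dots> = (`) g ` components ?S"
    by (simp add: components_def image_image)
  also have "components ?S = (\<lambda>z. {lo z<..<hi z}) ` Z"
    by (rule components_separated_intervals[OF lh ord])
  finally show ?thesis by (simp add: image_UN image_image)
qed

text \<open>Collects the properties of the coordinate change so that the identity, for an extremal
  point at infinity, and a proper Moebius map are treated alike.\<close>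

locale normalization =
  fixes \<phi> \<psi> :: "complex option \<Rightarrow> complex option" and xs :: "complex option"
  assumes \<phi>\<psi>: "\<And>x. \<phi> (\<psi> x) = x" and \<psi>\<phi>: "\<And>x. \<psi> (\<phi> x) = x"
    and \<phi>_Rbar: "\<And>x. x \<in> Rbar \<Longrightarrow> \<phi> x \<in> Rbar" and \<psi>_Rbar: "\<And>x. x \<in> Rbar \<Longrightarrow> \<psi> x \<in> Rbar"
    and \<psi>_cnj: "\<And>x. \<psi> (map_option cnj x) = map_option cnj (\<psi> x)"
    and cyc: "\<And>ts. cyc_ordered (map \<phi> ts) \<longleftrightarrow> cyc_ordered ts"
    and \<phi>_xs: "\<phi> xs = None"
    and transports_\<phi>: "transports \<phi>" and transports_\<psi>: "transports \<psi>"
    and objective_\<psi>: "\<And>k F. objective None k (F \<circ> \<psi>) = objective xs k F"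
    and continuous_sph_\<psi>: "continuous_on UNIV (\<lambda>t. sph (\<psi> (R t)))"
    and compact_\<phi>: "\<And>E. E \<subseteq> Rbar \<Longrightarrow> compact (sph ` E) \<Longrightarrow> xs \<notin> E \<Longrightarrow>
      compact ((\<lambda>x. Re (the (\<phi> x))) ` E)"

lemma normalization_mob:
  assumes det: "a * d - b * c = 1" and xs: "mob a b c d xs = None"
    and tr: "transports (mob a b c d)" "transports (mob d (-b) (-c) a)"
    and obj: "\<And>k F. objective None k (F \<circ> mob d (-b) (-c) a) = objective xs k F"
  shows "normalization (mob a b c d) (mob d (-b) (-c) a) xs"
proof
  fix E assume E: "E \<subseteq> Rbar" "compact (sph ` E)" "xs \<notin> E"
  have "mob a b c d x \<noteq> None" if "x \<in> E" for x
    using mob_inverse(1)[OF det] xs that E(3) by metis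
  then show "compact ((\<lambda>x. Re (the (mob a b c d x))) ` E)"
    using compact_mob_coord[OF det E(1,2)] by blast
next
  show "continuous_on UNIV (\<lambda>t. sph (mob d (-b) (-c) a (R t)))"
    using det by (intro continuous_sph_mob_R) (simp add: mult.commute)
qed (use assms mob_inverse[OF det] in \<open>auto simp: mob_Rbar mob_cnj cyc_ordered_mob\<close>)

lemma ex_normalization:
  assumes "xs \<in> Rbar"
  shows "\<exists>\<phi> \<psi>. normalization \<phi> \<psi> xs"
proof (cases xs)
  case None
  have "F \<circ> mob 1 0 0 1 = F" for F :: "complex option \<Rightarrow> complex option"
    by (simp add: fun_eq_iff mob_id)
  then have "normalization (mob 1 0 0 1) (mob 1 (-0) (-0) 1) xs"
    by (intro normalization_mob) (simp_all add: None mob_id transports_def)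
  then show ?thesis by blast
next
  case (Some w)
  then obtain r where r: "xs = R r" using assms by (auto simp: Rbar_iff)
  \<comment> \<open>This is x |-> 1 / (r - x), the function r(x, r) of the problem, written with
    determinant 1. Its inverse w |-> r - 1 / w is the map of
    \<open>objective_transport\<close>.\<close>
  have "normalization (mob 0 1 (-1) r) (mob r (-1) (-(-1)) 0) xs"
  proof (rule normalization_mob)
    show "mob 0 1 (-1) r xs = None" by (simp add: r mob_R)
    show "transports (mob 0 1 (-1) r)" by (rule transports_mob) auto
    show "transports (mob r (-1) (-(-1)) 0)" by (rule transports_mob) auto
    show "objective None k (F \<circ> mob r (-1) (-(-1)) 0) = objective xs k F" for k F
      unfolding r minus_minus by (rule objective_transport)
  qed simp
  then show ?thesis by blast
qed

context normalization
begin

lemma inj_\<psi>: "inj \<psi>"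
  using \<phi>\<psi> by (metis injI)

lemma \<psi>_None: "\<psi> None = xs"
  using \<psi>\<phi> \<phi>_xs by metis

lemma \<phi>_cint: "\<phi> x \<in> cint (\<phi> a) (\<phi> b) \<longleftrightarrow> x \<in> cint a b"
  using cyc[of "[a, x, b]"] by (simp add: cint_def)

lemma \<psi>_cint: "\<psi> ` cint (\<phi> a) (\<phi> b) = cint a b"
proof
  show "\<psi> ` cint (\<phi> a) (\<phi> b) \<subseteq> cint a b" using \<phi>_cint \<phi>\<psi> by (metis image_subsetI)
  show "cint a b \<subseteq> \<psi> ` cint (\<phi> a) (\<phi> b)" using \<phi>_cint \<psi>\<phi> by (metis image_eqI subsetI)
qed

lemma is_ratfun_\<psi>: "is_ratfun F \<Longrightarrow> is_ratfun (F \<circ> \<psi>)"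
  and polar_div_\<psi>: "is_ratfun F \<Longrightarrow> polar_div (F \<circ> \<psi>) x = polar_div F (\<psi> x)"
  and zero_div_\<psi>: "is_ratfun F \<Longrightarrow> zero_div (F \<circ> \<psi>) x = zero_div F (\<psi> x)"
  using transports_\<psi> by (auto simp: transports_def)

lemma is_ratfun_\<phi>: "is_ratfun F \<Longrightarrow> is_ratfun (F \<circ> \<phi>)"
  and polar_div_\<phi>: "is_ratfun F \<Longrightarrow> polar_div (F \<circ> \<phi>) x = polar_div F (\<phi> x)"
  using transports_\<phi> by (auto simp: transports_def)

lemma div0_\<psi>: "is_ratfun F \<Longrightarrow> div0 (F \<circ> \<psi>) (D \<circ> \<psi>) x = div0 F D (\<psi> x)"
  by (simp add: div0_def polar_div_\<psi> zero_div_\<psi>)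

lemma div_deg_\<psi>: "div_deg (D \<circ> \<psi>) = div_deg D"
proof -
  have "{x. D x \<noteq> 0} = \<psi> ` {x. (D \<circ> \<psi>) x \<noteq> 0}"
    using \<psi>\<phi> by (auto simp: image_iff) metis
  then show ?thesis
    unfolding div_deg_def using inj_on_subset[OF inj_\<psi>]
    by (simp add: sum.reindex[of \<psi>])
qed

lemma sum_\<psi>: "sum (D \<circ> \<psi>) (A \<inter> {x. (D \<circ> \<psi>) x \<noteq> 0}) = sum D (\<psi> ` A \<inter> {x. D x \<noteq> 0})"
proof -
  have "\<psi> ` A \<inter> {x. D x \<noteq> 0} = \<psi> ` (A \<inter> {x. (D \<circ> \<psi>) x \<noteq> 0})" by auto
  then show ?thesis using inj_on_subset[OF inj_\<psi>] by (simp add: sum.reindex[of \<psi>])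
qed

lemma admissible_\<psi>: "F \<in> admissible E D \<Longrightarrow> F \<circ> \<psi> \<in> admissible (\<phi> ` E) (D \<circ> \<psi>)"
  by (auto simp: admissible_def Lspace_def is_ratfun_\<psi> polar_div_\<psi> \<psi>\<phi>)

lemma admissible_\<phi>:
  assumes "F \<in> admissible (\<phi> ` E) (D \<circ> \<psi>)"
  shows "F \<circ> \<phi> \<in> admissible E D"
proof -
  have "polar_div F (\<phi> x) \<le> D x" for x
    using assms \<psi>\<phi>[of x] by (auto simp: admissible_def Lspace_def o_def dest: spec[of _ "\<phi> x"])
  then show ?thesis using assms
    by (auto simp: admissible_def Lspace_def is_ratfun_\<phi> polar_div_\<phi>)
qed

lemma is_maximizer_\<psi>:
  assumes "is_maximizer E D xs F"
  shows "is_maximizer (\<phi> ` E) (D \<circ> \<psi>) None (F \<circ> \<psi>)"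
  unfolding is_maximizer_def
proof (intro conjI ballI)
  show "F \<circ> \<psi> \<in> admissible (\<phi> ` E) (D \<circ> \<psi>)"
    using assms by (intro admissible_\<psi>) (simp add: is_maximizer_def)
  fix G assume "G \<in> admissible (\<phi> ` E) (D \<circ> \<psi>)"
  then have "G \<circ> \<phi> \<in> admissible E D" by (rule admissible_\<phi>)
  then have "objective xs (nat (D xs)) (G \<circ> \<phi>) \<le> objective xs (nat (D xs)) F"
    using assms by (simp add: is_maximizer_def)
  moreover have "(G \<circ> \<phi>) \<circ> \<psi> = G" by (simp add: fun_eq_iff \<phi>\<psi>)
  ultimately show "objective None (nat ((D \<circ> \<psi>) None)) G \<le> objective None (nat ((D \<circ> \<psi>) None)) (F \<circ> \<psi>)"
    using objective_\<psi>[of _ "G \<circ> \<phi>"] by (simp add: objective_\<psi> \<psi>_None)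
qed

lemma real_preim_\<psi>: "real_preim F S = \<psi> ` real_preim (F \<circ> \<psi>) S"
proof
  show "\<psi> ` real_preim (F \<circ> \<psi>) S \<subseteq> real_preim F S" by (auto simp: real_preim_def)
  show "real_preim F S \<subseteq> \<psi> ` real_preim (F \<circ> \<psi>) S"
  proof
    fix x assume "x \<in> real_preim F S"
    then have "\<phi> x \<in> real_preim (F \<circ> \<psi>) S" by (simp add: real_preim_def \<psi>\<phi>)
    then show "x \<in> \<psi> ` real_preim (F \<circ> \<psi>) S" using \<psi>\<phi>[of x] by (metis image_eqI)
  qed
qed

lemma inj_curve: "inj (\<lambda>t. sph (\<psi> (R t)))"
proof (rule injI)
  fix s t :: real assume "sph (\<psi> (R s)) = sph (\<psi> (R t))"
  then have "R s = R t" using injD[OF inj_sph] injD[OF inj_\<psi>] by blast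
  then show "s = t" by simp
qed

lemma real_coordinates:
  assumes "E \<subseteq> Rbar" "xs \<notin> E"
  shows "\<phi> ` E = R ` ((\<lambda>x. Re (the (\<phi> x))) ` E)"
  unfolding image_image
proof (rule image_cong[OF refl])
  fix x assume x: "x \<in> E"
  then have "\<phi> x \<noteq> None" using assms(2) \<psi>\<phi> \<psi>_None by metis
  moreover have "\<phi> x \<in> Rbar" using \<phi>_Rbar x assms(1) by blast
  ultimately show "\<phi> x = R (Re (the (\<phi> x)))" by (auto simp: Rbar_iff)
qed

end

section \<open>The general case\<close>

lemma is_gapD:
  assumes "is_gap E a b"
  shows "a \<in> E" "b \<in> E" "a \<noteq> b" "cint a b \<inter> E = {}"
proof -
  have "sph ` cint a b \<subseteq> sph ` (Rbar - E)"
    using assms in_components_subset unfolding is_gap_def by blast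
  then show "cint a b \<inter> E = {}" using injD[OF inj_sph] by fastforce
qed (use assms in \<open>auto simp: is_gap_def\<close>)

text \<open>For finite real points a cyclic triple is a rotation of an increasing one; increasing
  maps preserve this and decreasing ones reverse it.\<close>

lemma cyc_strict_mono_on_curve:
  assumes cyc: "\<And>x y z. cyc_ordered [g x, g y, g z] \<longleftrightarrow> cyc_ordered [R x, R y, R z]"
    and F: "\<And>x. x \<in> I \<Longrightarrow> F (g x) = R (f x)"
    and f: "strict_mono_on I f \<or> strict_antimono_on I f"
  shows "cyc_strict_mono_on (g ` I) F"
  using f
proof
  assume f: "strict_mono_on I f"
  have "cyc_ordered [F (g x), F (g y), F (g z)]"
    if "x \<in> I" "y \<in> I" "z \<in> I" "cyc_ordered [g x, g y, g z]" for x y z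
    using that strict_mono_onD[OF f] by (auto simp: F cyc cyc_ordered_R)
  then show ?thesis unfolding cyc_strict_mono_on_def by blast
next
  assume f: "strict_antimono_on I f"
  have "f y < f x" if "x \<in> I" "y \<in> I" "x < y" for x y
    using monotone_onD[OF f that] .
  then have "cyc_ordered [F (g z), F (g y), F (g x)]"
    if "x \<in> I" "y \<in> I" "z \<in> I" "cyc_ordered [g x, g y, g z]" for x y z
    using that by (auto simp: F cyc cyc_ordered_R)
  then show ?thesis unfolding cyc_strict_mono_on_def by blast
qed

locale normalized_solution = normalization \<phi> \<psi> xs + infinity_solution K "D \<circ> \<psi>" n "F \<circ> \<psi>" U p q s
  for \<phi> \<psi> xs K D n F U p q s +
  fixes E
  assumes E_sub: "E \<subseteq> Rbar" and E_image: "\<phi> ` E = R ` K" and ratfun: "is_ratfun F"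
begin

lemma E_coord:
  assumes "x \<in> E"
  shows "\<exists>t\<in>K. x = \<psi> (R t)"
proof -
  have "\<phi> x \<in> R ` K" using assms E_image by blast
  then obtain t where "t \<in> K" "\<phi> x = R t" by blast
  then show ?thesis using \<psi>\<phi>[of x] by auto
qed

lemma K_coord:
  assumes "t \<in> K"
  shows "\<psi> (R t) \<in> E"
proof -
  have "R t \<in> \<phi> ` E" using assms E_image by blast
  then obtain x where "x \<in> E" "R t = \<phi> x" by blast
  then show ?thesis using \<psi>\<phi>[of x] by simp
qed

lemma div0_coord: "div0 F D (\<psi> x) = div0 (F \<circ> \<psi>) (D \<circ> \<psi>) x"
  using div0_\<psi>[OF ratfun] by simp

lemma div0_pos_coord:
  assumes "div0 F D x > 0"
  shows "\<exists>t. x = \<psi> (R t) \<and> poly U t = 0"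
proof -
  have "div0 (F \<circ> \<psi>) (D \<circ> \<psi>) (\<phi> x) > 0" using assms div0_coord[of "\<phi> x"] by (simp only: \<psi>\<phi>)
  then obtain t where "\<phi> x = R t" "poly U t = 0" unfolding div0_pos_iff by blast
  then show ?thesis using \<psi>\<phi>[of x] by auto
qed

lemma cint_coord: "\<psi> x \<in> cint (\<psi> a) (\<psi> b) \<longleftrightarrow> x \<in> cint a b"
  using \<phi>_cint[of "\<psi> x" "\<psi> a" "\<psi> b"] by (simp add: \<phi>\<psi>)

lemma abs_one_coord: "t \<in> K \<Longrightarrow> abs_one F (\<psi> (R t)) \<longleftrightarrow> t \<in> E.X"
  using abs_one_K[of t] by (simp add: abs_one_def)

lemma gap_coord:
  assumes "is_gap E a b"
  obtains \<alpha> \<beta> where "a = \<psi> (R \<alpha>)" "b = \<psi> (R \<beta>)" "\<alpha> \<in> K" "\<beta> \<in> K" "\<alpha> \<noteq> \<beta>"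
    "cint (R \<alpha>) (R \<beta>) \<inter> R ` K = {}"
proof -
  note gap = is_gapD[OF assms]
  obtain \<alpha> \<beta> where ab: "\<alpha> \<in> K" "\<beta> \<in> K" "a = \<psi> (R \<alpha>)" "b = \<psi> (R \<beta>)"
    using E_coord[OF gap(1)] E_coord[OF gap(2)] by blast
  have "\<psi> x \<notin> E" if "x \<in> cint (R \<alpha>) (R \<beta>)" for x
    using that gap(4) cint_coord unfolding ab by blast
  then have "cint (R \<alpha>) (R \<beta>) \<inter> R ` K = {}" using K_coord by blast
  then show ?thesis using that ab gap(3) by blast
qed

lemma real_function: "is_real_fun F"
  unfolding is_real_fun_def
proof
  fix z
  have "F (\<psi> (map_option cnj (\<phi> z))) = map_option cnj (F (\<psi> (\<phi> z)))"
    using is_real[of "\<phi> z"] by simp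
  then show "F (map_option cnj z) = map_option cnj (F z)"
    by (simp add: \<psi>_cnj \<psi>\<phi>)
qed

lemma zeros_separated:
  assumes "x1 \<noteq> x2" "div0 F D x1 \<ge> 1" "div0 F D x2 \<ge> 1"
  shows "\<exists>y\<in>E \<inter> cint x1 x2. abs_one F y"
proof -
  obtain t1 t2 where t: "x1 = \<psi> (R t1)" "poly U t1 = 0" "x2 = \<psi> (R t2)" "poly U t2 = 0"
    using div0_pos_coord[of x1] div0_pos_coord[of x2] assms by auto
  then obtain y where y: "y \<in> E.X" "R y \<in> cint (R t1) (R t2)"
    using extremal_in_cint[of t1 t2] assms(1) by blast
  then show ?thesis
    using K_coord[OF X_K] abs_one_coord[OF X_K] by (auto simp: t cint_coord intro!: bexI[of _ "\<psi> (R y)"])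
qed

lemma gap_zero:
  assumes "is_gap E a b" "x \<in> cint a b" "y \<in> cint a b" "div0 F D x > 0" "div0 F D y > 0"
  shows "x = y"
proof -
  obtain \<alpha> \<beta> where ab: "a = \<psi> (R \<alpha>)" "b = \<psi> (R \<beta>)" "\<alpha> \<in> K" "\<beta> \<in> K" "\<alpha> \<noteq> \<beta>"
    "cint (R \<alpha>) (R \<beta>) \<inter> R ` K = {}"
    using gap_coord[OF assms(1)] by blast
  obtain t1 t2 where t: "x = \<psi> (R t1)" "poly U t1 = 0" "y = \<psi> (R t2)" "poly U t2 = 0"
    using div0_pos_coord[of x] div0_pos_coord[of y] assms by auto
  show ?thesis using gap_zero_unique[OF ab(3-6) t(2,4)] assms(2,3) by (simp add: t ab cint_coord)
qed

lemma gap_pole: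
  assumes "is_gap E a b" "c \<in> cint a b" "D c > 0"
  shows "(abs_one F a \<or> abs_one F b) \<and> (div0 F D c = 1 \<longrightarrow> abs_one F a \<and> abs_one F b)"
proof -
  obtain \<alpha> \<beta> where ab: "a = \<psi> (R \<alpha>)" "b = \<psi> (R \<beta>)" "\<alpha> \<in> K" "\<beta> \<in> K" "\<alpha> \<noteq> \<beta>"
    "cint (R \<alpha>) (R \<beta>) \<inter> R ` K = {}"
    using gap_coord[OF assms(1)] by blast
  have c: "c = \<psi> (\<phi> c)" by (simp only: \<psi>\<phi>)
  have c': "\<phi> c \<in> cint (R \<alpha>) (R \<beta>)" "(D \<circ> \<psi>) (\<phi> c) > 0"
    using assms(2,3) cint_coord[of "\<phi> c"] by (simp_all add: \<psi>\<phi> ab(1,2))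
  show ?thesis using pole_gap[OF ab(3-6) c'] abs_one_coord[OF ab(3)] abs_one_coord[OF ab(4)] div0_coord[of "\<phi> c"]
    unfolding ab(1,2) \<psi>\<phi> by auto
qed

lemma pole_free_gap:
  assumes "is_gap E a b" "xs \<in> cint a b"
  shows "x \<in> cint a b \<Longrightarrow> div0 F D x = 0"
    "F a = Some ((-1) ^ nat (sum D (cint a xs \<inter> {c. D c \<noteq> 0})))"
    "F b = Some ((-1) ^ nat (sum D (cint_lc xs b \<inter> {c. D c \<noteq> 0})))"
proof -
  obtain \<alpha> \<beta> where ab: "a = \<psi> (R \<alpha>)" "b = \<psi> (R \<beta>)" "\<alpha> \<in> K" "\<beta> \<in> K" "\<alpha> \<noteq> \<beta>"
    "cint (R \<alpha>) (R \<beta>) \<inter> R ` K = {}"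
    using gap_coord[OF assms(1)] by blast
  \<comment> \<open>In the new coordinate the gap of the extremal point is the one through infinity,
    where the sign counts apply.\<close>
  have None: "None \<in> cint (R \<alpha>) (R \<beta>)"
    using assms(2) cint_coord[of None "R \<alpha>" "R \<beta>"] by (simp only: ab(1,2) \<psi>_None)
  show "div0 F D x = 0" if x: "x \<in> cint a b"
  proof -
    have "\<phi> x \<in> cint (R \<alpha>) (R \<beta>)" using x cint_coord[of "\<phi> x"] by (simp add: \<psi>\<phi> ab(1,2))
    then have "div0 (F \<circ> \<psi>) (D \<circ> \<psi>) (\<phi> x) = 0" by (rule outer_gap_div0[OF ab(3-6) None])
    then show ?thesis using div0_coord[of "\<phi> x"] by (simp only: \<psi>\<phi>)
  qed
  have cints: "\<psi> ` cint (R \<alpha>) None = cint a xs" "\<psi> ` cint_lc None (R \<beta>) = cint_lc xs b"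
    using \<psi>_cint[of a xs] \<psi>_cint[of xs b] unfolding ab(1,2) \<phi>\<psi> \<phi>_xs cint_lc_def image_insert \<psi>_None
    by simp_all
  show "F a = Some ((-1) ^ nat (sum D (cint a xs \<inter> {c. D c \<noteq> 0})))"
    using value_right_end[OF ab(3-6) None] unfolding sum_\<psi> cints by (simp only: ab(1) comp_apply)
  show "F b = Some ((-1) ^ nat (sum D (cint_lc xs b \<inter> {c. D c \<noteq> 0})))"
    using value_left_end[OF ab(3-6) None] unfolding sum_\<psi> cints by (simp only: ab(2) comp_apply)
qed

lemma is_const_\<psi>: "is_const (F \<circ> \<psi>) \<longleftrightarrow> is_const F"
proof
  assume "is_const (F \<circ> \<psi>)"
  then obtain c where c: "\<And>z. F (\<psi> z) = c" by (auto simp: is_const_def)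
  have "F z = c" for z using c[of "\<phi> z"] by (simp only: \<psi>\<phi>)
  then show "is_const F" by (auto simp: is_const_def)
qed (auto simp: is_const_def)

lemma rat_deg_coord: "rat_deg F = int (degree p)"
proof -
  have "polar_div (F \<circ> \<psi>) = polar_div F \<circ> \<psi>" using polar_div_\<psi>[OF ratfun] by (simp add: fun_eq_iff)
  then show ?thesis using rat_deg_F by (simp add: rat_deg_def div_deg_\<psi>)
qed

end

locale normalized_nonconstant = normalized_solution +
  assumes nonconst_F: "\<not> is_const F"
begin

sublocale infinity_nonconstant K "D \<circ> \<psi>" n "F \<circ> \<psi>" U p q s
  by unfold_locales (simp add: is_const_\<psi> nonconst_F)

definition arc :: "real \<Rightarrow> complex option set" where
  "arc z = (\<lambda>t. \<psi> (R t)) ` I.band z"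

lemma preimage_Rbar: "real_preim F {-1..1} \<subseteq> Rbar"
  using preimage_closed \<psi>_Rbar by (subst real_preim_\<psi>) blast

lemma unit_points_coord: "{x. F x = Some 1 \<or> F x = Some (-1)} = \<psi> ` R ` (I.lo ` I.Z \<union> I.hi ` I.Z)"
proof -
  have "\<psi> ` {x. (F \<circ> \<psi>) x = Some 1 \<or> (F \<circ> \<psi>) x = Some (-1)} = {x. F x = Some 1 \<or> F x = Some (-1)}"
    (is "\<psi> ` ?A = ?B")
  proof
    show "\<psi> ` ?A \<subseteq> ?B" by auto
    show "?B \<subseteq> \<psi> ` ?A"
    proof
      fix x assume "x \<in> ?B"
      then have "\<phi> x \<in> ?A" by (simp add: \<psi>\<phi>)
      then have "\<psi> (\<phi> x) \<in> \<psi> ` ?A" by (rule imageI)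
      then show "x \<in> \<psi> ` ?A" by (simp only: \<psi>\<phi>)
    qed
  qed
  then show ?thesis by (simp only: unit_points)
qed

lemma lo_less_hi: "z \<in> I.Z \<Longrightarrow> I.lo z < I.hi z"
  using I.lo(1) I.hi(1) by (meson less_trans)

lemma sph_arc: "sph ` arc z = (\<lambda>t. sph (\<psi> (R t))) ` I.band z"
  by (simp add: arc_def image_image)

text \<open>All bands avoid the extremal point, where F is outside [-1,1]. They therefore lie on the
  curve that parametrizes the rest of the real circle injectively, and their components are those of
  real intervals.\<close>

lemma bands_eq: "bands F = arc ` I.Z"
proof -
  have "sph ` real_preim F {-1<..<1} = (\<Union>z\<in>I.Z. (\<lambda>t. sph (\<psi> (R t))) ` {I.lo z<..<I.hi z})"
    by (subst real_preim_\<psi>) (simp add: preimage_open image_UN image_image I.band_def)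
  then have "components (sph ` real_preim F {-1<..<1}) = (\<lambda>z. sph ` arc z) ` I.Z"
    unfolding sph_arc I.band_def
    by (simp only: components_curve_intervals[OF I.finite_Z lo_less_hi I.bands_ordered continuous_sph_\<psi> inj_curve])
  then show ?thesis
    unfolding bands_def by (simp add: image_image inj_vimage_image_eq[OF inj_sph])
qed

lemma inj_arc: "inj_on arc I.Z"
proof (rule inj_onI)
  fix z z' assume z: "z \<in> I.Z" "z' \<in> I.Z" "arc z = arc z'"
  have "\<psi> (R z) \<in> arc z'" using z(3) I.zero_in_band[OF z(1)] by (auto simp: arc_def)
  then obtain t where "\<psi> (R z) = \<psi> (R t)" "t \<in> I.band z'" by (auto simp: arc_def)
  moreover from this have "R z = R t" using injD[OF inj_\<psi>] by blast
  ultimately have "z \<in> I.band z'" by simp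
  then show "z = z'" using I.bands_disjoint[OF z(1,2) I.zero_in_band[OF z(1)]] by blast
qed

lemma card_bands: "finite (bands F)" "card (bands F) = degree p"
  using I.finite_Z I.card_Z inj_arc by (simp_all add: bands_eq card_image)

lemma F_arc: "z \<in> I.Z \<Longrightarrow> t \<in> I.band z \<Longrightarrow> F (\<psi> (R t)) = R (I.f t)"
  using F_band by simp

lemma arc_mono: "z \<in> I.Z \<Longrightarrow> cyc_strict_mono_on (arc z) F"
  unfolding arc_def
proof (rule cyc_strict_mono_on_curve[where f = I.f])
  show "cyc_ordered [\<psi> (R x), \<psi> (R y), \<psi> (R z)] \<longleftrightarrow> cyc_ordered [R x, R y, R z]" for x y z
    using cyc[of "[\<psi> (R x), \<psi> (R y), \<psi> (R z)]"] by (simp add: \<phi>\<psi>)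
qed (use F_arc I.monotone_on_band in auto)

lemma arc_image:
  assumes "z \<in> I.Z"
  shows "F ` arc z = R ` {-1<..<1}"
proof -
  have "F ` arc z = (\<lambda>t. R (I.f t)) ` I.band z"
    unfolding arc_def image_image using F_arc[OF assms] by (intro image_cong) auto
  also have "\<dots> = R ` I.f ` I.band z" by (simp add: image_image)
  finally show ?thesis by (simp only: I.image_band[OF assms])
qed

lemma endpoints_arc:
  assumes "z \<in> I.Z"
  shows "endpoints (arc z) = {\<psi> (R (I.lo z)), \<psi> (R (I.hi z))}"
proof -
  have "closure (sph ` arc z) = sph ` (\<lambda>t. \<psi> (R t)) ` {I.lo z..I.hi z}"
    unfolding sph_arc I.band_def image_image
    by (rule closure_inj_image_interval[OF continuous_sph_\<psi> lo_less_hi[OF assms]])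
  then have "{x. sph x \<in> closure (sph ` arc z)} = (\<lambda>t. \<psi> (R t)) ` {I.lo z..I.hi z}"
    using injD[OF inj_sph] by auto
  moreover have "inj (\<lambda>t. \<psi> (R t))"
  proof (rule injI)
    fix s t assume "\<psi> (R s) = \<psi> (R t)"
    then have "R s = R t" by (rule injD[OF inj_\<psi>])
    then show "s = t" by simp
  qed
  ultimately have "endpoints (arc z) = (\<lambda>t. \<psi> (R t)) ` ({I.lo z..I.hi z} - I.band z)"
    unfolding endpoints_def arc_def by (simp add: image_set_diff)
  also have "{I.lo z..I.hi z} - I.band z = {I.lo z, I.hi z}"
    using lo_less_hi[OF assms] by (auto simp: I.band_def)
  finally show ?thesis by simp
qed

lemma union_endpoints: "(\<Union>B\<in>bands F. endpoints B) = {x. F x = Some 1 \<or> F x = Some (-1)}"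
  unfolding bands_eq unit_points_coord using endpoints_arc by auto

end

theorem theorem2p3:
  fixes E :: "complex option set" and D :: "complex option \<Rightarrow> int" and n :: nat
    and xs a b :: "complex option" and F :: "complex option \<Rightarrow> complex option"
  assumes E_sub: "E \<subseteq> Rbar" and E_compact: "compact (sph ` E)"
    and E_proper: "E \<noteq> Rbar" and E_inf: "infinite E"
    and n_pos: "n \<ge> 1"
    and D_fin: "finite {x. D x \<noteq> 0}" and D_nonneg: "\<forall>x. D x \<ge> 0"
    and D_deg: "div_deg D = int n"
    and D_supp: "\<forall>x. D x \<noteq> 0 \<longrightarrow> x \<in> Rbar - E"
    and xs: "xs \<in> Rbar - E"
    and max: "is_maximizer E D xs F"
    and gap: "is_gap E a b" "xs \<in> cint a b"
  shows
    "(\<forall>x. div0 F D x > 0 \<longrightarrow> x \<in> Rbar)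
   \<and> is_real_fun F
   \<and> (\<forall>x1 \<in> Rbar. \<forall>x2 \<in> Rbar. x1 \<noteq> x2 \<and> div0 F D x1 \<ge> 1 \<and> div0 F D x2 \<ge> 1 \<longrightarrow>
        (\<exists>y \<in> E \<inter> cint x1 x2. abs_one F y))
   \<and> (\<forall>x. div0 F D x \<le> 1)
   \<and> (\<forall>a' b'. is_gap E a' b' \<longrightarrow>
        (\<forall>x \<in> cint a' b'. \<forall>y \<in> cint a' b'. div0 F D x > 0 \<and> div0 F D y > 0 \<longrightarrow> x = y))
   \<and> (\<forall>x \<in> cint a b. div0 F D x = 0)
   \<and> (\<forall>G. is_maximizer E D xs G \<longrightarrow> G = F)
   \<and> (\<not> is_const F \<longrightarrow>
        real_preim F {-1..1} \<subseteq> Rbar \<and> {z. F z = Some 1 \<or> F z = Some (-1)} \<subseteq> Rbar)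
   \<and> (\<forall>m. \<not> is_const F \<and> rat_deg F = int m \<longrightarrow>
        finite (bands F) \<and> card (bands F) = m
        \<and> (\<forall>B \<in> bands F. cyc_strict_mono_on B F
              \<and> F ` B = (\<lambda>t. Some (complex_of_real t)) ` {-1<..<1})
        \<and> (\<Union>B \<in> bands F. endpoints B) = {z. F z = Some 1 \<or> F z = Some (-1)})
   \<and> F a = Some ((-1) ^ nat (sum D (cint a xs \<inter> {c. D c \<noteq> 0})))
   \<and> F b = Some ((-1) ^ nat (sum D (cint_lc xs b \<inter> {c. D c \<noteq> 0})))
   \<and> (\<forall>ai bi ci. is_gap E ai bi \<and> ci \<in> cint ai bi \<and> D ci > 0 \<longrightarrow>
        (abs_one F ai \<or> abs_one F bi)
        \<and> (div0 F D ci = 1 \<longrightarrow> abs_one F ai \<and> abs_one F bi))"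
proof -
  obtain \<phi> \<psi> where "normalization \<phi> \<psi> xs" using ex_normalization xs by blast
  then interpret N: normalization \<phi> \<psi> xs .
  define K where "K = (\<lambda>x. Re (the (\<phi> x))) ` E"
  have E_image: "\<phi> ` E = R ` K" unfolding K_def using N.real_coordinates E_sub xs by blast
  have "infinite (\<phi> ` E)"
  proof -
    have "inj_on \<phi> E" by (rule inj_on_inverseI) (rule N.\<psi>\<phi>)
    then show ?thesis using E_inf finite_imageD by blast
  qed
  then have K_inf: "infinite K" unfolding E_image by auto
  have K_compact: "compact K" unfolding K_def using N.compact_\<phi> E_sub E_compact xs by blast
  interpret P: infinity_problem K "D \<circ> \<psi>" n
  proof
    have "{x. (D \<circ> \<psi>) x \<noteq> 0} = \<psi> -` {x. D x \<noteq> 0}" by auto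
    then show "finite {x. (D \<circ> \<psi>) x \<noteq> 0}" using finite_vimageI[OF D_fin N.inj_\<psi>] by simp
    show "x \<in> Rbar - R ` K" if "(D \<circ> \<psi>) x \<noteq> 0" for x
    proof -
      have "\<psi> x \<in> Rbar - E" using D_supp that by simp
      moreover have "x \<in> Rbar" using calculation N.\<phi>_Rbar[of "\<psi> x"] by (simp add: N.\<phi>\<psi>)
      moreover have "x \<notin> \<phi> ` E" using calculation(1) by (auto simp: N.\<psi>\<phi>)
      ultimately have "x \<in> Rbar" "x \<notin> \<phi> ` E" by blast+
      then show ?thesis by (simp add: E_image)
    qed
    show "div_deg (D \<circ> \<psi>) = int n" using D_deg by (simp only: N.div_deg_\<psi>)
    show "(D \<circ> \<psi>) x \<ge> 0" for x using D_nonneg by simp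
  qed (fact K_compact K_inf n_pos)+
  have maximizer: "is_maximizer (R ` K) (D \<circ> \<psi>) None (G \<circ> \<psi>)" if "is_maximizer E D xs G" for G
    using N.is_maximizer_\<psi>[OF that] by (simp only: E_image)
  obtain U p q s where sol: "infinity_solution K (D \<circ> \<psi>) n (F \<circ> \<psi>) U p q s"
    using P.maximizer_solution[OF maximizer[OF max]] by blast
  have "is_ratfun F" using max by (simp add: is_maximizer_def admissible_def Lspace_def)
  then interpret S: normalized_solution \<phi> \<psi> xs K D n F U p q s E
    by (intro normalized_solution.intro normalized_solution_axioms.intro
        N.normalization_axioms sol E_sub E_image)
  have nonneg: "div0 F D x > 0 \<Longrightarrow> x \<in> Rbar" for x
    using S.div0_pos_coord[of x] N.\<psi>_Rbar[OF R_in_Rbar] by auto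
  have le1: "div0 F D x \<le> 1" for x
    using S.div0_le_1[of "\<phi> x"] S.div0_coord[of "\<phi> x"] by (simp add: N.\<psi>\<phi>)
  have unique: "G = F" if "is_maximizer E D xs G" for G
  proof
    fix x
    have "G \<circ> \<psi> = F \<circ> \<psi>" by (rule P.maximizer_unique[OF maximizer[OF that] maximizer[OF max]])
    from fun_cong[OF this, of "\<phi> x"] show "G x = F x" by (simp add: N.\<psi>\<phi>)
  qed
  have bands: "real_preim F {-1..1} \<subseteq> Rbar"
    "finite (bands F) \<and> card (bands F) = m
      \<and> (\<forall>B \<in> bands F. cyc_strict_mono_on B F
            \<and> F ` B = (\<lambda>t. Some (complex_of_real t)) ` {-1<..<1})
      \<and> (\<Union>B \<in> bands F. endpoints B) = {z. F z = Some 1 \<or> F z = Some (-1)}"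
    if nc: "\<not> is_const F" and m: "rat_deg F = int m" for m
  proof -
    interpret C: normalized_nonconstant \<phi> \<psi> xs K D n F U p q s E
      by (intro normalized_nonconstant.intro normalized_nonconstant_axioms.intro
          S.normalized_solution_axioms nc)
    show "real_preim F {-1..1} \<subseteq> Rbar" by (rule C.preimage_Rbar)
    have "degree p = m" using m S.rat_deg_coord by simp
    moreover have "cyc_strict_mono_on B F \<and> F ` B = R ` {-1<..<1}" if "B \<in> bands F" for B
      using that C.arc_mono C.arc_image unfolding C.bands_eq by blast
    ultimately show "finite (bands F) \<and> card (bands F) = m
      \<and> (\<forall>B \<in> bands F. cyc_strict_mono_on B F
            \<and> F ` B = (\<lambda>t. Some (complex_of_real t)) ` {-1<..<1})
      \<and> (\<Union>B \<in> bands F. endpoints B) = {z. F z = Some 1 \<or> F z = Some (-1)}"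
      using C.card_bands C.union_endpoints by blast
  qed
  have preim: "real_preim F {-1..1} \<subseteq> Rbar" if "\<not> is_const F"
    using bands(1)[OF that S.rat_deg_coord] .
  have "{z. F z = Some 1 \<or> F z = Some (-1)} \<subseteq> real_preim F {-1..1}"
  proof safe
    fix z assume "F z = Some 1"
    then have "F z = R 1" by simp
    then show "z \<in> real_preim F {-1..1}" unfolding real_preim_def by (intro CollectI bexI[of _ 1]) auto
  next
    fix z assume "F z = Some (-1)"
    then have "F z = R (-1)" by simp
    then show "z \<in> real_preim F {-1..1}" unfolding real_preim_def by (intro CollectI bexI[of _ "-1"]) auto
  qed
  then have units: "{z. F z = Some 1 \<or> F z = Some (-1)} \<subseteq> Rbar" if "\<not> is_const F"
    using preim[OF that] by blast
  show ?thesis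
  proof (intro conjI)
    show "\<forall>x1\<in>Rbar. \<forall>x2\<in>Rbar. x1 \<noteq> x2 \<and> div0 F D x1 \<ge> 1 \<and> div0 F D x2 \<ge> 1 \<longrightarrow>
        (\<exists>y\<in>E \<inter> cint x1 x2. abs_one F y)"
      using S.zeros_separated by blast
    show "\<forall>a' b'. is_gap E a' b' \<longrightarrow>
        (\<forall>x\<in>cint a' b'. \<forall>y\<in>cint a' b'. div0 F D x > 0 \<and> div0 F D y > 0 \<longrightarrow> x = y)"
      using S.gap_zero by blast
    show "\<forall>ai bi ci. is_gap E ai bi \<and> ci \<in> cint ai bi \<and> D ci > 0 \<longrightarrow>
        (abs_one F ai \<or> abs_one F bi) \<and> (div0 F D ci = 1 \<longrightarrow> abs_one F ai \<and> abs_one F bi)"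
      using S.gap_pole by blast
    show "\<not> is_const F \<longrightarrow>
        real_preim F {-1..1} \<subseteq> Rbar \<and> {z. F z = Some 1 \<or> F z = Some (-1)} \<subseteq> Rbar"
      using preim units by blast
    show "\<forall>m. \<not> is_const F \<and> rat_deg F = int m \<longrightarrow>
        finite (bands F) \<and> card (bands F) = m
        \<and> (\<forall>B \<in> bands F. cyc_strict_mono_on B F
              \<and> F ` B = (\<lambda>t. Some (complex_of_real t)) ` {-1<..<1})
        \<and> (\<Union>B \<in> bands F. endpoints B) = {z. F z = Some 1 \<or> F z = Some (-1)}"
      by (intro allI impI bands(2)) (erule conjunct1, erule conjunct2)
    show "is_real_fun F" by (rule S.real_function)
    show "\<forall>x. div0 F D x > 0 \<longrightarrow> x \<in> Rbar" using nonneg by blast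
    show "\<forall>x. div0 F D x \<le> 1" using le1 by blast
    show "\<forall>x\<in>cint a b. div0 F D x = 0" using S.pole_free_gap(1)[OF gap] by blast
    show "\<forall>G. is_maximizer E D xs G \<longrightarrow> G = F" using unique by blast
  qed (rule S.pole_free_gap[OF gap])+
qed

end
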